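(* The family $\{X'_{-\lambda}\}_{\lambda\in\mathcal{P}}$, indexed by all partitions, is a basis of $\Lambda_{\mathbb{Q}(\alpha)}$ over $\mathbb{Q}(\alpha)$.
   Context: **Fock space and vertex operators.** Fix a positive integer $\alpha$. Let $V=\mathbb{C}[h_{-1},h_{-2},\dots]\otimes\mathbb{C}[\tfrac12\mathbb{Z}]$, where $\mathbb{C}[\tfrac12\mathbb{Z}]$ has basis $e^{mh}$ ($m\in\tfrac12\mathbb{Z}$). - For $n>0$, $h_{-n}$ acts by multiplication on the first factor. - For $n>0$, $h_n$ acts by $\alpha^{-1}n\,\partial/\partial h_{-n}$ on the first factor. - For a formal variable $z$, $A$ acts by $A(v\otimes e^{mh})=z^{(2m+1)\alpha}\,v\otimes e^{(m+1)h}$. Define the operators $X_n$ ($n\in\mathbb{Z}$) by $$X(z)=\exp\Big(\sum_{n\ge1}\frac{\alpha h_{-n}}{n}z^n\Big)\,A\,\exp\Big(-\sum_{n\ge1}\frac{2\alpha h_n}{n}z^{-n}\Big)=\sum_{n\in\mathbb{Z}}X_nz^{-n}.$$ For a partition $\lambda=(\lambda_1,\dots,\lambda_l)$ with $l=l(\lambda)$, set $X_{-\lambda}=X_{-\lambda_1}\cdots X_{-\lambda_l}$. Let $T:V\to\Lambda_{\mathbb{Q}}\otimes\mathbb{C}$ be the linear map $T(h_{-\mu_1}h_{-\mu_2}\cdots\otimes e^{mh})=p_\mu$, where $p_\mu$ are power-sum symmetric functions. Put $c_s(\alpha)=(-1)^{s(s-1)\alpha/2}(s\alpha)!/(\alpha!)^s$.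 **Definition of $X'_{-\lambda}$.** It is known that for every partition $\lambda$ there exists an element of $\Lambda_{\mathbb{Q}(\alpha)}$, with $\alpha$ now an indeterminate, with the following properties: - its coefficients in the power-sum basis are rational functions of $\alpha$ defined at every positive integer; - its specialization at every positive integer $\alpha$ equals $c_{l(\lambda)}(\alpha)^{-1}T(X_{-\lambda}e^{-l(\lambda)h/2})$. Such an element is unique, and it is denoted $X'_{-\lambda}$. *)

theory Defs
  imports
    Complex_Main
    "HOL-Library.Multiset"
    "HOL-Library.Poly_Mapping"
    "HOL-Library.Product_Plus"
    "HOL-Library.Function_Algebras"
    "HOL-Computational_Algebra.Polynomial"
    "HOL-Computational_Algebra.Fraction_Field"
begin

section \<open>Partitions\<close>

definition is_partition :: "nat list \<Rightarrow> bool" where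
  "is_partition lam \<longleftrightarrow> sorted_wrt (\<ge>) lam \<and> (\<forall>i\<in>set lam. 0 < i)"


section \<open>Symmetric functions in infinitely many variables\<close>

text \<open>
  A monomial in the variables \<open>x\<^sub>0, x\<^sub>1, \<dots>\<close> is the multiset of the indices of its variables; a
  formal power series is its coefficient function. Addition and zero of series are those of
  \<^theory>\<open>HOL-Library.Function_Algebras\<close>; its pointwise multiplication is not used, the product of
  series is \<open>fmul\<close>.
\<close>

type_synonym 'a series = "nat multiset \<Rightarrow> 'a"

definition smul :: "'a::comm_ring_1 \<Rightarrow> 'a series \<Rightarrow> 'a series" where
  "smul c f = (\<lambda>m. c * f m)"

definition fone :: "'a::comm_ring_1 series" where
  "fone = (\<lambda>m. if m = {#} then 1 else 0)"

definition fmul :: "'a::comm_ring_1 series \<Rightarrow> 'a series \<Rightarrow> 'a series" where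
  "fmul f g = (\<lambda>m. \<Sum>(a, b) \<in> {(a, b). a + b = m}. f a * g b)"

definition symmetric_functions :: "'a::comm_ring_1 series set" where
  "symmetric_functions =
     {f. (\<exists>d. \<forall>m. f m \<noteq> 0 \<longrightarrow> size m \<le> d) \<and>
         (\<forall>\<pi> m. bij \<pi> \<longrightarrow> f (image_mset \<pi> m) = f m)}"

definition power_sum :: "nat \<Rightarrow> 'a::comm_ring_1 series" where
  "power_sum n = (\<lambda>m. if \<exists>i. m = replicate_mset n i then 1 else 0)"

definition psum :: "nat list \<Rightarrow> 'a::comm_ring_1 series" where
  "psum mu = foldr (\<lambda>n f. fmul (power_sum n) f) mu fone"

lemma vector_space_smul: "vector_space (smul :: 'a::field \<Rightarrow> 'a series \<Rightarrow> 'a series)"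
  by unfold_locales (auto simp: smul_def fun_eq_iff algebra_simps)


section \<open>The Fock space\<close>

text \<open>
  \<open>V\<close> is the monoid algebra over the complex numbers with basis the pairs \<open>(M, k)\<close>. The pair
  \<open>(M, k)\<close> stands for the product of the \<open>h\<^sub>-\<^sub>(\<^sub>i\<^sub>+\<^sub>1\<^sub>)\<close>, \<open>i\<close> in the multiset \<open>M\<close>, tensored with \<open>e\<^sup>m\<^sup>h\<close>,
  where \<open>m = k/2\<close>. Indices are shifted by one, so that there is no variable \<open>h\<^sub>0\<close>.
\<close>

type_synonym fock = "(nat multiset \<times> int) \<Rightarrow>\<^sub>0 complex"

definition vscale :: "complex \<Rightarrow> fock \<Rightarrow> fock" where
  "vscale c v = Poly_Mapping.map ((*) c) v"

text \<open>\<open>vac k\<close> is \<open>e\<^sup>m\<^sup>h\<close> with \<open>m = k/2\<close>.\<close>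

definition vac :: "int \<Rightarrow> fock" where
  "vac k = Poly_Mapping.single ({#}, k) 1"

text \<open>\<open>h_neg n\<close> is the action of \<open>h\<^sub>-\<^sub>n\<close> and \<open>h_pos \<alpha> n\<close> that of \<open>h\<^sub>n\<close>, for \<open>n \<ge> 1\<close> only.\<close>

definition h_neg :: "nat \<Rightarrow> fock \<Rightarrow> fock" where
  "h_neg n v = Poly_Mapping.single ({#n - 1#}, 0) 1 * v"

definition d_h_neg :: "nat \<Rightarrow> fock \<Rightarrow> fock" where
  "d_h_neg n v =
     (\<Sum>(M, k) \<in> Poly_Mapping.keys v.
        Poly_Mapping.single (M - {#n - 1#}, k)
          (of_nat (count M (n - 1)) * Poly_Mapping.lookup v (M, k)))"

definition h_pos :: "nat \<Rightarrow> nat \<Rightarrow> fock \<Rightarrow> fock" where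
  "h_pos \<alpha> n v = vscale (of_nat n / of_nat \<alpha>) (d_h_neg n v)"

text \<open>
  The coefficient of \<open>z\<^sup>d\<close> in \<open>A\<close>. With \<open>m = k/2\<close> the exponent \<open>(2m+1)\<alpha>\<close> is \<open>(k+1)\<alpha>\<close>, and
  \<open>m \<mapsto> m+1\<close> is \<open>k \<mapsto> k+2\<close>.
\<close>

definition A_coeff :: "nat \<Rightarrow> int \<Rightarrow> fock \<Rightarrow> fock" where
  "A_coeff \<alpha> d v =
     (\<Sum>(M, k) \<in> {(M, k) \<in> Poly_Mapping.keys v. (k + 1) * int \<alpha> = d}.
        Poly_Mapping.single (M, k + 2) (Poly_Mapping.lookup v (M, k)))"


section \<open>Exponentials of power series of operators\<close>

text \<open>
  A sequence \<open>B\<close> of operators on \<open>V\<close> stands for the formal power series with coefficient \<open>B n\<close> at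
  the \<open>n\<close>-th power of the variable. The exponential is meant for \<open>B 0 = 0\<close>; only the powers \<open>k \<le> n\<close>
  of \<open>B\<close> then contribute to its \<open>n\<close>-th coefficient.
\<close>

type_synonym op_series = "nat \<Rightarrow> fock \<Rightarrow> fock"

fun op_power :: "op_series \<Rightarrow> nat \<Rightarrow> op_series" where
  "op_power B 0 n v = (if n = 0 then v else 0)"
| "op_power B (Suc k) n v = (\<Sum>i\<le>n. B i (op_power B k (n - i) v))"

definition op_exp :: "op_series \<Rightarrow> op_series" where
  "op_exp B n v = (\<Sum>k\<le>n. vscale (1 / fact k) (op_power B k n v))"


section \<open>The vertex operator\<close>

text \<open>\<open>E_minus\<close> is a power series in \<open>z\<^sup>-\<^sup>1\<close>.\<close>

definition E_plus :: "nat \<Rightarrow> op_series" where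
  "E_plus \<alpha> =
     op_exp (\<lambda>n v. if n = 0 then 0 else vscale (of_nat \<alpha> / of_nat n) (h_neg n v))"

definition E_minus :: "nat \<Rightarrow> op_series" where
  "E_minus \<alpha> =
     op_exp (\<lambda>n v. if n = 0 then 0 else vscale (- (2 * of_nat \<alpha> / of_nat n)) (h_pos \<alpha> n v))"

text \<open>
  \<open>X_mode \<alpha> n\<close> is \<open>X\<^sub>n\<close>, the coefficient of \<open>z\<^sup>-\<^sup>n\<close> in \<open>X(z)\<close>. For a given \<open>v\<close> only finitely many
  terms of the sum are nonzero, as \<open>E_minus \<alpha> j v = 0\<close> for large \<open>j\<close>.
\<close>

definition X_mode :: "nat \<Rightarrow> int \<Rightarrow> fock \<Rightarrow> fock" where
  "X_mode \<alpha> n v =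
     Sum_any (\<lambda>(i, d, j).
       E_plus \<alpha> i (A_coeff \<alpha> d (E_minus \<alpha> j v)) when int i + d - int j = - n)"

definition X_minus :: "nat \<Rightarrow> nat list \<Rightarrow> fock \<Rightarrow> fock" where
  "X_minus \<alpha> lam v = foldr (\<lambda>i. X_mode \<alpha> (- int i)) lam v"

definition T :: "fock \<Rightarrow> complex series" where
  "T v = (\<Sum>(M, k) \<in> Poly_Mapping.keys v.
            smul (Poly_Mapping.lookup v (M, k))
              (psum (rev (map Suc (sorted_list_of_multiset M)))))"

definition c_const :: "nat \<Rightarrow> nat \<Rightarrow> complex" where
  "c_const s \<alpha> = (-1) ^ (s * (s - 1) * \<alpha> div 2) * fact (s * \<alpha>) / fact \<alpha> ^ s"


section \<open>The family over the field of rational functions\<close>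

type_synonym ratfun = "rat poly fract"

definition regular_at :: "ratfun \<Rightarrow> rat \<Rightarrow> bool" where
  "regular_at f x \<longleftrightarrow> (\<exists>a b. f = Fract a b \<and> poly b x \<noteq> 0)"

definition rf_value :: "ratfun \<Rightarrow> rat \<Rightarrow> rat" where
  "rf_value f x = (THE y. \<exists>a b. f = Fract a b \<and> poly b x \<noteq> 0 \<and> y = poly a x / poly b x)"

lemma rf_value_Fract:
  assumes "poly b x \<noteq> 0"
  shows "rf_value (Fract a b) x = poly a x / poly b x"
  unfolding rf_value_def
proof (rule the_equality)
  show "\<exists>a' b'. Fract a b = Fract a' b' \<and> poly b' x \<noteq> 0 \<and>
          poly a x / poly b x = poly a' x / poly b' x"
    using assms by blast
next
  fix y
  assume "\<exists>a' b'. Fract a b = Fract a' b' \<and> poly b' x \<noteq> 0 \<and> y = poly a' x / poly b' x"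
  then obtain a' b' where *: "Fract a b = Fract a' b'" "poly b' x \<noteq> 0" "y = poly a' x / poly b' x"
    by blast
  moreover have "b \<noteq> 0" "b' \<noteq> 0"
    using assms *(2) by auto
  ultimately have "a * b' = a' * b"
    by (simp add: eq_fract)
  then have "poly a x * poly b' x = poly a' x * poly b x"
    by (metis poly_mult)
  then show "y = poly a x / poly b x"
    using assms * by (simp add: frac_eq_eq)
qed

text \<open>
  \<open>is_X_prime lam F\<close> is the characterisation of \<open>F = X'\<^sub>-\<^sub>\<lambda>\<close>: the finitely supported \<open>a\<close> is the
  expansion of \<open>F\<close> in the power sums, and the specialisation is taken coefficientwise. The tensor
  product of the rational symmetric functions with the complex numbers is identified with the
  complex symmetric functions.
\<close>

definition is_X_prime :: "nat list \<Rightarrow> ratfun series \<Rightarrow> bool" where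
  "is_X_prime lam F \<longleftrightarrow>
     (\<exists>a :: nat list \<Rightarrow>\<^sub>0 ratfun.
        (\<forall>mu \<in> Poly_Mapping.keys a. is_partition mu) \<and>
        F = (\<Sum>mu \<in> Poly_Mapping.keys a. smul (Poly_Mapping.lookup a mu) (psum mu)) \<and>
        (\<forall>mu \<in> Poly_Mapping.keys a. \<forall>n::nat. 0 < n \<longrightarrow>
           regular_at (Poly_Mapping.lookup a mu) (of_nat n)) \<and>
        (\<forall>n::nat. 0 < n \<longrightarrow>
           (\<Sum>mu \<in> Poly_Mapping.keys a.
              smul (of_rat (rf_value (Poly_Mapping.lookup a mu) (of_nat n))) (psum mu)) =
           smul (inverse (c_const (length lam) n))
             (T (X_minus n lam (vac (- int (length lam)))))))"

definition X_prime :: "nat list \<Rightarrow> ratfun series" where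
  "X_prime lam = (THE F. is_X_prime lam F)"

end

theory Submission
  imports
    Defs
    "HOL-Computational_Algebra.Polynomial_FPS"
    "HOL-Computational_Algebra.Polynomial_Factorial"
    "HOL-Combinatorics.Permutations"
begin

text \<open>
  Normal ordering shows that \<open>X\<^sub>-\<^sub>\<lambda> e\<^sup>-\<^sup>s\<^sup>h\<^sup>/\<^sup>2\<close>, \<open>s = l(\<lambda>)\<close>, is up to sign the coefficient of \<open>z\<^sup>\<lambda>\<close> in
  \<open>D(z) G(z\<^sub>1) \<dots> G(z\<^sub>s) e\<^sup>s\<^sup>h\<^sup>/\<^sup>2\<close>, where \<open>D = \<Prod>\<^sub>p\<^sub>\<noteq>\<^sub>q (1 - z\<^sub>p/z\<^sub>q)\<^sup>\<alpha>\<close> is the Dyson product and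
  \<open>G(z) = exp (\<Sum> \<alpha> h\<^sub>-\<^sub>n z\<^sup>n / n)\<close>. By Dyson's theorem (Good's proof) the constant term of \<open>D\<close> is
  \<open>(s\<alpha>)! / (\<alpha>!)\<^sup>s\<close>. The differential equation
  \<open>z\<^sub>i \<partial>\<^sub>i D = \<alpha> \<Sum>\<^sub>j (z\<^sub>i + z\<^sub>j) / (z\<^sub>i - z\<^sub>j) D\<close> and the symmetry of \<open>D\<close> express each coefficient of \<open>D\<close>
  through coefficients with a smaller sum of squares of the exponents, with a denominator \<open>m + c \<alpha>\<close>,
  \<open>m > 0\<close>, \<open>c \<ge> 0\<close>. So the coefficients divided by the constant term are rational functions of \<open>\<alpha>\<close>
  without poles at \<open>\<alpha> \<ge> 0\<close>, and \<open>X'\<^sub>-\<^sub>\<lambda>\<close> exists.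

  The same recursion bounds the order of vanishing of the coefficients at \<open>\<alpha> = 0\<close>. It follows that
  \<open>\<alpha>\<^sup>-\<^sup>l\<^sup>(\<^sup>\<lambda>\<^sup>) X'\<^sub>-\<^sub>\<lambda>\<close> is regular at \<open>\<alpha> = 0\<close>, with value a nonzero multiple of \<open>p\<^sub>\<lambda>\<close> plus a combination of
  power sums \<open>p\<^sub>\<mu>\<close> with \<open>l(\<mu>) < l(\<lambda>)\<close>. This triangularity gives linear independence, and counting
  dimensions degree by degree gives spanning.
\<close>

section \<open>Finitely supported functions as a ring\<close>

text \<open>Put s = l(\<lambda>). One count gives both the power \<alpha>^s and the condition on
  lengths. A monomial p_\<mu> brings \<alpha>^l(\<mu>), because every h_{-n} enters G as \<alpha>
  h_{-n}. It occurs in the coefficient of z^\<beta> in G(z_1) ... G(z_s) only if at most l(\<mu>) of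
  the exponents \<beta>_p are nonzero. That coefficient is multiplied by the coefficient of D at
  \<beta> - \<lambda>, where each \<beta>_p = 0 leaves a negative exponent and so one more factor
  \<alpha>. Together these are at least s factors. If l(\<mu>) >= s, a term survives division by
  \<alpha>^s at \<alpha> = 0 only if l(\<mu>) = s and \<beta> - \<lambda> has no negative entry; its
  entries have sum 0, so \<beta> = \<lambda>, and p_\<lambda> is the only product of at most s power
  sums in the coefficient of z^\<lambda>. The point \<alpha> = 0 is not among those at which
  \<open>X'\<close> is prescribed, which is why regularity is carried along for all \<alpha> >=
  0.\<close>

abbreviation "lookup \<equiv> Poly_Mapping.lookup"
abbreviation "keys \<equiv> Poly_Mapping.keys"
abbreviation "single \<equiv> Poly_Mapping.single"

lemma lookup_scale [simp]:
  fixes f :: "'m::monoid_add \<Rightarrow>\<^sub>0 'c::semiring_1"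
  shows "lookup (single 0 c * f) x = c * lookup f x"
  by (simp flip: mult_map_scale_conv_mult add: Poly_Mapping.map.rep_eq when_def)

lemma poly_mapping_sum_single:
  fixes f :: "'m \<Rightarrow>\<^sub>0 'c::comm_monoid_add"
  shows "f = (\<Sum>k\<in>keys f. single k (lookup f k))"
  by (rule poly_mapping_eqI)
    (simp add: lookup_sum lookup_single when_def sum.delta in_keys_iff)

lemma poly_mapping_additive_induct [case_names zero add single]:
  fixes f :: "'m \<Rightarrow>\<^sub>0 'c::comm_monoid_add"
  assumes zero: "P 0"
    and add: "\<And>f g. P f \<Longrightarrow> P g \<Longrightarrow> P (f + g)"
    and single: "\<And>k c. P (single k c)"
  shows "P f"
proof -
  have "P (\<Sum>k\<in>A. single k (lookup f k))" if "finite A" for A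
    using that by induction (auto intro: zero add single)
  then show ?thesis
    using poly_mapping_sum_single[of f] by (metis finite_keys)
qed

lemma keys_mult_subset:
  fixes f g :: "'m::monoid_add \<Rightarrow>\<^sub>0 'c::semiring_0"
  assumes "keys f \<subseteq> A" "keys g \<subseteq> B" "\<And>a b. a \<in> A \<Longrightarrow> b \<in> B \<Longrightarrow> a + b \<in> C"
  shows "keys (f * g) \<subseteq> C"
  using keys_mult[of f g] assms by blast

lemma keys_prod_subset:
  fixes f :: "'i \<Rightarrow> 'm::comm_monoid_add \<Rightarrow>\<^sub>0 'c::comm_semiring_1"
  assumes "0 \<in> S" "\<And>a b. a \<in> S \<Longrightarrow> b \<in> S \<Longrightarrow> a + b \<in> S" "\<And>i. i \<in> I \<Longrightarrow> keys (f i) \<subseteq> S"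
  shows "keys (prod f I) \<subseteq> S"
  using assms(3)
proof (induction I rule: infinite_finite_induct)
  case (insert i I)
  then show ?case
    using keys_mult_subset[of "f i" S "prod f I" S S] assms(2) by simp
qed (use assms(1) in \<open>auto simp: in_keys_iff lookup_one when_def\<close>)

lemma keys_power_subset:
  fixes f :: "'m::comm_monoid_add \<Rightarrow>\<^sub>0 'c::comm_semiring_1"
  assumes "0 \<in> S" "\<And>a b. a \<in> S \<Longrightarrow> b \<in> S \<Longrightarrow> a + b \<in> S" "keys f \<subseteq> S"
  shows "keys (f ^ n) \<subseteq> S"
  using keys_prod_subset[of S "{..<n}" "\<lambda>_. f"] assms by simp

text \<open>Scalars act as multiplication by the constant \<open>single 0 c\<close>, so that
  linearity falls under the ring laws.\<close>

definition linear_ext ::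
    "('m \<Rightarrow> 'n::comm_monoid_add \<Rightarrow>\<^sub>0 'c::comm_ring_1) \<Rightarrow> ('m \<Rightarrow>\<^sub>0 'c) \<Rightarrow> 'n \<Rightarrow>\<^sub>0 'c" where
  "linear_ext \<phi> f = (\<Sum>x\<in>keys f. single 0 (lookup f x) * \<phi> x)"

lemma linear_ext_superset:
  assumes "finite A" "keys f \<subseteq> A"
  shows "linear_ext \<phi> f = (\<Sum>x\<in>A. single 0 (lookup f x) * \<phi> x)"
  unfolding linear_ext_def using assms
  by (intro sum.mono_neutral_left) (auto simp: in_keys_iff)

lemma linear_ext_0 [simp]: "linear_ext \<phi> 0 = 0"
  by (simp add: linear_ext_def)

lemma linear_ext_add: "linear_ext \<phi> (f + g) = linear_ext \<phi> f + linear_ext \<phi> g"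
proof -
  have "keys (f + g) \<subseteq> keys f \<union> keys g"
    by (rule keys_add)
  then show ?thesis
    by (simp add: linear_ext_superset[of "keys f \<union> keys g"] lookup_add single_add
        distrib_right sum.distrib)
qed

lemma linear_ext_single: "linear_ext \<phi> (single k c) = single 0 c * \<phi> k"
  by (simp add: linear_ext_superset[of "{k}"])

lemma linear_ext_sum: "linear_ext \<phi> (\<Sum>i\<in>I. f i) = (\<Sum>i\<in>I. linear_ext \<phi> (f i))"
  by (induction I rule: infinite_finite_induct) (simp_all add: linear_ext_add)

lemma linear_ext_scale:
  fixes f :: "'m::monoid_add \<Rightarrow>\<^sub>0 'c::comm_ring_1" and \<phi> :: "'m \<Rightarrow> 'n::comm_monoid_add \<Rightarrow>\<^sub>0 'c"
  shows "linear_ext \<phi> (single 0 c * f) = single 0 c * linear_ext \<phi> f"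
proof -
  have "single 0 (c * lookup f x) =
      (single 0 c * single 0 (lookup f x) :: 'n \<Rightarrow>\<^sub>0 'c)"
    for x
    by (simp add: mult_single)
  moreover have "keys (single 0 c * f) \<subseteq> keys f"
    by (auto simp: in_keys_iff)
  ultimately show ?thesis
    by (simp add: linear_ext_superset[of "keys f"] sum_distrib_left mult.assoc)
qed

section \<open>Laurent polynomials and Dyson's constant term\<close>

text \<open>All variables z_0, z_1, ... live in one ring, so that a further vertex operator brings a
  new variable without a change of type.\<close>

type_synonym laurent = "(nat \<Rightarrow>\<^sub>0 int) \<Rightarrow>\<^sub>0 complex"

definition zpow :: "nat \<Rightarrow> int \<Rightarrow> laurent" where
  "zpow p n = single (single p n) 1"

lemma zpow_0 [simp]: "zpow p 0 = 1"
  by (simp add: zpow_def)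

lemma zpow_add: "zpow p (m + n) = zpow p m * zpow p n"
  by (simp add: zpow_def mult_single single_add)

lemma zpow_nonzero [simp]: "zpow p n \<noteq> 0"
  by (metis mult_zero_left add.right_inverse zero_neq_one zpow_0 zpow_add)

lemma zpow_inverse [simp]: "zpow p 1 * zpow p (-1) = 1" "zpow p (-1) * zpow p 1 = 1"
  by (simp_all flip: zpow_add)

lemma keys_zpow [simp]: "keys (zpow p n) = {single p n}"
  by (simp add: zpow_def)

lemma zpow_power: "zpow p n ^ k = zpow p (n * int k)"
  by (induction k) (simp_all add: zpow_add algebra_simps)

lemma zpow_inj: "zpow p 1 = zpow q 1 \<longleftrightarrow> p = q"
proof
  assume "zpow p 1 = zpow q 1"
  then have "single p (1::int) = single q 1"
    by (metis keys_zpow singleton_inject)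
  then show "p = q"
    by (metis lookup_single_eq lookup_single_not_eq zero_neq_one)
qed simp

text \<open>The left side is the value at 0 of the Lagrange interpolation polynomial with value 1 at
  every \<open>x i\<close>. Its degree is less than \<open>card S\<close>, so it is the constant
  1.\<close>

lemma lagrange_at_zero:
  fixes x :: "'i \<Rightarrow> 'k::field"
  assumes "finite S" "S \<noteq> {}" "inj_on x S"
  shows "(\<Sum>i\<in>S. \<Prod>j\<in>S - {i}. x j / (x j - x i)) = 1"
proof -
  define P where
    "P = (\<Sum>i\<in>S. \<Prod>j\<in>S - {i}. smult (inverse (x j - x i)) [:x j, -1:])"
  have ev: "poly P t = (\<Sum>i\<in>S. \<Prod>j\<in>S - {i}. (x j - t) / (x j - x i))" for t
    by (simp add: P_def poly_sum poly_prod divide_inverse left_diff_distrib mult.commute)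
  have "degree (\<Prod>j\<in>S - {i}. smult (inverse (x j - x i)) [:x j, -1:]) \<le> card S - 1" if "i \<in> S" for i
  proof -
    have "degree (\<Prod>j\<in>S - {i}. smult (inverse (x j - x i)) [:x j, -1:]) \<le>
        sum (degree \<circ> (\<lambda>j. smult (inverse (x j - x i)) [:x j, -1:])) (S - {i})"
      using assms by (intro degree_prod_sum_le) auto
    also have "\<dots> \<le> (\<Sum>j\<in>S - {i}. 1)"
      by (intro sum_mono) auto
    finally show ?thesis
      using that assms by simp
  qed
  then have "degree P \<le> card S - 1"
    unfolding P_def using assms by (intro degree_sum_le) auto
  moreover have "card S > 0"
    using assms by auto
  ultimately have deg: "degree P < card (x ` S)"
    using assms by (simp add: card_image)
  have "poly P (x k) = 1" if "k \<in> S" for k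
  proof -
    have "(\<Prod>j\<in>S - {i}. (x j - x k) / (x j - x i)) = (if i = k then 1 else 0)" if "i \<in> S" for i
    proof (cases "i = k")
      case True
      have "(x j - x k) / (x j - x i) = 1" if "j \<in> S - {i}" for j
        using that True \<open>i \<in> S\<close> assms(3) by (auto dest: inj_onD)
      then show ?thesis
        using True by simp
    next
      case False
      then have "\<exists>j\<in>S - {i}. (x j - x k) / (x j - x i) = 0"
        using \<open>k \<in> S\<close> by (intro bexI[of _ k]) auto
      then show ?thesis
        using False assms by simp
    qed
    then show ?thesis
      using that assms by (simp add: ev)
  qed
  then have "P = 1"
    using deg \<open>card S > 0\<close> assms(3)
    by (intro poly_eqI_degree[of "x ` S"]) (auto simp: card_image)
  then show ?thesis
    using ev[of 0] by simp
qed

section \<open>Good's proof of Dyson's constant term identity\<close>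

definition dyson_factor :: "nat set \<Rightarrow> nat \<Rightarrow> laurent" where
  "dyson_factor S p = (\<Prod>q\<in>S - {p}. 1 - zpow p 1 * zpow q (-1))"

text \<open>Good's induction lowers one exponent at a time and so leaves the case of equal
  exponents; each variable therefore has its own \<open>a p\<close>.\<close>

definition dyson :: "nat set \<Rightarrow> (nat \<Rightarrow> nat) \<Rightarrow> laurent" where
  "dyson S a = (\<Prod>p\<in>S. dyson_factor S p ^ a p)"

text \<open>Division by the whole product turns this into the statement that the inverses of the
  factors have sum 1. In the fraction field the inverse of the factor of p is the product of z_q /
  (z_q - z_p), and \<open>lagrange_at_zero\<close> applies.\<close>

lemma dyson_factor_identity:
  assumes "finite S" "S \<noteq> {}"
  shows "(\<Prod>p\<in>S. dyson_factor S p) = (\<Sum>i\<in>S. \<Prod>p\<in>S - {i}. dyson_factor S p)"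
proof -
  define x where "x p = to_fract (zpow p 1)" for p
  define u where "u p = to_fract (dyson_factor S p)" for p
  have to_prod: "to_fract (\<Prod>i\<in>A. f i) = (\<Prod>i\<in>A. to_fract (f i))" for A and f :: "nat \<Rightarrow> laurent"
    by (induction A rule: infinite_finite_induct) auto
  have to_sum: "to_fract (\<Sum>i\<in>A. f i) = (\<Sum>i\<in>A. to_fract (f i))" for A and f :: "nat \<Rightarrow> laurent"
    by (induction A rule: infinite_finite_induct) auto
  have x0: "x p \<noteq> 0" for p
    by (simp add: x_def)
  have "to_fract (zpow p (-1)) * x p = 1" for p
    unfolding x_def by (metis to_fract_1 to_fract_mult zpow_inverse(2))
  then have inv: "to_fract (zpow p (-1)) = 1 / x p" for p
    using x0[of p] by (simp add: nonzero_eq_divide_eq)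
  have inj: "inj x"
    by (auto simp: inj_def x_def zpow_inj)
  have u: "u p = (\<Prod>q\<in>S - {p}. (x q - x p) / x q)" for p
    using x0 by (simp add: u_def dyson_factor_def to_prod inv diff_divide_distrib flip: x_def)
  have u0: "u p \<noteq> 0" for p
    using x0 inj assms by (auto simp: u dest: injD)
  have one: "(\<Sum>i\<in>S. 1 / u i) = 1"
    using lagrange_at_zero[of S x] assms inj by (simp add: u inj_on_def inj_def prod_dividef)
  have "(\<Sum>i\<in>S. \<Prod>p\<in>S - {i}. u p) = (\<Sum>i\<in>S. (\<Prod>p\<in>S. u p) * (1 / u i))"
    using assms u0 by (intro sum.cong) (simp_all add: prod.remove[of S _ u])
  also have "\<dots> = (\<Prod>p\<in>S. u p)"
    by (simp only: one mult_1_right flip: sum_distrib_left)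
  finally have "to_fract (\<Prod>p\<in>S. dyson_factor S p) = to_fract (\<Sum>i\<in>S. \<Prod>p\<in>S - {i}. dyson_factor S p)"
    by (simp add: to_prod to_sum u_def)
  then show ?thesis
    by (simp only: to_fract_eq_iff)
qed

text \<open>This is \<open>dyson_factor_identity\<close> multiplied by all
  \<open>dyson_factor S p ^ (a p - 1)\<close>.\<close>

lemma dyson_recursion:
  assumes "finite S" "S \<noteq> {}" "\<And>p. p \<in> S \<Longrightarrow> a p > 0"
  shows "dyson S a = (\<Sum>i\<in>S. dyson S (a(i := a i - 1)))"
proof -
  let ?u = "dyson_factor S"
  have "dyson S a = (\<Prod>p\<in>S. ?u p ^ (a p - 1)) * (\<Prod>p\<in>S. ?u p)"
    unfolding dyson_def prod.distrib[symmetric]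
    using assms by (intro prod.cong) (simp_all flip: power_Suc2)
  also have "\<dots> = (\<Sum>i\<in>S. (\<Prod>p\<in>S. ?u p ^ (a p - 1)) * (\<Prod>p\<in>S - {i}. ?u p))"
    using assms by (simp add: dyson_factor_identity sum_distrib_left)
  also have "\<dots> = (\<Sum>i\<in>S. dyson S (a(i := a i - 1)))"
  proof (intro sum.cong refl)
    fix i assume i: "i \<in> S"
    have "(\<Prod>p\<in>S - {i}. ?u p ^ (a p - 1)) * (\<Prod>p\<in>S - {i}. ?u p) = (\<Prod>p\<in>S - {i}. ?u p ^ a p)"
      unfolding prod.distrib[symmetric]
      using assms by (intro prod.cong) (simp_all flip: power_Suc2)
    moreover have "(\<Prod>p\<in>S - {i}. ?u p ^ (a(i := a i - 1)) p) = (\<Prod>p\<in>S - {i}. ?u p ^ a p)"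
      by (intro prod.cong) auto
    ultimately show "(\<Prod>p\<in>S. ?u p ^ (a p - 1)) * (\<Prod>p\<in>S - {i}. ?u p) = dyson S (a(i := a i - 1))"
      using assms i by (simp add: dyson_def prod.remove[of S i] mult.assoc)
  qed
  finally show ?thesis .
qed

text \<open>Every factor has only the exponents 0 and e_p - e_q. A property of exponent vectors that
  is stable under addition thus needs checking only there.\<close>

lemma keys_dyson_subset:
  assumes "0 \<in> U" "\<And>a b. a \<in> U \<Longrightarrow> b \<in> U \<Longrightarrow> a + b \<in> U"
    and "\<And>p q. p \<in> S \<Longrightarrow> q \<in> S \<Longrightarrow> p \<noteq> q \<Longrightarrow> single p 1 + single q (-1) \<in> U"
  shows "keys (dyson S a) \<subseteq> U"
proof -
  have "keys (1 - zpow p 1 * zpow q (-1)) \<subseteq> U" if "p \<in> S" "q \<in> S" "p \<noteq> q" for p q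
  proof -
    have "keys (1 - zpow p 1 * zpow q (-1)) \<subseteq> keys (1::laurent) \<union> keys (zpow p 1 * zpow q (-1))"
      by (rule keys_diff)
    then show ?thesis
      using assms(1) assms(3)[OF that] by (auto simp: zpow_def mult_single)
  qed
  then show ?thesis
    unfolding dyson_def dyson_factor_def
    by (intro keys_prod_subset keys_power_subset assms(1,2)) auto
qed

text \<open>With \<open>a k = 0\<close> the variable z_k remains only in the factors (1 -
  z_p/z_k)^(a p). Every term of these other than 1 has a negative power of z_k, which nothing can
  compensate.\<close>

lemma dyson_remove_zero:
  assumes "finite S" "k \<in> S" "a k = 0"
  shows "lookup (dyson S a) 0 = lookup (dyson (S - {k}) a) 0"
proof -
  \<comment> \<open>\<open>N\<close> holds the exponents negative at k, and \<open>K\<close> the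
    polynomials that are 1 plus terms from \<open>N\<close>; \<open>K\<close> is closed under
    multiplication.\<close>
  define N where "N = {\<beta> :: nat \<Rightarrow>\<^sub>0 int. lookup \<beta> k < 0}"
  define K where "K = {f :: laurent. keys (f - 1) \<subseteq> N}"
  have N_mult: "keys (f * g) \<subseteq> N" if "keys f \<subseteq> {\<beta>. lookup \<beta> k \<le> 0}" "keys g \<subseteq> N" for f g :: laurent
    using that by (rule keys_mult_subset) (auto simp: N_def lookup_add)
  have K_mult: "f * g \<in> K" if "f \<in> K" "g \<in> K" for f g
  proof -
    have f: "keys (f - 1) \<subseteq> N" and g: "keys (g - 1) \<subseteq> N"
      using that by (auto simp: K_def)
    have "keys ((f - 1) * (g - 1)) \<subseteq> N"
      using f by (intro N_mult g) (auto simp: N_def)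
    moreover have "f * g - 1 = (f - 1) * (g - 1) + (f - 1) + (g - 1)"
      by (simp add: algebra_simps)
    ultimately have "keys (f * g - 1) \<subseteq> N"
      using f g keys_add by (metis (no_types, lifting) Un_subset_iff subset_trans)
    then show ?thesis
      by (simp add: K_def)
  qed
  have K_prod: "(\<Prod>i\<in>I. f i) \<in> K" if "\<And>i. i \<in> I \<Longrightarrow> f i \<in> K" for I and f :: "nat \<Rightarrow> laurent"
    using that
  proof (induction I rule: infinite_finite_induct)
    case (insert i I)
    then show ?case
      using K_mult[of "f i" "prod f I"] by simp
  qed (simp_all add: K_def)
  have K_power: "f ^ n \<in> K" if "f \<in> K" for f n
    using K_prod[of "{..<n}" "\<lambda>_. f"] that by simp
  have fac: "1 - zpow p 1 * zpow k (-1) \<in> K" if "p \<noteq> k" for p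
  proof -
    have "(1 - zpow p 1 * zpow k (-1)) - 1 = - (zpow p 1 * zpow k (-1))"
      by simp
    then show ?thesis
      using that by (simp add: K_def zpow_def mult_single N_def lookup_add lookup_single)
  qed
  define h where "h = (\<Prod>p\<in>S - {k}. (1 - zpow p 1 * zpow k (-1)) ^ a p)"
  have h: "h \<in> K"
    unfolding h_def by (intro K_prod K_power fac) auto
  have "dyson S a = (\<Prod>p\<in>S - {k}. dyson_factor S p ^ a p)"
    using assms by (simp add: dyson_def prod.remove[of S k])
  also have "\<dots> = (\<Prod>p\<in>S - {k}. dyson_factor (S - {k}) p ^ a p * (1 - zpow p 1 * zpow k (-1)) ^ a p)"
  proof (intro prod.cong refl)
    fix p assume "p \<in> S - {k}"
    then have "S - {p} = insert k (S - {k} - {p})"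
      using assms by auto
    then have "dyson_factor S p = dyson_factor (S - {k}) p * (1 - zpow p 1 * zpow k (-1))"
      using assms by (simp add: dyson_factor_def mult.commute)
    then show "dyson_factor S p ^ a p = dyson_factor (S - {k}) p ^ a p * (1 - zpow p 1 * zpow k (-1)) ^ a p"
      by (simp add: power_mult_distrib)
  qed
  also have "\<dots> = dyson (S - {k}) a * h"
    by (simp add: prod.distrib dyson_def h_def)
  finally have eq: "dyson S a = dyson (S - {k}) a + dyson (S - {k}) a * (h - 1)"
    by (simp add: algebra_simps)
  have "keys (dyson (S - {k}) a) \<subseteq> {\<beta>. lookup \<beta> k \<le> 0}"
    by (rule keys_dyson_subset) (auto simp: lookup_add lookup_single)
  then have "keys (dyson (S - {k}) a * (h - 1)) \<subseteq> N"
    using h by (intro N_mult) (auto simp: K_def)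
  then have "lookup (dyson (S - {k}) a * (h - 1)) 0 = 0"
    by (auto simp: N_def in_keys_iff)
  then show ?thesis
    by (simp add: eq lookup_add)
qed

theorem dyson_constant_term:
  assumes "finite S"
  shows "lookup (dyson S a) 0 = fact (\<Sum>p\<in>S. a p) / (\<Prod>p\<in>S. fact (a p))"
  using assms
proof (induction "card S + (\<Sum>p\<in>S. a p)" arbitrary: S a rule: less_induct)
  case less
  note fin = \<open>finite S\<close>
  consider "S = {}" | k where "k \<in> S" "a k = 0" | "S \<noteq> {}" "\<And>p. p \<in> S \<Longrightarrow> a p > 0"
    by blast
  then show ?case
  proof cases
    case 1
    then show ?thesis
      by (simp add: dyson_def)
  next
    case 2
    have "card (S - {k}) + sum a (S - {k}) < card S + sum a S"
      using 2 fin card_Diff1_less[of S k] by (simp add: sum.remove[of S k])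
    then have "lookup (dyson (S - {k}) a) 0 = fact (\<Sum>p\<in>S - {k}. a p) / (\<Prod>p\<in>S - {k}. fact (a p))"
      using fin by (intro less) auto
    then show ?thesis
      using 2 fin by (simp add: dyson_remove_zero sum.remove[of S k] prod.remove[of S k])
  next
    case 3
    \<comment> \<open>Lowering \<open>a i\<close> leaves the fraction \<open>a i\<close> /
      \<open>sum a S\<close> of the multinomial coefficient; these fractions have sum 1.\<close>
    have step: "lookup (dyson S (a(i := a i - 1))) 0 =
        of_nat (a i) * fact ((\<Sum>p\<in>S. a p) - 1) / (\<Prod>p\<in>S. fact (a p))" if i: "i \<in> S" for i
    proof -
      have s1: "sum (a(i := a i - 1)) (S - {i}) = sum a (S - {i})"
        by (intro sum.cong) auto
      have p1: "(\<Prod>p\<in>S - {i}. fact ((a(i := a i - 1)) p)) = (\<Prod>p\<in>S - {i}. fact (a p) :: complex)"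
        by (intro prod.cong) auto
      have s: "sum (a(i := a i - 1)) S = sum a S - 1"
        using i fin 3(2)[OF i] by (simp add: sum.remove[of S i] s1)
      have "sum a S > 0"
        using i fin 3(2)[OF i] by (simp add: sum.remove[of S i])
      then have "lookup (dyson S (a(i := a i - 1))) 0 =
          fact (sum a S - 1) / (\<Prod>p\<in>S. fact ((a(i := a i - 1)) p))"
        using s fin by (subst less) auto
      moreover have "(\<Prod>p\<in>S. fact (a p) :: complex) =
          of_nat (a i) * (\<Prod>p\<in>S. fact ((a(i := a i - 1)) p))"
        using i fin 3(2)[OF i] by (simp add: prod.remove[of S i] p1 fact_reduce[of "a i"])
      ultimately show ?thesis
        using 3(2)[OF i] by (simp add: field_simps)
    qed
    have "sum a S > 0"
      using 3 fin by (metis card_gt_0_iff sum_pos)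
    have "lookup (dyson S a) 0 = (\<Sum>i\<in>S. lookup (dyson S (a(i := a i - 1))) 0)"
      using dyson_recursion[OF fin, of a] 3 by (simp add: lookup_sum)
    also have "\<dots> = of_nat (sum a S) * fact ((\<Sum>p\<in>S. a p) - 1) / (\<Prod>p\<in>S. fact (a p))"
      by (simp add: step sum_distrib_right sum_divide_distrib del: One_nat_def cong: sum.cong)
    also have "\<dots> = fact (\<Sum>p\<in>S. a p) / (\<Prod>p\<in>S. fact (a p))"
      using \<open>sum a S > 0\<close> by (simp add: fact_reduce)
    finally show ?thesis .
  qed
qed

section \<open>A recursion for the coefficients of the Dyson product\<close>

lemma lookup_single_mult:
  fixes f :: "'m::ab_group_add \<Rightarrow>\<^sub>0 'c::comm_semiring_1"
  shows "lookup (single k c * f) x = c * lookup f (x - k)"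
proof (induction f rule: poly_mapping_additive_induct)
  case (single j b)
  have "j = x - k \<longleftrightarrow> k + j = x"
    by (auto simp: algebra_simps)
  then show ?case
    by (simp add: mult_single lookup_single when_def)
qed (simp_all add: distrib_left lookup_add)

section \<open>The Euler operators z_i d/dz_i\<close>

definition theta :: "nat \<Rightarrow> laurent \<Rightarrow> laurent" where
  "theta i f = Poly_Mapping.mapp (\<lambda>\<beta> c. of_int (lookup \<beta> i) * c) f"

lemma lookup_theta [simp]: "lookup (theta i f) \<beta> = of_int (lookup \<beta> i) * lookup f \<beta>"
  by (simp add: theta_def lookup_mapp when_def in_keys_iff)

lemma theta_add: "theta i (f + g) = theta i f + theta i g"
  by (rule poly_mapping_eqI) (simp add: lookup_add algebra_simps)

lemma theta_diff: "theta i (f - g) = theta i f - theta i g"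
  by (rule poly_mapping_eqI) (simp add: lookup_minus algebra_simps)

lemma theta_single: "theta i (single \<beta> c) = single \<beta> (of_int (lookup \<beta> i) * c)"
  by (rule poly_mapping_eqI) (simp add: lookup_single when_def)

lemma theta_0 [simp]: "theta i 0 = 0"
  by (rule poly_mapping_eqI) simp

lemma theta_1 [simp]: "theta i 1 = 0"
  by (rule poly_mapping_eqI) (simp add: lookup_one when_def)

lemma theta_mult: "theta i (f * g) = theta i f * g + f * theta i g"
proof (induction f rule: poly_mapping_additive_induct)
  case (single \<beta> c)
  show ?case
  proof (induction g rule: poly_mapping_additive_induct)
    case (single \<gamma> d)
    show ?case
      by (simp add: theta_single mult_single lookup_add algebra_simps flip: single_add)
  qed (simp_all add: theta_add algebra_simps)
qed (simp_all add: theta_add algebra_simps)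

lemma theta_power: "theta i (f ^ n) = of_nat n * f ^ (n - 1) * theta i f"
proof (induction n)
  case (Suc n)
  then show ?case
    by (cases n) (simp_all add: theta_mult algebra_simps)
qed simp

text \<open>Stated for any map with the Leibniz rule because it serves both \<open>theta i\<close>
  and the derivations \<open>d_h_neg i\<close> of the Fock space.\<close>

lemma derivation_prod:
  fixes D :: "'a::comm_ring_1 \<Rightarrow> 'a"
  assumes mult: "\<And>f g. D (f * g) = D f * g + f * D g" and "finite J"
  shows "D (\<Prod>j\<in>J. f j) = (\<Sum>j\<in>J. D (f j) * (\<Prod>k\<in>J - {j}. f k))"
  using assms(2)
proof (induction J)
  case empty
  show ?case
    using mult[of 1 1] by simp
next
  case (insert a J)
  have "(\<Sum>j\<in>J. D (f j) * (\<Prod>k\<in>insert a J - {j}. f k)) =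
      (\<Sum>j\<in>J. f a * (D (f j) * (\<Prod>k\<in>J - {j}. f k)))"
  proof (intro sum.cong refl)
    fix j assume "j \<in> J"
    then have "insert a J - {j} = insert a (J - {j})"
      using insert by auto
    then show "D (f j) * (\<Prod>k\<in>insert a J - {j}. f k) =
        f a * (D (f j) * (\<Prod>k\<in>J - {j}. f k))"
      using insert by (simp add: mult_ac)
  qed
  then show ?case
    using insert by (simp add: mult sum_distrib_left mult.commute)
qed

lemmas theta_prod = derivation_prod[where D = "theta i" for i, OF theta_mult]

text \<open>The two factors that involve both z_i and z_j; with equal exponents the Dyson product is
  a product over unordered pairs.\<close>

definition dyson_pair :: "nat \<Rightarrow> nat \<Rightarrow> laurent" where
  "dyson_pair i j = (1 - zpow i 1 * zpow j (-1)) * (1 - zpow j 1 * zpow i (-1))"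

lemma dyson_pair_eq:
  "dyson_pair i j = (zpow i 1 - zpow j 1) * (zpow i (-1) - zpow j (-1))"
  using zpow_inverse(1)[of i] zpow_inverse(1)[of j] unfolding dyson_pair_def by algebra

text \<open>Together with \<open>dyson_pair_eq\<close> this gives the logarithmic derivative (z_i +
  z_j) / (z_i - z_j) without a division.\<close>

lemma theta_dyson_pair:
  assumes "i \<noteq> j"
  shows "theta i (dyson_pair i j) = (zpow i 1 + zpow j 1) * (zpow i (-1) - zpow j (-1))"
proof -
  have pm: "theta i (zpow i n) = of_int n * zpow i n" for n
    by (simp add: zpow_def theta_single mult_single flip: single_of_int)
  have "theta i (zpow j n) = 0" for n
    using assms by (simp add: zpow_def theta_single lookup_single)
  then have "theta i (dyson_pair i j) = zpow j 1 * zpow i (-1) - zpow i 1 * zpow j (-1)"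
    using pm[of 1] pm[of "-1"]
    by (simp add: dyson_pair_eq theta_mult theta_diff) (simp add: algebra_simps)
  then show ?thesis
    using zpow_inverse(1)[of i] zpow_inverse(1)[of j] by algebra
qed

lemma dyson_insert:
  assumes "finite S" "i \<notin> S"
  shows "dyson (insert i S) (\<lambda>_. n) = dyson S (\<lambda>_. n) * (\<Prod>j\<in>S. dyson_pair i j ^ n)"
proof -
  have 1: "dyson_factor (insert i S) i = (\<Prod>q\<in>S. 1 - zpow i 1 * zpow q (-1))"
    using assms by (simp add: dyson_factor_def)
  have 2: "dyson_factor (insert i S) p = (1 - zpow p 1 * zpow i (-1)) * dyson_factor S p"
    if "p \<in> S" for p
  proof -
    have "insert i S - {p} = insert i (S - {p})"
      using that assms by auto
    then show ?thesis
      using assms by (simp add: dyson_factor_def)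
  qed
  show ?thesis
    using assms
    by (simp add: dyson_def 1 2 dyson_pair_def power_mult_distrib prod.distrib
        flip: prod_power_distrib)
qed

section \<open>Exchange of two variables and the symmetry of the Dyson product\<close>

definition swap_vars :: "nat \<Rightarrow> nat \<Rightarrow> laurent \<Rightarrow> laurent" where
  "swap_vars i j f = Poly_Mapping.map_key (Poly_Mapping.map_key (transpose i j)) f"

lemma lookup_map_key_transpose [simp]:
  "lookup (Poly_Mapping.map_key (transpose i j) \<beta>) p = lookup \<beta> (transpose i j p)"
  by (simp add: Poly_Mapping.map_key.rep_eq)

lemma map_key_transpose_involutory [simp]:
  "Poly_Mapping.map_key (transpose i j) (Poly_Mapping.map_key (transpose i j) \<beta>) = \<beta>"
  by (rule poly_mapping_eqI) simp

lemma inj_map_key_transpose: "inj (Poly_Mapping.map_key (transpose i j))"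
  by (metis injI map_key_transpose_involutory)

lemma lookup_swap_vars [simp]:
  "lookup (swap_vars i j f) \<beta> = lookup f (Poly_Mapping.map_key (transpose i j) \<beta>)"
  by (simp add: swap_vars_def Poly_Mapping.map_key.rep_eq inj_map_key_transpose)

lemma swap_vars_single:
  "swap_vars i j (single \<beta> c) = single (Poly_Mapping.map_key (transpose i j) \<beta>) c"
  by (rule poly_mapping_eqI) (auto simp: lookup_single when_def)

lemma swap_vars_add: "swap_vars i j (f + g) = swap_vars i j f + swap_vars i j g"
  by (rule poly_mapping_eqI) (simp add: lookup_add)

lemma swap_vars_diff: "swap_vars i j (f - g) = swap_vars i j f - swap_vars i j g"
  by (rule poly_mapping_eqI) (simp add: lookup_minus)

lemma swap_vars_0 [simp]: "swap_vars i j 0 = 0"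
  by (rule poly_mapping_eqI) simp

lemma swap_vars_1 [simp]: "swap_vars i j 1 = 1"
  using swap_vars_single[of i j 0 1]
  by (metis map_key_zero single_one inj_transpose)

lemma swap_vars_mult: "swap_vars i j (f * g) = swap_vars i j f * swap_vars i j g"
proof (induction f rule: poly_mapping_additive_induct)
  case (single \<beta> c)
  show ?case
  proof (induction g rule: poly_mapping_additive_induct)
    case (single \<gamma> d)
    have "Poly_Mapping.map_key (transpose i j) (\<beta> + \<gamma>) =
        Poly_Mapping.map_key (transpose i j) \<beta> + Poly_Mapping.map_key (transpose i j) \<gamma>"
      by (rule poly_mapping_eqI) (simp add: lookup_add)
    then show ?case
      by (simp add: swap_vars_single mult_single)
  qed (simp_all add: swap_vars_add algebra_simps)
qed (simp_all add: swap_vars_add algebra_simps)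

lemma swap_vars_prod: "swap_vars i j (\<Prod>x\<in>I. f x) = (\<Prod>x\<in>I. swap_vars i j (f x))"
  by (induction I rule: infinite_finite_induct) (simp_all add: swap_vars_mult)

lemma swap_vars_power: "swap_vars i j (f ^ n) = swap_vars i j f ^ n"
  by (induction n) (simp_all add: swap_vars_mult)

lemma swap_vars_zpow: "swap_vars i j (zpow p n) = zpow (transpose i j p) n"
proof -
  have "Poly_Mapping.map_key (transpose i j) (single p n) = single (transpose i j p) n"
    by (rule poly_mapping_eqI) (auto simp: lookup_single when_def transpose_def)
  then show ?thesis
    by (simp add: zpow_def swap_vars_single)
qed

lemma swap_vars_dyson:
  assumes "i \<in> S" "j \<in> S"
  shows "swap_vars i j (dyson S (\<lambda>_. n)) = dyson S (\<lambda>_. n)"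
proof -
  let ?t = "transpose i j"
  have bij: "bij_betw ?t S S"
    using assms by (auto simp: bij_betw_transpose_iff)
  have "swap_vars i j (dyson_factor S p) = dyson_factor S (?t p)" if "p \<in> S" for p
  proof -
    have "bij_betw ?t (S - {p}) (S - {?t p})"
      using bij that by (intro bij_betw_DiffI) (auto simp: bij_betw_def)
    then have "(\<Prod>q\<in>S - {p}. 1 - zpow (?t p) 1 * zpow (?t q) (-1)) =
        (\<Prod>q\<in>S - {?t p}. 1 - zpow (?t p) 1 * zpow q (-1))"
      by (rule prod.reindex_bij_betw)
    then show ?thesis
      by (simp add: dyson_factor_def swap_vars_prod swap_vars_diff swap_vars_mult swap_vars_zpow)
  qed
  then have "swap_vars i j (dyson S (\<lambda>_. n)) = (\<Prod>p\<in>S. dyson_factor S (?t p) ^ n)"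
    by (simp add: dyson_def swap_vars_prod swap_vars_power)
  also have "\<dots> = dyson S (\<lambda>_. n)"
    unfolding dyson_def by (rule prod.reindex_bij_betw[OF bij])
  finally show ?thesis .
qed

text \<open>The quotient D / (z_i - z_j) as a Laurent polynomial: one copy of
  \<open>dyson_pair i j\<close> has lost its factor z_i - z_j.\<close>

definition dyson_quot :: "nat set \<Rightarrow> nat \<Rightarrow> nat \<Rightarrow> nat \<Rightarrow> laurent" where
  "dyson_quot S n i j = dyson (S - {i}) (\<lambda>_. n) * (zpow i (-1) - zpow j (-1)) *
     dyson_pair i j ^ (n - 1) * (\<Prod>k\<in>S - {i} - {j}. dyson_pair i k ^ n)"

lemma dyson_eq_quot:
  assumes "finite S" "i \<in> S" "j \<in> S" "i \<noteq> j" "n > 0"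
  shows "dyson S (\<lambda>_. n) = (zpow i 1 - zpow j 1) * dyson_quot S n i j"
proof -
  have "dyson S (\<lambda>_. n) = dyson (S - {i}) (\<lambda>_. n) * (\<Prod>k\<in>S - {i}. dyson_pair i k ^ n)"
    using dyson_insert[of "S - {i}" i n] assms by (simp add: insert_absorb)
  also have "(\<Prod>k\<in>S - {i}. dyson_pair i k ^ n) =
      dyson_pair i j ^ n * (\<Prod>k\<in>S - {i} - {j}. dyson_pair i k ^ n)"
    using assms by (intro prod.remove) auto
  also have "dyson_pair i j ^ n =
      (zpow i 1 - zpow j 1) * (zpow i (-1) - zpow j (-1)) * dyson_pair i j ^ (n - 1)"
    using assms(5) dyson_pair_eq[of i j] by (metis power_eq_if neq0_conv)
  finally show ?thesis
    by (simp add: dyson_quot_def mult_ac)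
qed

text \<open>The differential equation of D. The factors without z_i are constants for
  \<open>theta i\<close>, and each remaining pair contributes its logarithmic derivative.\<close>

lemma theta_dyson:
  assumes "finite S" "i \<in> S"
  shows "theta i (dyson S (\<lambda>_. n)) =
    of_nat n * (\<Sum>j\<in>S - {i}. (zpow i 1 + zpow j 1) * dyson_quot S n i j)"
proof -
  let ?E = "dyson (S - {i}) (\<lambda>_. n)"
  have "keys ?E \<subseteq> {\<beta>. lookup \<beta> i = 0}"
    by (rule keys_dyson_subset) (auto simp: lookup_add lookup_single)
  then have E: "theta i ?E = 0"
    by (intro poly_mapping_eqI) (auto simp: in_keys_iff)
  have "dyson S (\<lambda>_. n) = ?E * (\<Prod>k\<in>S - {i}. dyson_pair i k ^ n)"
    using dyson_insert[of "S - {i}" i n] assms by (simp add: insert_absorb)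
  then have "theta i (dyson S (\<lambda>_. n)) =
      ?E * (\<Sum>j\<in>S - {i}. theta i (dyson_pair i j ^ n) * (\<Prod>k\<in>S - {i} - {j}. dyson_pair i k ^ n))"
    using assms by (simp add: theta_mult E theta_prod)
  also have "\<dots> = of_nat n * (\<Sum>j\<in>S - {i}. (zpow i 1 + zpow j 1) * dyson_quot S n i j)"
    unfolding sum_distrib_left
    by (intro sum.cong refl) (auto simp: theta_power theta_dyson_pair dyson_quot_def mult_ac)
  finally show ?thesis .
qed

text \<open>D is symmetric and z_i - z_j changes sign, so their quotient changes sign; Laurent
  polynomials have no zero divisors.\<close>

lemma swap_vars_dyson_quot:
  assumes "finite S" "i \<in> S" "j \<in> S" "i \<noteq> j" "n > 0"
  shows "swap_vars i j (dyson_quot S n i j) = - dyson_quot S n i j"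
proof -
  let ?q = "dyson_quot S n i j"
  have "(zpow j 1 - zpow i 1) * swap_vars i j ?q = swap_vars i j ((zpow i 1 - zpow j 1) * ?q)"
    by (simp add: swap_vars_mult swap_vars_diff swap_vars_zpow)
  also have "\<dots> = (zpow i 1 - zpow j 1) * ?q"
    using swap_vars_dyson[of i S j n] assms by (simp flip: dyson_eq_quot)
  finally have "(zpow i 1 - zpow j 1) * (swap_vars i j ?q + ?q) = 0"
    by algebra
  moreover have "zpow i 1 - zpow j 1 \<noteq> 0"
    using assms by (simp add: zpow_inj)
  ultimately show ?thesis
    by (simp add: eq_neg_iff_add_eq_0)
qed

text \<open>Let u_k be the coefficient of the quotient at \<gamma> + (k-1) e_i - k e_j. The
  coefficient of D at \<gamma> + k (e_i - e_j) is then u_k - u_{k+1}, so the right side telescopes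
  to u_0 - u_M with M = \<gamma>_j - \<gamma>_i. The left side is u_0 + u_1, and antisymmetry gives
  u_M = - u_1.\<close>

lemma dyson_quot_coeffs:
  fixes \<gamma> :: "nat \<Rightarrow>\<^sub>0 int"
  assumes "finite S" "i \<in> S" "j \<in> S" "i \<noteq> j" "n > 0" "lookup \<gamma> i \<le> lookup \<gamma> j"
  shows "lookup ((zpow i 1 + zpow j 1) * dyson_quot S n i j) \<gamma> =
    (\<Sum>k<nat (lookup \<gamma> j - lookup \<gamma> i).
       lookup (dyson S (\<lambda>_. n)) (\<gamma> + single i (int k) - single j (int k)))"
proof -
  let ?q = "dyson_quot S n i j"
  define M where "M = nat (lookup \<gamma> j - lookup \<gamma> i)"
  define pt where "pt k = \<gamma> + single i (k - 1) - single j k" for k :: int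
  define u where "u k = lookup ?q (pt k)" for k
  have lookup_q: "lookup (zpow p 1 * ?q) \<beta> = lookup ?q (\<beta> - single p 1)" for p \<beta>
    by (simp add: zpow_def lookup_single_mult)
  have pt1: "\<gamma> + single i k - single j k - single i 1 = pt k" for k
    by (simp add: pt_def single_diff algebra_simps)
  have pt2: "\<gamma> + single i k - single j k - single j 1 = pt (k + 1)" for k
    by (simp add: pt_def single_add algebra_simps)
  have d: "lookup (dyson S (\<lambda>_. n)) (\<gamma> + single i k - single j k) = u k - u (k + 1)" for k
    using assms
    by (simp add: dyson_eq_quot left_diff_distrib lookup_minus lookup_q u_def pt1 pt2)
  \<comment> \<open>Exchanging z_i and z_j reflects the line of exponents: \<gamma>_j - k =
    \<gamma>_i + (M + 1 - k) - 1.\<close>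
  have "Poly_Mapping.map_key (transpose i j) (pt k) = pt (int M + 1 - k)" for k
    using assms(4,6)
    by (intro poly_mapping_eqI)
      (auto simp: pt_def M_def lookup_add lookup_minus lookup_single when_def transpose_def)
  then have "u (int M + 1 - k) = - u k" for k
    using arg_cong[OF swap_vars_dyson_quot[OF assms(1-5)], of "\<lambda>f. lookup f (pt k)"]
    by (simp add: u_def)
  from this[of 1] have anti: "u (int M) = - u 1"
    by simp
  have tele: "(\<Sum>k<m. u (int k) - u (int k + 1)) = u 0 - u (int m)" for m
    by (induction m) (simp_all add: algebra_simps)
  have "lookup ((zpow i 1 + zpow j 1) * ?q) \<gamma> = u 0 + u 1"
    using pt1[of 0] pt2[of 0] by (simp add: distrib_right lookup_add lookup_q u_def)
  also have "\<dots> = (\<Sum>k<M. u (int k) - u (int k + 1))"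
    by (simp add: tele anti)
  finally show ?thesis
    by (simp add: d M_def)
qed

text \<open>Coefficients of z^\<gamma> are compared in \<open>theta_dyson\<close>. As \<gamma>_i is
  minimal, \<open>dyson_quot_coeffs\<close> applies to every j. For each j in \<open>J\<close> its
  summand k = 0 is the coefficient at \<gamma> itself; moved to the left, these summands produce
  \<open>card J\<close> * n, with the same sign as - \<gamma>_i when \<gamma>_i is negative.\<close>

theorem dyson_coeff_recursion:
  fixes \<gamma> :: "nat \<Rightarrow>\<^sub>0 int"
  assumes "finite S" "i \<in> S" "n > 0" "\<And>j. j \<in> S \<Longrightarrow> lookup \<gamma> i \<le> lookup \<gamma> j"
  defines "J \<equiv> {j \<in> S. lookup \<gamma> i < lookup \<gamma> j}"
  shows "(of_int (- lookup \<gamma> i) + of_nat (card J) * of_nat n) * lookup (dyson S (\<lambda>_. n)) \<gamma> =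
    - of_nat n * (\<Sum>j\<in>J. \<Sum>k\<in>{1..<nat (lookup \<gamma> j - lookup \<gamma> i)}.
       lookup (dyson S (\<lambda>_. n)) (\<gamma> + single i (int k) - single j (int k)))"
proof -
  let ?D = "dyson S (\<lambda>_. n)"
  define d where "d j k = lookup ?D (\<gamma> + single i (int k) - single j (int k))" for j k
  define m where "m j = nat (lookup \<gamma> j - lookup \<gamma> i)" for j
  have "of_int (lookup \<gamma> i) * lookup ?D \<gamma> = lookup (theta i ?D) \<gamma>"
    by simp
  also have "\<dots> = of_nat n * (\<Sum>j\<in>S - {i}. lookup ((zpow i 1 + zpow j 1) * dyson_quot S n i j) \<gamma>)"
    using assms by (simp add: theta_dyson lookup_sum flip: single_of_nat)
  also have "(\<Sum>j\<in>S - {i}. lookup ((zpow i 1 + zpow j 1) * dyson_quot S n i j) \<gamma>) =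
      (\<Sum>j\<in>S - {i}. \<Sum>k<m j. d j k)"
    unfolding d_def m_def using assms by (intro sum.cong refl dyson_quot_coeffs) auto
  also have "\<dots> = (\<Sum>j\<in>J. \<Sum>k<m j. d j k)"
  proof (rule sum.mono_neutral_right)
    have "m j = 0" if "j \<in> S - {i} - J" for j
      using that by (auto simp: J_def m_def)
    then show "\<forall>j\<in>S - {i} - J. (\<Sum>k<m j. d j k) = 0"
      by simp
  qed (use assms in auto)
  also have "\<dots> = (\<Sum>j\<in>J. lookup ?D \<gamma> + (\<Sum>k\<in>{1..<m j}. d j k))"
  proof (intro sum.cong refl)
    fix j assume "j \<in> J"
    then have "{..<m j} = insert 0 {1..<m j}"
      by (auto simp: J_def m_def)
    then show "(\<Sum>k<m j. d j k) = lookup ?D \<gamma> + (\<Sum>k\<in>{1..<m j}. d j k)"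
      by (simp add: d_def)
  qed
  also have "\<dots> = of_nat (card J) * lookup ?D \<gamma> + (\<Sum>j\<in>J. \<Sum>k\<in>{1..<m j}. d j k)"
    by (simp add: sum.distrib)
  finally show ?thesis
    by (simp add: d_def m_def algebra_simps)
qed

section \<open>Values of rational functions\<close>

lemma regular_atE:
  assumes "regular_at f x"
  obtains a b where "f = Fract a b" "poly b x \<noteq> 0" "b \<noteq> 0" "rf_value f x = poly a x / poly b x"
  using assms rf_value_Fract unfolding regular_at_def by (metis poly_0)

lemma regular_at_Fract: "poly b x \<noteq> 0 \<Longrightarrow> regular_at (Fract a b) x"
  by (auto simp: regular_at_def)

lemma regular_at_add_value:
  assumes "regular_at f x" "regular_at g x"
  shows "regular_at (f + g) x \<and> rf_value (f + g) x = rf_value f x + rf_value g x"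
proof -
  obtain a b where f: "f = Fract a b" "poly b x \<noteq> 0" "b \<noteq> 0" "rf_value f x = poly a x / poly b x"
    using assms(1) by (rule regular_atE)
  obtain c d where g: "g = Fract c d" "poly d x \<noteq> 0" "d \<noteq> 0" "rf_value g x = poly c x / poly d x"
    using assms(2) by (rule regular_atE)
  have "f + g = Fract (a * d + c * b) (b * d)"
    using f g by simp
  then show ?thesis
    using f g by (simp add: regular_at_Fract rf_value_Fract add_frac_eq)
qed

lemma regular_at_mult_value:
  assumes "regular_at f x" "regular_at g x"
  shows "regular_at (f * g) x \<and> rf_value (f * g) x = rf_value f x * rf_value g x"
proof -
  obtain a b where f: "f = Fract a b" "poly b x \<noteq> 0" "b \<noteq> 0" "rf_value f x = poly a x / poly b x"
    using assms(1) by (rule regular_atE)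
  obtain c d where g: "g = Fract c d" "poly d x \<noteq> 0" "d \<noteq> 0" "rf_value g x = poly c x / poly d x"
    using assms(2) by (rule regular_atE)
  have "f * g = Fract (a * c) (b * d)"
    using f g by simp
  then show ?thesis
    using f g by (simp add: regular_at_Fract rf_value_Fract)
qed

lemmas regular_at_add = regular_at_add_value[THEN conjunct1]
  and rf_value_add = regular_at_add_value[THEN conjunct2]
  and regular_at_mult = regular_at_mult_value[THEN conjunct1]
  and rf_value_mult = regular_at_mult_value[THEN conjunct2]

lemma regular_at_to_fract [simp]: "regular_at (to_fract p) x"
  by (simp add: to_fract_def regular_at_Fract)

lemma rf_value_to_fract [simp]: "rf_value (to_fract p) x = poly p x"
  by (simp add: to_fract_def rf_value_Fract)

lemma regular_at_0 [simp]: "regular_at 0 x"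
  and rf_value_0 [simp]: "rf_value 0 x = 0"
  using regular_at_to_fract[of 0 x] rf_value_to_fract[of 0 x] by simp_all

lemma regular_at_1 [simp]: "regular_at 1 x"
  and rf_value_1 [simp]: "rf_value 1 x = 1"
  using regular_at_to_fract[of 1 x] rf_value_to_fract[of 1 x] by simp_all

lemma regular_at_sum_value:
  assumes "\<And>i. i \<in> I \<Longrightarrow> regular_at (f i) x"
  shows "regular_at (\<Sum>i\<in>I. f i) x \<and> rf_value (\<Sum>i\<in>I. f i) x = (\<Sum>i\<in>I. rf_value (f i) x)"
  using assms
  by (induction I rule: infinite_finite_induct) (simp_all add: regular_at_add rf_value_add)

lemmas regular_at_sum = regular_at_sum_value[THEN conjunct1]
  and rf_value_sum = regular_at_sum_value[THEN conjunct2]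

lemma regular_at_power_value:
  assumes "regular_at f x"
  shows "regular_at (f ^ n) x \<and> rf_value (f ^ n) x = rf_value f x ^ n"
  using assms by (induction n) (simp_all add: regular_at_mult rf_value_mult)

lemmas regular_at_power = regular_at_power_value[THEN conjunct1]
  and rf_value_power = regular_at_power_value[THEN conjunct2]

lemma ratfun_eqI:
  assumes "infinite A" "\<And>x. x \<in> A \<Longrightarrow> regular_at f x" "\<And>x. x \<in> A \<Longrightarrow> regular_at g x"
    and "\<And>x. x \<in> A \<Longrightarrow> rf_value f x = rf_value g x"
  shows "f = g"
proof -
  obtain a b where f: "f = Fract a b" "b \<noteq> 0"
    by (cases f)
  obtain c d where g: "g = Fract c d" "d \<noteq> 0"
    by (cases g)
  define Z where "Z = {x. poly b x = 0} \<union> {x. poly d x = 0}"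
  have "finite Z"
    using f g by (simp add: Z_def poly_roots_finite)
  then have inf: "infinite (A - Z)"
    using assms(1) by simp
  have "poly (a * d - c * b) x = 0" if "x \<in> A - Z" for x
    using that assms(4)[of x] f g by (simp add: Z_def rf_value_Fract field_simps)
  then have "infinite {x. poly (a * d - c * b) x = 0}"
    using inf by (metis (mono_tags, lifting) finite_subset mem_Collect_eq subsetI)
  then have "a * d - c * b = 0"
    using poly_roots_finite by blast
  then show ?thesis
    using f g by (simp add: eq_fract)
qed

definition alpha_var :: ratfun where
  "alpha_var = to_fract [:0, 1:]"

lemma regular_at_alpha_var [simp]: "regular_at alpha_var x"
  and rf_value_alpha_var [simp]: "rf_value alpha_var x = x"
  by (simp_all add: alpha_var_def)

lemma alpha_var_nonzero [simp]: "alpha_var \<noteq> 0"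
  by (simp add: alpha_var_def)

section \<open>The coefficients of the Dyson product as functions of the exponent\<close>

definition neg_count :: "nat set \<Rightarrow> (nat \<Rightarrow>\<^sub>0 int) \<Rightarrow> nat" where
  "neg_count S \<gamma> = card {p \<in> S. lookup \<gamma> p < 0}"

text \<open>D is homogeneous of degree 0 in the variables of \<open>S\<close>.\<close>

lemma dyson_coeff_eq_0:
  assumes "finite S" "\<not> (keys \<gamma> \<subseteq> S \<and> (\<Sum>p\<in>S. lookup \<gamma> p) = 0)"
  shows "lookup (dyson S a) \<gamma> = 0"
proof -
  have "keys (dyson S a) \<subseteq> {\<beta>. (\<forall>p. p \<notin> S \<longrightarrow> lookup \<beta> p = 0) \<and> (\<Sum>p\<in>S. lookup \<beta> p) = 0}"
  proof (rule keys_dyson_subset)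
    fix p q assume "p \<in> S" "q \<in> S" "p \<noteq> q"
    then show "single p (1::int) + single q (-1) \<in>
        {\<beta>. (\<forall>p. p \<notin> S \<longrightarrow> lookup \<beta> p = 0) \<and> (\<Sum>p\<in>S. lookup \<beta> p) = 0}"
      using assms(1) by (auto simp: lookup_add lookup_single when_def sum.distrib)
  qed (auto simp: lookup_add sum.distrib)
  then have "\<gamma> \<in> keys (dyson S a) \<Longrightarrow> keys \<gamma> \<subseteq> S \<and> (\<Sum>p\<in>S. lookup \<gamma> p) = 0"
    by (fastforce simp: in_keys_iff[of _ \<gamma>])
  then show ?thesis
    using assms(2) by (meson in_keys_iff)
qed

text \<open>
  The power of \<open>\<alpha>\<close> gives a lower bound for the order of vanishing at \<open>\<alpha> = 0\<close>: each application of
  \<open>dyson_coeff_recursion\<close> contributes a factor \<open>\<alpha>\<close> and removes at most one negative exponent.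
\<close>

theorem dyson_coeff_rational:
  fixes \<gamma> :: "nat \<Rightarrow>\<^sub>0 int"
  assumes "finite S"
  shows "\<exists>L. (\<forall>x\<ge>0. regular_at L x) \<and> (\<gamma> = 0 \<longrightarrow> L = 1) \<and>
    (\<not> (keys \<gamma> \<subseteq> S \<and> (\<Sum>p\<in>S. lookup \<gamma> p) = 0) \<longrightarrow> L = 0) \<and>
    (\<forall>n>0. lookup (dyson S (\<lambda>_. n)) \<gamma> = lookup (dyson S (\<lambda>_. n)) 0 *
       of_rat (rf_value (alpha_var ^ neg_count S \<gamma> * L) (of_nat n)))"
proof (induction "nat (\<Sum>p\<in>S. (lookup \<gamma> p)\<^sup>2)" arbitrary: \<gamma> rule: less_induct)
  case less
  let ?D = "\<lambda>n. dyson S (\<lambda>_. n)"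
  consider "\<gamma> = 0" | "\<not> (keys \<gamma> \<subseteq> S \<and> (\<Sum>p\<in>S. lookup \<gamma> p) = 0)"
    | "\<gamma> \<noteq> 0" "keys \<gamma> \<subseteq> S" "(\<Sum>p\<in>S. lookup \<gamma> p) = 0"
    by blast
  then show ?case
  proof cases
    case 1
    then show ?thesis
      by (intro exI[of _ 1]) (simp add: neg_count_def)
  next
    case 2
    then have "\<gamma> \<noteq> 0"
      by auto
    then show ?thesis
      using 2 assms by (intro exI[of _ 0]) (simp add: dyson_coeff_eq_0)
  next
    case 3
    obtain p where p: "p \<in> keys \<gamma>"
      using 3(1) keys_eq_empty by blast
    then have "S \<noteq> {}"
      using 3 by auto
    obtain i where i: "i \<in> S" "\<And>j. j \<in> S \<Longrightarrow> lookup \<gamma> i \<le> lookup \<gamma> j"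
      using assms \<open>S \<noteq> {}\<close> arg_min_if_finite(1)[of S "lookup \<gamma>"] arg_min_least[of S _ "lookup \<gamma>"]
      by blast
    \<comment> \<open>Exponents that are not all 0 but have sum 0 have a negative minimum.\<close>
    have neg: "lookup \<gamma> i < 0"
    proof (rule ccontr)
      assume "\<not> lookup \<gamma> i < 0"
      then have "\<forall>j\<in>S. 0 \<le> lookup \<gamma> j"
        using i(2) by force
      then have "\<forall>j\<in>S. lookup \<gamma> j = 0"
        using 3(3) assms sum_nonneg_eq_0_iff by blast
      then show False
        using p 3(2) by (auto simp: in_keys_iff)
    qed
    define J where "J = {j \<in> S. lookup \<gamma> i < lookup \<gamma> j}"
    define K where "K j = {1..<nat (lookup \<gamma> j - lookup \<gamma> i)}" for j
    define \<gamma>' where "\<gamma>' j k = \<gamma> + single i (int k) - single j (int k)" for j k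
    define \<nu> where "\<nu> = neg_count S \<gamma>"
    have finJ: "finite J"
      using assms by (simp add: J_def)
    have smaller: "nat (\<Sum>p\<in>S. (lookup (\<gamma>' j k) p)\<^sup>2) < nat (\<Sum>p\<in>S. (lookup \<gamma> p)\<^sup>2)"
      and nu: "\<nu> \<le> neg_count S (\<gamma>' j k) + 1"
      if jk: "j \<in> J" "k \<in> K j" for j k
    proof -
      have j: "j \<in> S" "j \<noteq> i" and k: "0 < int k" "int k < lookup \<gamma> j - lookup \<gamma> i"
        using jk by (auto simp: J_def K_def)
      have lk: "lookup (\<gamma>' j k) p = lookup \<gamma> p + (if p = i then int k else 0) - (if p = j then int k else 0)" for p
        by (simp add: \<gamma>'_def lookup_add lookup_minus lookup_single when_def)
      have fin: "finite (S - {i} - {j})"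
        using assms by simp
      have split: "(\<Sum>p\<in>S. f p) = f i + (f j + (\<Sum>p\<in>S - {i} - {j}. f p))" for f :: "nat \<Rightarrow> int"
        using assms i(1) j by (simp add: sum.remove[of S i] sum.remove[of "S - {i}" j])
      have rest: "(\<Sum>p\<in>S - {i} - {j}. (lookup (\<gamma>' j k) p)\<^sup>2) = (\<Sum>p\<in>S - {i} - {j}. (lookup \<gamma> p)\<^sup>2)"
        by (intro sum.cong) (auto simp: lk)
      \<comment> \<open>The exponents at i and j move towards each other without passing, which
        lowers the sum of squares.\<close>
      have "(lookup \<gamma> i + int k)\<^sup>2 + (lookup \<gamma> j - int k)\<^sup>2 =
          (lookup \<gamma> i)\<^sup>2 + (lookup \<gamma> j)\<^sup>2 - 2 * (int k * (lookup \<gamma> j - lookup \<gamma> i - int k))"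
        by (simp add: power2_eq_square algebra_simps)
      moreover have "int k * (lookup \<gamma> j - lookup \<gamma> i - int k) > 0"
        using k by simp
      ultimately have "(\<Sum>p\<in>S. (lookup (\<gamma>' j k) p)\<^sup>2) < (\<Sum>p\<in>S. (lookup \<gamma> p)\<^sup>2)"
        using j by (simp add: split rest) (simp add: lk)
      moreover have "(\<Sum>p\<in>S. (lookup (\<gamma>' j k) p)\<^sup>2) \<ge> 0"
        by (simp add: sum_nonneg)
      ultimately show "nat (\<Sum>p\<in>S. (lookup (\<gamma>' j k) p)\<^sup>2) < nat (\<Sum>p\<in>S. (lookup \<gamma> p)\<^sup>2)"
        by linarith
      \<comment> \<open>The exponent at j only decreases, so i is the only place where a negative
        exponent can be lost.\<close>
      have "{p \<in> S. lookup \<gamma> p < 0} \<subseteq> insert i {p \<in> S. lookup (\<gamma>' j k) p < 0}"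
        using k by (auto simp: lk)
      then have "neg_count S \<gamma> \<le> card (insert i {p \<in> S. lookup (\<gamma>' j k) p < 0})"
        unfolding neg_count_def using assms by (intro card_mono) auto
      also have "\<dots> \<le> neg_count S (\<gamma>' j k) + 1"
        unfolding neg_count_def using assms by (simp add: card_insert_if)
      finally show "\<nu> \<le> neg_count S (\<gamma>' j k) + 1"
        by (simp add: \<nu>_def)
    qed
    have "\<forall>j k. \<exists>L. j \<in> J \<longrightarrow> k \<in> K j \<longrightarrow> (\<forall>x\<ge>0. regular_at L x) \<and>
        (\<forall>n>0. lookup (?D n) (\<gamma>' j k) = lookup (?D n) 0 *
          of_rat (rf_value (alpha_var ^ neg_count S (\<gamma>' j k) * L) (of_nat n)))"
      using less[OF smaller] by blast
    then obtain L' where L':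
      "\<And>j k x. j \<in> J \<Longrightarrow> k \<in> K j \<Longrightarrow> x \<ge> 0 \<Longrightarrow> regular_at (L' j k) x"
      "\<And>j k n. j \<in> J \<Longrightarrow> k \<in> K j \<Longrightarrow> n > 0 \<Longrightarrow> lookup (?D n) (\<gamma>' j k) = lookup (?D n) 0 *
          of_rat (rf_value (alpha_var ^ neg_count S (\<gamma>' j k) * L' j k) (of_nat n))"
      by metis
    \<comment> \<open>The denominator - \<gamma>_i + \<open>card J\<close> \<alpha> of the
      recursion. As \<gamma>_i < 0 it has no root at \<alpha> >= 0.\<close>
    define b where "b = [:of_int (- lookup \<gamma> i), of_nat (card J):: rat:]"
    \<comment> \<open>One factor \<alpha> from the recursion and those of the induction hypothesis,
      less the \<open>\<nu>\<close> factors kept outside \<open>L\<close>; \<open>nu\<close> makes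
      the subtraction exact.\<close>
    define e where "e j k = neg_count S (\<gamma>' j k) + 1 - \<nu>" for j k
    define G where "G = (\<Sum>j\<in>J. \<Sum>k\<in>K j. alpha_var ^ e j k * L' j k)"
    define L where "L = Fract (-1) b * G"
    have b_pos: "poly b x > 0" if "x \<ge> 0" for x
    proof -
      have "rat_of_int (lookup \<gamma> i) < 0" "0 \<le> x * rat_of_nat (card J)"
        using that neg by simp_all
      then show ?thesis
        by (simp add: b_def)
    qed
    have reg_term: "regular_at (alpha_var ^ e j k * L' j k) x" if "j \<in> J" "k \<in> K j" "x \<ge> 0" for j k x
      using that L'(1) by (intro regular_at_mult regular_at_power) auto
    have reg_G: "regular_at G x" if "x \<ge> 0" for x
      unfolding G_def using that reg_term by (intro regular_at_sum) auto
    have reg_b: "regular_at (Fract (-1) b) x" if "x \<ge> 0" for x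
      using b_pos[OF that] by (intro regular_at_Fract) auto
    have "\<forall>x\<ge>0. regular_at L x"
      unfolding L_def using reg_b reg_G by (intro allI impI regular_at_mult) auto
    moreover have "lookup (?D n) \<gamma> = lookup (?D n) 0 *
        of_rat (rf_value (alpha_var ^ \<nu> * L) (of_nat n))" if n: "n > 0" for n
    proof -
      have val_term: "rf_value (alpha_var ^ neg_count S (\<gamma>' j k) * L' j k) (of_nat n) * of_nat n =
          of_nat n ^ \<nu> * rf_value (alpha_var ^ e j k * L' j k) (of_nat n)"
        if "j \<in> J" "k \<in> K j" for j k
        using nu[OF that] L'(1)[OF that, of "of_nat n"]
        by (simp add: e_def rf_value_mult rf_value_power regular_at_power flip: power_add mult.assoc)
      have "rf_value L (of_nat n) = - rf_value G (of_nat n) / poly b (of_nat n)"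
        using reg_b[of "of_nat n"] reg_G[of "of_nat n"] b_pos[of "of_nat n"]
        by (simp add: L_def rf_value_mult rf_value_Fract)
      then have "poly b (of_nat n) * rf_value (alpha_var ^ \<nu> * L) (of_nat n) =
          - (of_nat n ^ \<nu> * rf_value G (of_nat n))"
        using \<open>\<forall>x\<ge>0. regular_at L x\<close> b_pos[of "of_nat n"]
        by (simp add: rf_value_mult rf_value_power regular_at_power)
      also have "\<dots> = - (\<Sum>j\<in>J. \<Sum>k\<in>K j.
          rf_value (alpha_var ^ neg_count S (\<gamma>' j k) * L' j k) (of_nat n) * of_nat n)"
        using reg_term
        by (simp add: G_def rf_value_sum regular_at_sum val_term sum_distrib_left cong: sum.cong)
      finally have val: "poly b (of_nat n) * rf_value (alpha_var ^ \<nu> * L) (of_nat n) =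
          - (\<Sum>j\<in>J. \<Sum>k\<in>K j.
            rf_value (alpha_var ^ neg_count S (\<gamma>' j k) * L' j k) (of_nat n) * of_nat n)" .
      have "of_rat (poly b (of_nat n)) * lookup (?D n) \<gamma> =
          - of_nat n * (\<Sum>j\<in>J. \<Sum>k\<in>K j. lookup (?D n) (\<gamma>' j k))"
        using dyson_coeff_recursion[OF assms i(1) n i(2)]
        by (simp add: b_def J_def K_def \<gamma>'_def of_rat_add of_rat_diff of_rat_mult mult.commute)
      also have "\<dots> = lookup (?D n) 0 * of_rat (poly b (of_nat n) * rf_value (alpha_var ^ \<nu> * L) (of_nat n))"
        unfolding val
        by (simp add: L'(2) n of_rat_sum of_rat_mult of_rat_minus sum_distrib_left sum_negf mult_ac cong: sum.cong)
      finally show ?thesis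
        using b_pos[of "of_nat n"] by (simp add: of_rat_mult)
    qed
    ultimately show ?thesis
      using 3 by (intro exI[of _ L]) (simp add: \<nu>_def)
  qed
qed

section \<open>Exponentials of operator series\<close>

lemma vscale_eq_mult: "vscale c v = single 0 c * v"
  by (simp add: vscale_def mult_map_scale_conv_mult)

text \<open>The commutative counterpart of \<open>op_exp\<close>. Once the operators have become
  multiplications, their exponential is computed with formal power series.\<close>

definition exp_coeff :: "('m::comm_monoid_add \<Rightarrow>\<^sub>0 complex) fps \<Rightarrow> nat \<Rightarrow> 'm \<Rightarrow>\<^sub>0 complex" where
  "exp_coeff b n = (\<Sum>k\<le>n. single 0 (1 / fact k) * fps_nth (b ^ k) n)"

lemma op_power_intertwine:
  fixes \<Phi> :: "('m::comm_monoid_add \<Rightarrow>\<^sub>0 complex) \<Rightarrow> fock"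
  assumes add: "\<And>f g. \<Phi> (f + g) = \<Phi> f + \<Phi> g"
    and B: "\<And>n f. B n (\<Phi> f) = \<Phi> (fps_nth b n * f)"
  shows "op_power B k n (\<Phi> f) = \<Phi> (fps_nth (b ^ k) n * f)"
proof (induction k arbitrary: n)
  case 0
  have "\<Phi> 0 = 0"
    using add[of 0 0] by simp
  then show ?case
    by simp
next
  case (Suc k)
  have sum: "\<Phi> (\<Sum>i\<in>I. h i) = (\<Sum>i\<in>I. \<Phi> (h i))" for I :: "nat set" and h
    using add add[of 0 0] by (induction I rule: infinite_finite_induct) auto
  show ?case
    by (simp add: Suc.IH B fps_mult_nth sum_distrib_right sum mult.assoc atMost_atLeast0)
qed

text \<open>If the operators act on the image of \<open>\<Phi>\<close> as multiplications by b_n, so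
  does their exponential. The creation part uses \<open>\<Phi>\<close> = multiplication with a fixed
  vector, the annihilation part \<open>\<Phi>\<close> = \<open>fock_lift\<close>.\<close>

lemma op_exp_intertwine:
  fixes \<Phi> :: "('m::comm_monoid_add \<Rightarrow>\<^sub>0 complex) \<Rightarrow> fock"
  assumes add: "\<And>f g. \<Phi> (f + g) = \<Phi> f + \<Phi> g"
    and scale: "\<And>c f. \<Phi> (single 0 c * f) = vscale c (\<Phi> f)"
    and B: "\<And>n f. B n (\<Phi> f) = \<Phi> (fps_nth b n * f)"
  shows "op_exp B n (\<Phi> f) = \<Phi> (exp_coeff b n * f)"
proof -
  have sum: "\<Phi> (\<Sum>i\<in>I. h i) = (\<Sum>i\<in>I. \<Phi> (h i))" for I :: "nat set" and h
    using add add[of 0 0] by (induction I rule: infinite_finite_induct) auto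
  show ?thesis
    by (simp add: op_exp_def exp_coeff_def op_power_intertwine[of \<Phi>, OF add B] sum_distrib_right sum
        mult.assoc scale)
qed

lemma of_nat_mult_cancel_poly_mapping:
  fixes x y :: "'m::comm_monoid_add \<Rightarrow>\<^sub>0 complex"
  assumes "of_nat (Suc n) * x = of_nat (Suc n) * y"
  shows "x = y"
proof (rule poly_mapping_eqI)
  fix k
  have "lookup (single 0 (of_nat (Suc n)) * x) k = lookup (single 0 (of_nat (Suc n)) * y) k"
    using assms by (simp only: single_of_nat)
  then show "lookup x k = lookup y k"
    by (simp del: of_nat_Suc single_of_nat)
qed

text \<open>exp b solves x' = b' x with constant term 1, and this equation determines the
  coefficients one after the other.\<close>

lemma exp_coeff_unique:
  fixes b x :: "('m::comm_monoid_add \<Rightarrow>\<^sub>0 complex) fps"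
  assumes b0: "fps_nth b 0 = 0" and x0: "fps_nth x 0 = 1"
    and ode: "fps_deriv x = fps_deriv b * x"
  shows "exp_coeff b n = fps_nth x n"
proof -
  define E where "E = Abs_fps (exp_coeff b)"
  \<comment> \<open>Since b has no constant term, b^k does not reach degrees below k, and all
    truncated sums may run to a common bound.\<close>
  have trunc: "exp_coeff b m = (\<Sum>k\<le>N. single 0 (1 / fact k) * fps_nth (b ^ k) m)" if "m \<le> N" for m N
    unfolding exp_coeff_def using that b0
    by (intro sum.mono_neutral_left) (auto simp: startsby_zero_power_prefix)
  have "fps_deriv E = fps_deriv b * E"
  proof (rule fps_ext)
    fix m
    have *: "of_nat (Suc m) * (single 0 (1 / fact (Suc k)) * fps_nth (b ^ Suc k) (Suc m)) =
        single 0 (1 / fact k) * fps_nth (fps_deriv b * b ^ k) m" for k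
    proof -
      have "of_nat (Suc m) * fps_nth (b ^ Suc k) (Suc m) = fps_nth (fps_deriv (b ^ Suc k)) m"
        by (simp only: fps_deriv_nth Suc_eq_plus1)
      also have "\<dots> = of_nat (Suc k) * fps_nth (fps_deriv b * b ^ k) m"
        unfolding fps_deriv_power by (simp add: mult.assoc del: of_nat_Suc)
      finally have 1: "of_nat (Suc m) * fps_nth (b ^ Suc k) (Suc m) =
          of_nat (Suc k) * fps_nth (fps_deriv b * b ^ k) m" .
      have 2: "single 0 (1 / fact (Suc k)) * of_nat (Suc k) = (single 0 (1 / fact k) :: 'm \<Rightarrow>\<^sub>0 complex)"
        by (simp add: mult_single flip: single_of_nat del: of_nat_Suc)
      show ?thesis
        unfolding mult.left_commute[of "of_nat (Suc m)"] 1
        by (simp only: mult.assoc[symmetric] 2)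
    qed
    have "fps_nth (fps_deriv E) m =
        of_nat (Suc m) * (\<Sum>k\<le>Suc m. single 0 (1 / fact k) * fps_nth (b ^ k) (Suc m))"
      by (simp add: E_def exp_coeff_def)
    also have "\<dots> = (\<Sum>k\<le>m. single 0 (1 / fact k) * fps_nth (fps_deriv b * b ^ k) m)"
      unfolding sum.atMost_Suc_shift sum_distrib_left distrib_left * by simp
    also have "\<dots> = (\<Sum>i=0..m. \<Sum>k\<le>m. fps_nth (fps_deriv b) i * (single 0 (1 / fact k) * fps_nth (b ^ k) (m - i)))"
      unfolding fps_mult_nth sum_distrib_left by (subst sum.swap) (simp add: mult_ac)
    also have "\<dots> = fps_nth (fps_deriv b * E) m"
      unfolding fps_mult_nth by (simp add: E_def trunc[of _ m] sum_distrib_left)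
    finally show "fps_nth (fps_deriv E) m = fps_nth (fps_deriv b * E) m" .
  qed
  moreover have "fps_nth E 0 = 1"
    by (simp add: E_def exp_coeff_def)
  moreover have "fps_nth E n = fps_nth x n"
  proof (induction n rule: less_induct)
    case (less n)
    show ?case
    proof (cases n)
      case (Suc m)
      have "of_nat (Suc m) * fps_nth E (Suc m) = fps_nth (fps_deriv E) m"
        by simp
      also have "\<dots> = fps_nth (fps_deriv x) m"
        unfolding \<open>fps_deriv E = fps_deriv b * E\<close> ode fps_mult_nth
        using less Suc by (intro sum.cong) auto
      also have "\<dots> = of_nat (Suc m) * fps_nth x (Suc m)"
        by simp
      finally show ?thesis
        unfolding Suc by (rule of_nat_mult_cancel_poly_mapping)
    qed (simp add: x0 \<open>fps_nth E 0 = 1\<close>)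
  qed
  ultimately show ?thesis
    by (simp add: E_def)
qed

section \<open>The modes of the creation part\<close>

text \<open>The degree: index i stands for the variable h_{-(i+1)} of degree i + 1.\<close>

definition weight :: "nat multiset \<Rightarrow> nat" where
  "weight M = (\<Sum>i\<in>#M. Suc i)"

lemma weight_empty [simp]: "weight {#} = 0"
  and weight_add_mset [simp]: "weight (add_mset i M) = Suc i + weight M"
  and weight_plus [simp]: "weight (M + N) = weight M + weight N"
  by (simp_all add: weight_def)

lemma size_le_weight: "size M \<le> weight M"
  by (induction M) auto

lemma member_less_weight: "i \<in># M \<Longrightarrow> i < weight M"
  by (induction M) auto

lemma weight_eq_sum_count: "weight M = (\<Sum>i\<in>set_mset M. count M i * Suc i)"
proof (induction M)
  case (add x M)
  have "(\<Sum>i\<in>set_mset (add_mset x M). count (add_mset x M) i * Suc i) =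
      (\<Sum>i\<in>insert x (set_mset M). count M i * Suc i + (if i = x then Suc x else 0))"
    by (intro sum.cong) auto
  also have "\<dots> = (\<Sum>i\<in>insert x (set_mset M). count M i * Suc i) + Suc x"
    by (simp add: sum.distrib del: sum.insert)
  also have "(\<Sum>i\<in>insert x (set_mset M). count M i * Suc i) = (\<Sum>i\<in>set_mset M. count M i * Suc i)"
    by (intro sum.mono_neutral_right) (auto simp: not_in_iff)
  finally show ?case
    by (simp add: add.IH)
qed simp

lemma finite_weight_le: "finite {M. weight M \<le> n}"
proof (rule finite_subset)
  show "{M. weight M \<le> n} \<subseteq> (\<Union>k\<le>n. multisets_of_size {..<n} k)"
  proof
    fix M assume "M \<in> {M. weight M \<le> n}"
    then have "size M \<le> n" "set_mset M \<subseteq> {..<n}"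
      using size_le_weight[of M] member_less_weight[of _ M] by fastforce+
    then show "M \<in> (\<Union>k\<le>n. multisets_of_size {..<n} k)"
      by (simp add: multisets_of_size_def)
  qed
qed auto

text \<open>The number 1/z_\<mu>, z_\<mu> = prod_n n^(m_n) m_n!, of the expansion of complete
  symmetric functions in power sums; m_n is the number of parts n = i + 1.\<close>

definition zinv :: "nat multiset \<Rightarrow> rat" where
  "zinv M = (\<Prod>i\<in>set_mset M. 1 / (of_nat (Suc i) ^ count M i * fact (count M i)))"

lemma zinv_superset:
  assumes "finite A" "set_mset M \<subseteq> A"
  shows "zinv M = (\<Prod>i\<in>A. 1 / (of_nat (Suc i) ^ count M i * fact (count M i)))"
  unfolding zinv_def using assms
  by (intro prod.mono_neutral_left) (auto simp: not_in_iff)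

lemma zinv_nonzero [simp]: "zinv M \<noteq> 0"
  by (simp add: zinv_def del: of_nat_Suc)

lemma zinv_empty [simp]: "zinv {#} = 1"
  by (simp add: zinv_def)

lemma zinv_add_mset: "of_nat (Suc i) * of_nat (Suc (count M i)) * zinv (add_mset i M) = zinv M"
proof -
  define A where "A = set_mset M - {i}"
  have A: "finite A" "i \<notin> A" "set_mset M \<subseteq> insert i A" "set_mset (add_mset i M) \<subseteq> insert i A"
    by (auto simp: A_def)
  have "(\<Prod>j\<in>A. 1 / (of_nat (Suc j) ^ count (add_mset i M) j * fact (count (add_mset i M) j))) =
      (\<Prod>j\<in>A. 1 / (of_nat (Suc j) ^ count M j * fact (count M j)) :: rat)"
    using A by (intro prod.cong) auto
  then show ?thesis
    using A by (simp add: zinv_superset[of "insert i A"] del: of_nat_Suc)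
qed

text \<open>
  The coefficient of \<open>z\<^sup>n\<close> in \<open>exp (\<Sum> h\<^sub>-\<^sub>n z\<^sup>n / n)\<close>; the exponent \<open>\<alpha>\<close> is put back by \<open>fock_embed\<close>, which
  substitutes \<open>\<alpha> h\<^sub>-\<^sub>n\<close> for \<open>h\<^sub>-\<^sub>n\<close>.
\<close>

definition row :: "int \<Rightarrow> nat multiset \<Rightarrow>\<^sub>0 rat" where
  "row n = (\<Sum>M\<in>{M. int (weight M) = n}. single M (zinv M))"

lemma lookup_row: "lookup (row n) M = (if int (weight M) = n then zinv M else 0)"
proof -
  have "finite {M. int (weight M) = n}"
    by (rule finite_subset[OF _ finite_weight_le[of "nat n"]]) auto
  then show ?thesis
    by (simp add: row_def lookup_sum lookup_single when_def sum.delta)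
qed

lemma row_0 [simp]: "row 0 = 1"
proof (rule poly_mapping_eqI)
  fix M
  have "weight M = 0 \<longleftrightarrow> M = {#}"
    using size_le_weight[of M] by auto
  then show "lookup (row 0) M = lookup 1 M"
    by (simp add: lookup_row lookup_one when_def)
qed

lemma row_neg: "n < 0 \<Longrightarrow> row n = 0"
  by (rule poly_mapping_eqI) (simp add: lookup_row)

definition fock_embed :: "nat \<Rightarrow> int \<Rightarrow> (nat multiset \<Rightarrow>\<^sub>0 rat) \<Rightarrow> fock" where
  "fock_embed \<alpha> k u = (\<Sum>M\<in>keys u. single (M, k) (of_nat \<alpha> ^ size M * of_rat (lookup u M)))"

lemma lookup_fock_embed:
  "lookup (fock_embed \<alpha> k u) (M, l) = (if l = k then of_nat \<alpha> ^ size M * of_rat (lookup u M) else 0)"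
proof (cases "l = k")
  case True
  have "lookup (fock_embed \<alpha> k u) (M, l) =
      (\<Sum>N\<in>keys u. if N = M then of_nat \<alpha> ^ size M * of_rat (lookup u M) else 0)"
    using True by (simp add: fock_embed_def lookup_sum lookup_single when_def cong: if_cong sum.cong)
  then show ?thesis
    using True by (simp add: in_keys_iff)
next
  case False
  then show ?thesis
    by (simp add: fock_embed_def lookup_sum lookup_single when_def)
qed

lemma fock_embed_eqI:
  assumes "\<And>M l. lookup v (M, l) = (if l = k then of_nat \<alpha> ^ size M * of_rat (lookup u M) else 0)"
  shows "v = fock_embed \<alpha> k u"
  by (rule poly_mapping_eqI) (metis assms lookup_fock_embed surj_pair)

lemma fock_embed_0 [simp]: "fock_embed \<alpha> k 0 = 0"
  by (simp add: fock_embed_def)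

lemma fock_embed_add: "fock_embed \<alpha> k (u + v) = fock_embed \<alpha> k u + fock_embed \<alpha> k v"
  by (rule fock_embed_eqI[symmetric]) (simp add: lookup_add lookup_fock_embed of_rat_add algebra_simps)

lemma fock_embed_single: "fock_embed \<alpha> k (single M c) = single (M, k) (of_nat \<alpha> ^ size M * of_rat c)"
  by (rule fock_embed_eqI[symmetric]) (auto simp: lookup_single when_def)

lemma fock_embed_1: "fock_embed \<alpha> k 1 = single ({#}, k) 1"
  using fock_embed_single[of \<alpha> k 0 1] by simp

lemma fock_embed_mult: "fock_embed \<alpha> k u * fock_embed \<alpha> l v = fock_embed \<alpha> (k + l) (u * v)"
proof (induction u rule: poly_mapping_additive_induct)
  case (single M c)
  show ?case
  proof (induction v rule: poly_mapping_additive_induct)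
    case (single N d)
    show ?case
      by (simp add: fock_embed_single mult_single of_rat_mult power_add mult_ac)
  qed (simp_all add: fock_embed_add algebra_simps)
qed (simp_all add: fock_embed_add algebra_simps)

lemma lookup_single_mult_fock:
  fixes f :: fock
  shows "lookup (single (A, 0) c * f) (M, k) = (if A \<subseteq># M then c * lookup f (M - A, k) else 0)"
proof (induction f rule: poly_mapping_additive_induct)
  case (single x d)
  obtain N l where x: "x = (N, l)"
    by force
  have "A + N = M \<longleftrightarrow> A \<subseteq># M \<and> N = M - A"
    by auto
  then show ?case
    by (auto simp: x mult_single lookup_single when_def)
qed (auto simp: distrib_left lookup_add)

text \<open>As h_{-n} acts by multiplication, the exponential is that of a power series over the
  Fock ring. For the coefficients \<open>row\<close>, the equation x' = b' x is Newton's identity.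
  At a monomial M it says that the parts of M, counted with multiplicity, add up to its
  weight.\<close>

lemma E_plus_eq: "E_plus \<alpha> n v = fock_embed \<alpha> 0 (row (int n)) * v"
proof -
  define b :: "fock fps" where
    "b = Abs_fps (\<lambda>n. if n = 0 then 0 else single ({#n - 1#}, 0) (of_nat \<alpha> / of_nat n))"
  define x where "x = Abs_fps (\<lambda>n. fock_embed \<alpha> 0 (row (int n)))"
  have "op_exp (\<lambda>n v. if n = 0 then 0 else vscale (of_nat \<alpha> / of_nat n) (h_neg n v)) n (1 * v) =
      exp_coeff b n * 1 * v"
    by (rule op_exp_intertwine[where \<Phi> = "\<lambda>u. u * v"])
      (auto simp: algebra_simps vscale_eq_mult h_neg_def b_def mult_single simp flip: mult.assoc)
  moreover have "exp_coeff b n = fps_nth x n"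
  proof (rule exp_coeff_unique)
    show "fps_deriv x = fps_deriv b * x"
    proof (rule fps_ext)
      fix m
      have b': "fps_nth (fps_deriv b) i = single ({#i#}, 0) (of_nat \<alpha>)" for i
        by (simp add: b_def mult_single flip: single_of_nat del: of_nat_Suc)
      have "lookup (fps_nth (fps_deriv x) m) (M, k) = lookup (fps_nth (fps_deriv b * x) m) (M, k)" for M k
      proof (cases "k = 0")
        case True
        have "lookup (fps_nth (fps_deriv b * x) m) (M, 0) =
            (\<Sum>i=0..m. if i \<in># M \<and> weight M = Suc m
              then of_nat (count M i * Suc i) * (of_nat \<alpha> ^ size M * of_rat (zinv M)) else 0)"
          unfolding fps_mult_nth lookup_sum b'
        proof (intro sum.cong refl)
          fix i assume i: "i \<in> {0..m}"
          show "lookup (single ({#i#}, 0) (of_nat \<alpha>) * fps_nth x (m - i)) (M, 0) =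
              (if i \<in># M \<and> weight M = Suc m
                then of_nat (count M i * Suc i) * (of_nat \<alpha> ^ size M * of_rat (zinv M)) else 0)"
          proof (cases "i \<in># M")
            case True
            then obtain N where N: "M = add_mset i N"
              by (metis mset_add)
            have "weight N = m - i \<longleftrightarrow> weight M = Suc m"
              using i N by auto
            moreover have "of_rat (zinv N) =
                of_nat (Suc i) * of_nat (Suc (count N i)) * (of_rat (zinv M) :: complex)"
              unfolding N zinv_add_mset[of i N, symmetric] by (simp add: of_rat_mult del: of_nat_Suc)
            ultimately show ?thesis
              by (simp add: lookup_single_mult_fock x_def lookup_fock_embed lookup_row N) (simp add: algebra_simps)
          qed (simp add: lookup_single_mult_fock)
        qed
        also have "\<dots> = (if weight M = Suc m then of_nat (\<Sum>i\<in>{0..m} \<inter> set_mset M. count M i * Suc i) *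
            (of_nat \<alpha> ^ size M * of_rat (zinv M)) else 0)"
          by (auto simp: sum.inter_restrict sum_distrib_right of_nat_sum intro!: sum.cong)
        also have "\<dots> = lookup (fps_nth (fps_deriv x) m) (M, 0)"
        proof (cases "weight M = Suc m")
          case True
          \<comment> \<open>No part of M exceeds its weight, so the convolution sees all
            parts.\<close>
          have "{0..m} \<inter> set_mset M = set_mset M"
            using member_less_weight[of _ M] True by (auto simp: less_Suc_eq_le)
          then show ?thesis
            using True
            by (simp add: x_def lookup_fock_embed lookup_row weight_eq_sum_count[symmetric]
                flip: single_of_nat del: of_nat_Suc of_nat_sum of_nat_mult mult_Suc_right)
        next
          case False
          then show ?thesis
            by (simp add: x_def lookup_fock_embed lookup_row flip: single_of_nat del: of_nat_Suc)
        qed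
        finally show ?thesis
          using True by simp
      next
        case False
        then show ?thesis
          unfolding fps_mult_nth lookup_sum b'
          by (simp add: lookup_single_mult_fock x_def lookup_fock_embed
              flip: single_of_nat del: of_nat_Suc cong: if_cong)
      qed
      then show "fps_nth (fps_deriv x) m = fps_nth (fps_deriv b * x) m"
        by (intro poly_mapping_eqI) auto
    qed
  qed (simp_all add: b_def x_def fock_embed_1 flip: zero_prod_def)
  ultimately show ?thesis
    by (simp add: E_plus_def x_def)
qed

section \<open>The annihilation part\<close>

lemma lookup_d_h_neg:
  "lookup (d_h_neg n v) (M, k) =
     of_nat (Suc (count M (n - 1))) * lookup v (add_mset (n - 1) M, k)"
proof -
  have "lookup (case x of (N, l) \<Rightarrow> single (N - {#n - 1#}, l) (of_nat (count N (n - 1)) * lookup v (N, l))) (M, k) =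
      (if x = (add_mset (n - 1) M, k)
       then of_nat (Suc (count M (n - 1))) * lookup v (add_mset (n - 1) M, k) else 0)" for x
  proof (cases x)
    case (Pair N l)
    show ?thesis
    proof (cases "n - 1 \<in># N")
      case True
      then have "N - {#n - 1#} = M \<longleftrightarrow> N = add_mset (n - 1) M"
        by auto
      then show ?thesis
        by (auto simp: Pair lookup_single when_def)
    next
      case False
      then show ?thesis
        by (auto simp: Pair not_in_iff)
    qed
  qed
  then show ?thesis
    by (simp add: d_h_neg_def lookup_sum in_keys_iff)
qed

lemma d_h_neg_add: "d_h_neg n (u + v) = d_h_neg n u + d_h_neg n v"
  by (rule poly_mapping_eqI) (auto simp: lookup_d_h_neg lookup_add algebra_simps)

lemma d_h_neg_0 [simp]: "d_h_neg n 0 = 0"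
  by (simp add: d_h_neg_def)

lemma d_h_neg_single:
  "d_h_neg n (single (M, k) c) = single (M - {#n - 1#}, k) (of_nat (count M (n - 1)) * c)"
  by (cases "c = 0") (simp_all add: d_h_neg_def)

lemma d_h_neg_mult: "d_h_neg n (u * v) = d_h_neg n u * v + u * d_h_neg n v"
proof (induction u rule: poly_mapping_additive_induct)
  case (single x c)
  obtain M k where x: "x = (M, k)"
    by force
  show ?case
  proof (induction v rule: poly_mapping_additive_induct)
    case (single y d)
    obtain N l where y: "y = (N, l)"
      by force
    \<comment> \<open>If index n - 1 does not occur in M, the two monomials may differ, but their
      coefficient is 0.\<close>
    have 1: "single (M + N - {#n - 1#}, k + l) (of_nat (count M (n - 1)) * (c * d)) =
        single (M - {#n - 1#} + N, k + l) (of_nat (count M (n - 1)) * (c * d))"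
      by (cases "n - 1 \<in># M") (auto simp: not_in_iff)
    have 2: "single (M + N - {#n - 1#}, k + l) (of_nat (count N (n - 1)) * (c * d)) =
        single (M + (N - {#n - 1#}), k + l) (of_nat (count N (n - 1)) * (c * d))"
      by (cases "n - 1 \<in># N") (auto simp: not_in_iff)
    have "d_h_neg n (single x c * single y d) =
        single (M + N - {#n - 1#}, k + l) (of_nat (count M (n - 1)) * (c * d)) +
        single (M + N - {#n - 1#}, k + l) (of_nat (count N (n - 1)) * (c * d))"
      by (simp add: x y mult_single d_h_neg_single distrib_right flip: single_add)
    also have "\<dots> = d_h_neg n (single x c) * single y d + single x c * d_h_neg n (single y d)"
      unfolding 1 2 by (simp add: x y mult_single d_h_neg_single mult.assoc mult.left_commute)
    finally show ?case .
  qed (simp_all add: d_h_neg_add algebra_simps)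
qed (simp_all add: d_h_neg_add algebra_simps)

text \<open>The coefficient of z^n in dG/dh_{-i} = (\<alpha> z^i / i) G.\<close>

lemma d_h_neg_row:
  assumes "i > 0"
  shows "d_h_neg i (fock_embed \<alpha> 0 (row n)) =
    single 0 (of_nat \<alpha> / of_nat i) * fock_embed \<alpha> 0 (row (n - int i))"
proof (rule poly_mapping_eqI)
  fix x :: "nat multiset \<times> int"
  obtain M k where x: "x = (M, k)"
    by force
  have "of_nat i * of_nat (Suc (count M (i - 1))) * zinv (add_mset (i - 1) M) = zinv M"
    using zinv_add_mset[of "i - 1" M] assms by simp
  then have "of_nat i * of_nat (Suc (count M (i - 1))) * of_rat (zinv (add_mset (i - 1) M)) =
      (of_rat (zinv M) :: complex)"
    by (metis of_rat_mult of_rat_of_nat_eq)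
  then have "of_nat (Suc (count M (i - 1))) * of_rat (zinv (add_mset (i - 1) M)) =
      (of_rat (zinv M) :: complex) / of_nat i"
    using assms by (simp add: field_simps)
  then have "of_nat (Suc (count M (i - 1))) *
      (of_nat \<alpha> * of_nat \<alpha> ^ size M * of_rat (zinv (add_mset (i - 1) M))) =
      of_nat \<alpha> * (of_nat \<alpha> ^ size M * of_rat (zinv M)) / (of_nat i :: complex)"
    unfolding mult.left_commute[of "of_nat (Suc (count M (i - 1)))"] by simp
  then show "lookup (d_h_neg i (fock_embed \<alpha> 0 (row n))) x =
      lookup (single 0 (of_nat \<alpha> / of_nat i) * fock_embed \<alpha> 0 (row (n - int i))) x"
    using assms by (auto simp: x lookup_d_h_neg lookup_fock_embed lookup_row simp del: of_nat_Suc)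
qed

definition row_prod :: "nat \<Rightarrow> (nat \<Rightarrow>\<^sub>0 int) \<Rightarrow> nat multiset \<Rightarrow>\<^sub>0 rat" where
  "row_prod r \<beta> = (\<Prod>p<r. row (lookup \<beta> p))"

lemma fock_embed_row_prod:
  "fock_embed \<alpha> k (row_prod r \<beta>) =
     single ({#}, k) 1 * (\<Prod>p<r. fock_embed \<alpha> 0 (row (lookup \<beta> p)))"
proof (induction r)
  case (Suc r)
  have "fock_embed \<alpha> k (row_prod (Suc r) \<beta>) =
      fock_embed \<alpha> k (row_prod r \<beta>) * fock_embed \<alpha> 0 (row (lookup \<beta> r))"
    by (simp add: fock_embed_mult row_prod_def)
  then show ?case
    by (simp add: Suc.IH mult.assoc)
qed (simp add: row_prod_def fock_embed_1)

text \<open>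
  \<open>fock_lift \<alpha> r k\<close> sends the monomial \<open>z\<^sup>\<beta>\<close> to the coefficient of \<open>z\<^sup>\<beta>\<close> in
  \<open>exp (\<Sum>\<^sub>p \<Sum>\<^sub>n \<alpha> h\<^sub>-\<^sub>n z\<^sub>p\<^sup>n / n) e\<^sup>k\<^sup>h\<^sup>/\<^sup>2\<close>, \<open>p < r\<close>. It turns the action of the vertex operators into the
  multiplication of Laurent polynomials.
\<close>

definition fock_lift :: "nat \<Rightarrow> nat \<Rightarrow> int \<Rightarrow> laurent \<Rightarrow> fock" where
  "fock_lift \<alpha> r k = linear_ext (\<lambda>\<beta>. fock_embed \<alpha> k (row_prod r \<beta>))"

lemma fock_lift_add: "fock_lift \<alpha> r k (f + g) = fock_lift \<alpha> r k f + fock_lift \<alpha> r k g"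
  and fock_lift_0 [simp]: "fock_lift \<alpha> r k 0 = 0"
  and fock_lift_sum: "fock_lift \<alpha> r k (\<Sum>i\<in>I. h i) = (\<Sum>i\<in>I. fock_lift \<alpha> r k (h i))"
  and fock_lift_scale: "fock_lift \<alpha> r k (single 0 c * f) = single 0 c * fock_lift \<alpha> r k f"
  and fock_lift_single: "fock_lift \<alpha> r k (single \<beta> c) = single 0 c * fock_embed \<alpha> k (row_prod r \<beta>)"
  by (simp_all add: fock_lift_def linear_ext_add linear_ext_sum linear_ext_scale linear_ext_single)

lemma lookup_fock_lift:
  "lookup (fock_lift \<alpha> r k f) (M, l) =
     (if l = k then of_nat \<alpha> ^ size M *
        (\<Sum>\<beta>\<in>keys f. lookup f \<beta> * of_rat (lookup (row_prod r \<beta>) M)) else 0)"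
  by (simp add: fock_lift_def linear_ext_def lookup_sum lookup_fock_embed sum_distrib_left mult_ac)

text \<open>By the product rule and \<open>d_h_neg_row\<close> the derivation lowers one exponent
  \<beta>_p by i at a time. On monomials z^\<beta> this is multiplication by z_p^(-i):
  \<open>fock_lift\<close> is dual to a generating function, which inverts the variables.\<close>

lemma d_h_neg_fock_lift:
  assumes "i > 0"
  shows "d_h_neg i (fock_lift \<alpha> r k f) =
    fock_lift \<alpha> r k (single 0 (of_nat \<alpha> / of_nat i) * (\<Sum>p<r. zpow p (- int i)) * f)"
proof (induction f rule: poly_mapping_additive_induct)
  case (single \<beta> c)
  let ?g = "\<lambda>p. fock_embed \<alpha> 0 (row (lookup \<beta> p))"
  have e: "d_h_neg i (single ({#}, k) c) = 0" for k c
    by (simp add: d_h_neg_single)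
  have step: "d_h_neg i (?g p) * (\<Prod>q\<in>{..<r} - {p}. ?g q) = single 0 (of_nat \<alpha> / of_nat i) *
      (\<Prod>q<r. fock_embed \<alpha> 0 (row (lookup (single p (- int i) + \<beta>) q)))" if "p < r" for p
  proof -
    have "(\<Prod>q\<in>{..<r} - {p}. fock_embed \<alpha> 0 (row (lookup (single p (- int i) + \<beta>) q))) =
        (\<Prod>q\<in>{..<r} - {p}. ?g q)"
      by (intro prod.cong) (auto simp: lookup_add lookup_single)
    then show ?thesis
      using that assms
      by (simp add: d_h_neg_row prod.remove[of "{..<r}" p] lookup_add mult.assoc)
  qed
  have "d_h_neg i (fock_embed \<alpha> k (row_prod r \<beta>)) =
      single ({#}, k) 1 * (\<Sum>p<r. d_h_neg i (?g p) * (\<Prod>q\<in>{..<r} - {p}. ?g q))"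
    by (simp add: fock_embed_row_prod d_h_neg_mult e derivation_prod[where D = "d_h_neg i", OF d_h_neg_mult])
  also have "\<dots> = (\<Sum>p<r. single 0 (of_nat \<alpha> / of_nat i) *
      fock_embed \<alpha> k (row_prod r (single p (- int i) + \<beta>)))"
    unfolding fock_embed_row_prod sum_distrib_left
    by (intro sum.cong refl) (simp add: step mult.left_commute)
  finally have "d_h_neg i (fock_lift \<alpha> r k (single \<beta> c)) =
      single 0 c * (\<Sum>p<r. single 0 (of_nat \<alpha> / of_nat i) *
        fock_embed \<alpha> k (row_prod r (single p (- int i) + \<beta>)))"
    by (simp add: fock_lift_single d_h_neg_mult e zero_prod_def)
  also have "\<dots> = fock_lift \<alpha> r k (single 0 (of_nat \<alpha> / of_nat i) * (\<Sum>p<r. zpow p (- int i)) * single \<beta> c)"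
    by (simp add: zpow_def sum_distrib_left sum_distrib_right mult_single fock_lift_sum fock_lift_single
        mult.commute[of c] flip: mult.assoc)
  finally show ?case .
qed (simp_all add: fock_lift_add d_h_neg_add algebra_simps)

text \<open>The contraction of a new vertex operator with r earlier ones, prod_p (1 -
  t/z_p)^(2\<alpha>), as a polynomial in t; its coefficient at t^j belongs to the new variable's
  power -j.\<close>

definition annihilation_poly :: "nat \<Rightarrow> nat \<Rightarrow> laurent poly" where
  "annihilation_poly \<alpha> r = (\<Prod>p<r. [:1, - zpow p (-1):] ^ (2 * \<alpha>))"

text \<open>The logarithmic derivative of (1 - t/z_p)^(2\<alpha>) is -2\<alpha> times the geometric
  series with coefficients z_p^(-n-1); a product of such factors adds them.\<close>

lemma fps_deriv_annihilation_poly: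
  assumes "\<alpha> > 0"
  shows "fps_deriv (fps_of_poly (annihilation_poly \<alpha> r)) =
    Abs_fps (\<lambda>n. - of_nat (2 * \<alpha>) * (\<Sum>p<r. zpow p (- int (Suc n)))) *
    fps_of_poly (annihilation_poly \<alpha> r)"
proof (induction r)
  case (Suc r)
  define u where "u = fps_of_poly [:1, - zpow r (-1):]"
  define l where "l = Abs_fps (\<lambda>n. - of_nat (2 * \<alpha>) * zpow r (- int (Suc n)))"
  define w where "w = fps_const (- zpow r (-1))"
  have u: "u = 1 + w * fps_X"
    by (simp add: u_def w_def fps_of_poly_pCons)
  have "l * u = of_nat (2 * \<alpha>) * w"
  proof (rule fps_ext)
    fix n
    have "fps_nth (l * u) n = fps_nth l n + - zpow r (-1) * (if n = 0 then 0 else fps_nth l (n - 1))"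
      by (simp add: u w_def algebra_simps flip: mult.assoc)
    also have "\<dots> = fps_nth (of_nat (2 * \<alpha>) * w) n"
    proof (cases n)
      case (Suc m)
      have "zpow r (- int (Suc (Suc m))) = zpow r (-1) * zpow r (- int (Suc m))"
        by (simp flip: zpow_add)
      then show ?thesis
        by (simp add: Suc l_def w_def fps_of_nat[symmetric] del: of_nat_Suc)
    qed (simp add: l_def w_def fps_of_nat[symmetric])
    finally show "fps_nth (l * u) n = fps_nth (of_nat (2 * \<alpha>) * w) n" .
  qed
  moreover have "fps_deriv u = w"
    by (simp add: u w_def)
  ultimately have "fps_deriv (u ^ (2 * \<alpha>)) = l * u * u ^ (2 * \<alpha> - 1)"
    unfolding fps_deriv_power fps_of_nat by (simp only:)
  also have "\<dots> = l * u ^ (2 * \<alpha>)"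
    using assms by (cases "2 * \<alpha>") (simp_all add: mult.assoc)
  finally have du: "fps_deriv (u ^ (2 * \<alpha>)) = l * u ^ (2 * \<alpha>)" .
  have split: "fps_of_poly (annihilation_poly \<alpha> (Suc r)) = fps_of_poly (annihilation_poly \<alpha> r) * u ^ (2 * \<alpha>)"
    by (simp add: annihilation_poly_def fps_of_poly_mult fps_of_poly_power u_def)
  have l: "Abs_fps (\<lambda>n. - of_nat (2 * \<alpha>) * (\<Sum>p<Suc r. zpow p (- int (Suc n)))) =
      Abs_fps (\<lambda>n. - of_nat (2 * \<alpha>) * (\<Sum>p<r. zpow p (- int (Suc n)))) + l"
    by (rule fps_ext) (simp add: l_def algebra_simps)
  show ?case
    unfolding split l fps_deriv_mult Suc.IH du by (simp only: algebra_simps)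
qed (simp add: annihilation_poly_def fps_eq_iff)

text \<open>Through \<open>fock_lift\<close> the exponent of \<open>E_minus\<close> becomes
  multiplication by the sum of - (2\<alpha>/n) z_p^(-n) t^n, the logarithm of
  \<open>annihilation_poly\<close>.\<close>

lemma E_minus_fock_lift:
  assumes "\<alpha> > 0"
  shows "E_minus \<alpha> j (fock_lift \<alpha> r k f) =
    fock_lift \<alpha> r k (coeff (annihilation_poly \<alpha> r) j * f)"
proof -
  define b where
    "b = Abs_fps (\<lambda>n. if n = 0 then 0 else single 0 (- (2 * of_nat \<alpha> / of_nat n)) * (\<Sum>p<r. zpow p (- int n)))"
  define x where "x = fps_of_poly (annihilation_poly \<alpha> r)"
  have "E_minus \<alpha> j (fock_lift \<alpha> r k f) = fock_lift \<alpha> r k (exp_coeff b j * f)"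
    unfolding E_minus_def
  proof (rule op_exp_intertwine)
    fix n f
    show "(if n = 0 then 0 else vscale (- (2 * of_nat \<alpha> / of_nat n)) (h_pos \<alpha> n (fock_lift \<alpha> r k f))) =
        fock_lift \<alpha> r k (fps_nth b n * f)"
    proof (cases "n = 0")
      case False
      \<comment> \<open>The factor n/\<alpha> in \<open>h_pos\<close> cancels the \<alpha>/n of
        \<open>d_h_neg_fock_lift\<close>.\<close>
      have "- (2 * of_nat \<alpha> / of_nat n) * (of_nat n / of_nat \<alpha>) * (of_nat \<alpha> / of_nat n) =
          (- (2 * of_nat \<alpha> / of_nat n) :: complex)"
        using assms False by simp
      then show ?thesis
        using False
        by (simp add: h_pos_def vscale_eq_mult d_h_neg_fock_lift b_def mult.assoc fock_lift_scale)
          (simp add: mult_single flip: mult.assoc)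
    qed (simp add: b_def)
  qed (simp_all add: fock_lift_add fock_lift_scale vscale_eq_mult)
  moreover have "exp_coeff b j = fps_nth x j"
  proof (rule exp_coeff_unique)
    have "fps_deriv b = Abs_fps (\<lambda>n. - of_nat (2 * \<alpha>) * (\<Sum>p<r. zpow p (- int (Suc n))))"
    proof (rule fps_ext)
      fix n
      have "of_nat (Suc n) * single 0 (- (2 * of_nat \<alpha> / of_nat (Suc n))) = (- of_nat (2 * \<alpha>) :: laurent)"
        by (simp add: mult_single flip: single_of_nat single_uminus del: of_nat_Suc)
      then show "fps_nth (fps_deriv b) n =
          fps_nth (Abs_fps (\<lambda>n. - of_nat (2 * \<alpha>) * (\<Sum>p<r. zpow p (- int (Suc n))))) n"
        by (simp add: b_def flip: mult.assoc del: of_nat_Suc)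
    qed
    then show "fps_deriv x = fps_deriv b * x"
      using fps_deriv_annihilation_poly[OF assms] by (simp add: x_def)
  next
    show "fps_nth x 0 = 1"
      by (simp add: x_def annihilation_poly_def coeff_0_prod_list poly_0_coeff_0[symmetric] poly_prod)
  qed (simp add: b_def)
  ultimately show ?thesis
    by (simp add: x_def)
qed

section \<open>The modes of the vertex operator\<close>

text \<open>\<open>theta r f = 0\<close> says that f is free of z_r. Then \<open>row n\<close> can
  take the vacant place r in each \<open>row_prod\<close>.\<close>

lemma row_mult_fock_lift:
  assumes "theta r f = 0"
  shows "fock_embed \<alpha> 0 (row n) * fock_lift \<alpha> r k f = fock_lift \<alpha> (Suc r) k (zpow r n * f)"
proof -
  have "fock_embed \<alpha> 0 (row n) * fock_lift \<alpha> r k (single \<beta> (lookup f \<beta>)) =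
      fock_lift \<alpha> (Suc r) k (zpow r n * single \<beta> (lookup f \<beta>))" if "\<beta> \<in> keys f" for \<beta>
  proof -
    have "lookup (theta r f) \<beta> = 0"
      using assms by simp
    then have "lookup \<beta> r = 0"
      using that by (simp add: in_keys_iff)
    then have "row_prod (Suc r) (single r n + \<beta>) = row n * row_prod r \<beta>"
      by (simp add: row_prod_def lookup_add lookup_single mult.commute)
    then have "fock_embed \<alpha> k (row_prod (Suc r) (single r n + \<beta>)) =
        fock_embed \<alpha> 0 (row n) * fock_embed \<alpha> k (row_prod r \<beta>)"
      by (simp add: fock_embed_mult)
    then show ?thesis
      by (simp add: zpow_def mult_single fock_lift_single mult.left_commute)
  qed
  then have "fock_embed \<alpha> 0 (row n) * fock_lift \<alpha> r k (\<Sum>\<beta>\<in>keys f. single \<beta> (lookup f \<beta>)) =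
      fock_lift \<alpha> (Suc r) k (zpow r n * (\<Sum>\<beta>\<in>keys f. single \<beta> (lookup f \<beta>)))"
    by (simp add: fock_lift_sum sum_distrib_left)
  then show ?thesis
    by (simp flip: poly_mapping_sum_single)
qed

lemma lookup_A_coeff:
  "lookup (A_coeff \<alpha> d v) (M, l) = (if (l - 1) * int \<alpha> = d then lookup v (M, l - 2) else 0)"
proof -
  have fin: "finite {(M, k) \<in> keys v. (k + 1) * int \<alpha> = d}"
    by (rule finite_subset[OF _ finite_keys[of v]]) auto
  have "lookup (A_coeff \<alpha> d v) (M, l) = (\<Sum>x\<in>{(M, k) \<in> keys v. (k + 1) * int \<alpha> = d}.
      if x = (M, l - 2) then lookup v (M, l - 2) else 0)"
    unfolding A_coeff_def lookup_sum
    by (intro sum.cong) (auto simp: lookup_single when_def split: if_splits)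
  also have "\<dots> = (if (l - 1) * int \<alpha> = d then lookup v (M, l - 2) else 0)"
    using fin by (auto simp: in_keys_iff algebra_simps)
  finally show ?thesis .
qed

lemma A_coeff_fock_lift:
  "A_coeff \<alpha> d (fock_lift \<alpha> r k f) =
     (if (k + 1) * int \<alpha> = d then fock_lift \<alpha> r (k + 2) f else 0)"
proof (rule poly_mapping_eqI)
  fix x :: "nat multiset \<times> int"
  obtain M l where x: "x = (M, l)"
    by force
  show "lookup (A_coeff \<alpha> d (fock_lift \<alpha> r k f)) x =
      lookup (if (k + 1) * int \<alpha> = d then fock_lift \<alpha> r (k + 2) f else 0) x"
    by (auto simp: x lookup_A_coeff lookup_fock_lift)
qed

lemma theta_sum: "theta i (\<Sum>x\<in>I. f x) = (\<Sum>x\<in>I. theta i (f x))"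
  by (induction I rule: infinite_finite_induct) (simp_all add: theta_add)

lemma theta_zpow: "p \<noteq> i \<Longrightarrow> theta i (zpow p n) = 0"
  by (simp add: zpow_def theta_single lookup_single)

lemma theta_coeff_annihilation_poly: "r \<le> i \<Longrightarrow> theta i (coeff (annihilation_poly \<alpha> r) j) = 0"
proof (induction r arbitrary: j)
  case 0
  then show ?case
    by (simp add: annihilation_poly_def coeff_pCons split: nat.split)
next
  case (Suc r)
  have mult: "theta i (coeff (f * g) j) = 0"
    if "\<And>j. theta i (coeff f j) = 0" "\<And>j. theta i (coeff g j) = 0" for f g j
    using that by (simp add: coeff_mult theta_sum theta_mult)
  have lin: "theta i (coeff [:1, - zpow r (-1):] j) = 0" for j
    using Suc.prems theta_diff[of i 0 "zpow r (-1)"]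
    by (auto simp: coeff_pCons theta_zpow split: nat.split)
  have "theta i (coeff ([:1, - zpow r (-1):] ^ m) j) = 0" for m j
  proof (induction m arbitrary: j)
    case (Suc m)
    show ?case
      unfolding power_Suc by (intro mult lin Suc.IH)
  qed simp
  then show ?case
    using Suc by (simp add: annihilation_poly_def mult)
qed

text \<open>The charge k fixes d, and j then fixes i, so the triple sum is a sum over j. The new
  variable z_r has exponent n - d + j there, and the sum over j evaluates
  \<open>annihilation_poly\<close> at t = z_r.\<close>

lemma X_mode_fock_lift:
  assumes "\<alpha> > 0" "theta r f = 0"
  shows "X_mode \<alpha> (- n) (fock_lift \<alpha> r k f) = fock_lift \<alpha> (Suc r) (k + 2)
    (zpow r (n - (k + 1) * int \<alpha>) * (\<Prod>p<r. (1 - zpow r 1 * zpow p (-1)) ^ (2 * \<alpha>)) * f)"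
proof -
  define P where "P = annihilation_poly \<alpha> r"
  define d0 where "d0 = (k + 1) * int \<alpha>"
  define e where "e j = n - d0 + int j" for j
  define v where "v j = fock_lift \<alpha> r (k + 2) (coeff P j * f)" for j
  define g where "g = (\<lambda>(i, d, j).
      E_plus \<alpha> i (A_coeff \<alpha> d (E_minus \<alpha> j (fock_lift \<alpha> r k f))) when int i + d - int j = n)"
  have g: "g (i, d, j) = (fock_embed \<alpha> 0 (row (int i)) * v j when d = d0 \<and> int i = e j)" for i d j
    using assms(1)
    by (auto simp: g_def E_plus_eq E_minus_fock_lift A_coeff_fock_lift P_def v_def d0_def e_def when_def)
  define A where "A = (\<lambda>j. (nat (e j), d0, j)) ` {..degree P}"
  have "{x. g x \<noteq> 0} \<subseteq> A"
  proof
    fix x assume "x \<in> {x. g x \<noteq> 0}"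
    then obtain i d j where x: "x = (i, d, j)" "g (i, d, j) \<noteq> 0"
      by (cases x) auto
    then have "d = d0" "int i = e j" "v j \<noteq> 0"
      by (auto simp: g when_def split: if_splits)
    moreover have "j \<le> degree P"
      using \<open>v j \<noteq> 0\<close> le_degree[of P j] by (cases "coeff P j = 0") (auto simp: v_def)
    ultimately show "x \<in> A"
      by (auto simp: A_def x intro!: image_eqI[of _ _ j])
  qed
  then have "X_mode \<alpha> (- n) (fock_lift \<alpha> r k f) = sum g A"
    by (simp add: X_mode_def g_def A_def Sum_any.expand_superset)
  also have "\<dots> = (\<Sum>j\<le>degree P. g (nat (e j), d0, j))"
    unfolding A_def by (subst sum.reindex) (auto simp: inj_on_def)
  also have "\<dots> = (\<Sum>j\<le>degree P. fock_lift \<alpha> (Suc r) (k + 2) (zpow r (e j) * (coeff P j * f)))"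
  proof (intro sum.cong refl)
    fix j
    have "theta r (coeff P j * f) = 0"
      using assms(2) by (simp add: theta_mult P_def theta_coeff_annihilation_poly)
    then have "fock_embed \<alpha> 0 (row (e j)) * v j =
        fock_lift \<alpha> (Suc r) (k + 2) (zpow r (e j) * (coeff P j * f))"
      unfolding v_def by (rule row_mult_fock_lift)
    \<comment> \<open>For negative \<open>e j\<close> the truncation by \<open>nat\<close> is
      harmless: the condition in \<open>g\<close> fails, and \<open>row (e j)\<close> is 0 as
      well.\<close>
    then show "g (nat (e j), d0, j) = fock_lift \<alpha> (Suc r) (k + 2) (zpow r (e j) * (coeff P j * f))"
      by (cases "e j \<ge> 0") (auto simp: g when_def row_neg)
  qed
  also have "\<dots> = fock_lift \<alpha> (Suc r) (k + 2) (zpow r (n - d0) * poly P (zpow r 1) * f)"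
    by (simp add: fock_lift_sum[symmetric] poly_altdef sum_distrib_left sum_distrib_right e_def
        zpow_add zpow_power mult_ac)
  also have "poly P (zpow r 1) = (\<Prod>p<r. (1 - zpow r 1 * zpow p (-1)) ^ (2 * \<alpha>))"
    by (simp add: P_def annihilation_poly_def poly_prod)
  finally show ?thesis
    by (simp add: d0_def)
qed

definition zmono :: "nat \<Rightarrow> (nat \<Rightarrow> int) \<Rightarrow> laurent" where
  "zmono r e = (\<Prod>p<r. zpow p (e p))"

lemma zmono_mult: "zmono r e * zmono r e' = zmono r (\<lambda>p. e p + e' p)"
  by (simp add: zmono_def zpow_add prod.distrib)

lemma theta_prod_eq_0:
  assumes "\<And>x. x \<in> I \<Longrightarrow> theta i (f x) = 0"
  shows "theta i (\<Prod>x\<in>I. f x) = 0"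
  using assms by (induction I rule: infinite_finite_induct) (simp_all add: theta_mult)

text \<open>
  Here \<open>(1 - z\<^sub>r/z\<^sub>p)\<^sup>2 = - (1 - z\<^sub>r/z\<^sub>p) (1 - z\<^sub>p/z\<^sub>r) z\<^sub>r/z\<^sub>p\<close> symmetrises the factors produced by the
  contractions.
\<close>

lemma contraction_factor:
  "(\<Prod>p<r. (1 - zpow r 1 * zpow p (-1)) ^ (2 * n)) =
    (-1) ^ (r * n) * zpow r (int (r * n)) * zmono r (\<lambda>_. - int n) * (\<Prod>p<r. dyson_pair r p ^ n)"
proof -
  have sq: "(1 - zpow r 1 * zpow p (-1)) ^ 2 = - zpow r 1 * zpow p (-1) * dyson_pair r p" for p
    using zpow_inverse(1)[of r] zpow_inverse(1)[of p]
    unfolding dyson_pair_def power2_eq_square by algebra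
  have "(1 - zpow r 1 * zpow p (-1)) ^ (2 * n) =
      (-1) ^ n * zpow r (int n) * zpow p (- int n) * dyson_pair r p ^ n" for p
    unfolding power_mult sq power_mult_distrib power_minus[of "zpow r 1"]
    by (simp add: zpow_power)
  then show ?thesis
    by (simp add: prod.distrib zmono_def zpow_power mult_ac flip: power_mult)
qed

text \<open>The head of the list acts last and receives the variable of highest index, so the
  exponents follow \<open>rev lam\<close>. The shift (k + r) \<alpha> disappears exactly for the
  vacuum with k = - r.\<close>

lemma X_minus_vac:
  fixes lam :: "nat list"
  assumes "\<alpha> > 0"
  defines "r \<equiv> length lam"
  shows "X_minus \<alpha> lam (vac k) = fock_lift \<alpha> r (k + 2 * int r)
    ((-1) ^ (r * (r - 1) * \<alpha> div 2) *
      (zmono r (\<lambda>p. int (rev lam ! p) - (k + int r) * int \<alpha>) * dyson {..<r} (\<lambda>_. \<alpha>)))"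
  unfolding r_def
proof (induction lam)
  case Nil
  have "fock_lift \<alpha> 0 k 1 = vac k"
    using fock_lift_single[of \<alpha> 0 k 0 1] by (simp add: vac_def row_prod_def fock_embed_1)
  then show ?case
    by (simp add: X_minus_def zmono_def dyson_def)
next
  case (Cons x lam)
  define r where "r = length lam"
  define e where "e = (\<lambda>p. int (rev lam ! p) - (k + int r) * int \<alpha>)"
  define e' where "e' = (\<lambda>p. int (rev (x # lam) ! p) - (k + int (Suc r)) * int \<alpha>)"
  define F where "F = (-1) ^ (r * (r - 1) * \<alpha> div 2) * (zmono r e * dyson {..<r} (\<lambda>_. \<alpha>))"
  have "theta r (zmono r e) = 0"
    unfolding zmono_def by (intro theta_prod_eq_0 theta_zpow) auto
  moreover have "theta r (dyson {..<r} (\<lambda>_. \<alpha>)) = 0"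
  proof -
    have "keys (dyson {..<r} (\<lambda>_. \<alpha>)) \<subseteq> {\<beta>. lookup \<beta> r = 0}"
      by (rule keys_dyson_subset) (auto simp: lookup_add lookup_single)
    then show ?thesis
      by (intro poly_mapping_eqI) (auto simp: in_keys_iff)
  qed
  moreover have "theta r ((-1) ^ m) = 0" for m
    using theta_prod_eq_0[of "{..<m}" r "\<lambda>_. -1"] theta_diff[of r 0 1] by simp
  ultimately have F0: "theta r F = 0"
    by (simp add: F_def theta_mult)
  \<comment> \<open>The sign exponent grows by the r \<alpha> that comes from
    \<open>contraction_factor\<close>.\<close>
  have "Suc r * (Suc r - 1) * \<alpha> = r * (r - 1) * \<alpha> + 2 * (r * \<alpha>)"
    by (cases r) (simp_all add: algebra_simps)
  then have sign: "Suc r * (Suc r - 1) * \<alpha> div 2 = r * (r - 1) * \<alpha> div 2 + r * \<alpha>"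
    by simp
  have "zmono (Suc r) e' = zmono r e' * zpow r (int x - (k + int (Suc r)) * int \<alpha>)"
    by (simp add: zmono_def e'_def r_def nth_append)
  also have "zmono r e' = zmono r e * zmono r (\<lambda>_. - int \<alpha>)"
    unfolding zmono_mult unfolding zmono_def
    by (intro prod.cong) (auto simp: e_def e'_def r_def nth_append algebra_simps)
  \<comment> \<open>The last operator meets the charge k + 2r left by r earlier ones; symmetrising
    the contractions returns r \<alpha>.\<close>
  also have "zpow r (int x - (k + int (Suc r)) * int \<alpha>) =
      zpow r (int x - (k + 2 * int r + 1) * int \<alpha>) * zpow r (int (r * \<alpha>))"
    by (simp add: algebra_simps flip: zpow_add)
  finally have zm: "zmono (Suc r) e' = zmono r e * zmono r (\<lambda>_. - int \<alpha>) *
      (zpow r (int x - (k + 2 * int r + 1) * int \<alpha>) * zpow r (int (r * \<alpha>)))" .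
  have dy: "dyson {..<Suc r} (\<lambda>_. \<alpha>) = dyson {..<r} (\<lambda>_. \<alpha>) * (\<Prod>p<r. dyson_pair r p ^ \<alpha>)"
    using dyson_insert[of "{..<r}" r \<alpha>] by (simp add: lessThan_Suc)
  have "X_minus \<alpha> (x # lam) (vac k) = X_mode \<alpha> (- int x) (fock_lift \<alpha> r (k + 2 * int r) F)"
    using Cons.IH by (simp add: X_minus_def r_def F_def e_def)
  also have "\<dots> = fock_lift \<alpha> (Suc r) (k + 2 * int r + 2)
      (zpow r (int x - (k + 2 * int r + 1) * int \<alpha>) *
        (\<Prod>p<r. (1 - zpow r 1 * zpow p (-1)) ^ (2 * \<alpha>)) * F)"
    by (rule X_mode_fock_lift[OF assms(1) F0])
  also have "zpow r (int x - (k + 2 * int r + 1) * int \<alpha>) *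
        (\<Prod>p<r. (1 - zpow r 1 * zpow p (-1)) ^ (2 * \<alpha>)) * F =
      (-1) ^ (Suc r * (Suc r - 1) * \<alpha> div 2) * (zmono (Suc r) e' * dyson {..<Suc r} (\<lambda>_. \<alpha>))"
    unfolding contraction_factor F_def sign zm dy power_add by (simp only: mult_ac)
  finally show ?case
    by (simp add: e'_def r_def algebra_simps)
qed

section \<open>Power sums\<close>

lemma sum_series_apply: "(\<Sum>i\<in>I. f i) m = (\<Sum>i\<in>I. f i m)"
  for f :: "'i \<Rightarrow> 'b \<Rightarrow> 'c::comm_monoid_add"
  by (induction I rule: infinite_finite_induct) simp_all

lemma finite_submultisets: "finite {a. a \<subseteq># m}"
proof (rule finite_subset)
  show "{a. a \<subseteq># m} \<subseteq> (\<Union>k\<le>size m. multisets_of_size (set_mset m) k)"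
    by (auto simp: multisets_of_size_def size_mset_mono dest: mset_subset_eqD)
qed auto

lemma replicate_mset_subseteq_iff: "replicate_mset n i \<subseteq># m \<longleftrightarrow> n \<le> count m i"
  by (auto simp: subseteq_mset_def)

lemma finite_count_ge: "n > 0 \<Longrightarrow> finite {i. n \<le> count m i}"
  by (rule finite_subset[OF _ finite_set_mset[of m]]) (auto intro: ccontr simp: not_in_iff)

lemma psum_Nil: "psum [] m = (if m = {#} then 1 else 0)"
  by (simp add: psum_def fone_def)

text \<open>For n > 0 the monomials x_i^n are distinct, so the convolution becomes a sum over the i
  for which x_i^n divides m.\<close>

lemma psum_Cons:
  assumes "n > 0"
  shows "(psum (n # mu) m :: 'a::comm_ring_1) = (\<Sum>i | n \<le> count m i. psum mu (m - replicate_mset n i))"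
proof -
  define R where "R = (\<lambda>i. (replicate_mset n i, m - replicate_mset n i)) ` {i. n \<le> count m i}"
  have inj: "inj_on (\<lambda>i. (replicate_mset n i, m - replicate_mset n i)) {i. n \<le> count m i}"
  proof (rule inj_onI)
    fix i j
    assume "(replicate_mset n i, m - replicate_mset n i) = (replicate_mset n j, m - replicate_mset n j)"
    then have "set_mset (replicate_mset n i) = set_mset (replicate_mset n j)"
      by simp
    then show "i = j"
      using assms by (simp split: if_splits)
  qed
  have fin: "finite {(a, b). a + b = m}"
    by (rule finite_subset[of _ "(\<lambda>a. (a, m - a)) ` {a. a \<subseteq># m}"]) (auto simp: finite_submultisets)
  have eq: "(psum (n # mu) m :: 'a) = (\<Sum>(a, b)\<in>{(a, b). a + b = m}. power_sum n a * psum mu b)"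
    by (simp add: psum_def fmul_def)
  have zero: "power_sum n a = (0 :: 'a)" if "a + b = m" "(a, b) \<notin> R" for a b
  proof -
    have False if a: "a = replicate_mset n i" for i
    proof -
      have "(a, b) = (replicate_mset n i, m - replicate_mset n i)" "n \<le> count m i"
        using a \<open>a + b = m\<close> by auto
      then show False
        using \<open>(a, b) \<notin> R\<close> by (auto simp: R_def)
    qed
    then show ?thesis
      by (auto simp: power_sum_def)
  qed
  have "R \<subseteq> {(a, b). a + b = m}"
    by (auto simp: R_def replicate_mset_subseteq_iff)
  then have "(\<Sum>(a, b)\<in>{(a, b). a + b = m}. power_sum n a * psum mu b :: 'a) =
      (\<Sum>(a, b)\<in>R. power_sum n a * psum mu b)"
    using zero by (intro sum.mono_neutral_right fin) auto
  then have "(psum (n # mu) m :: 'a) = (\<Sum>(a, b)\<in>R. power_sum n a * psum mu b)"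
    by (simp only: eq)
  also have "\<dots> = (\<Sum>i | n \<le> count m i. psum mu (m - replicate_mset n i))"
  proof -
    have "power_sum n (replicate_mset n i) = (1 :: 'a)" for i
      by (auto simp: power_sum_def)
    then show ?thesis
      unfolding R_def by (subst sum.reindex[OF inj]) simp
  qed
  finally show ?thesis .
qed

text \<open>Positivity is argued over the integers; this carries nonvanishing to rings of
  characteristic 0.\<close>

lemma psum_of_int:
  assumes "\<forall>n\<in>set mu. n > 0"
  shows "(psum mu m :: 'a::comm_ring_1) = of_int (psum mu m)"
  using assms by (induction mu arbitrary: m) (simp_all add: psum_Nil psum_Cons)

lemma psum_int_nonneg:
  assumes "\<forall>n\<in>set mu. n > 0"
  shows "(psum mu m :: int) \<ge> 0"
  using assms by (induction mu arbitrary: m) (simp_all add: psum_Nil psum_Cons sum_nonneg)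

text \<open>The type of a monomial: symmetric functions depend on m only through it.\<close>

definition exponents :: "nat multiset \<Rightarrow> nat multiset" where
  "exponents m = image_mset (count m) (mset_set (set_mset m))"

lemma size_exponents [simp]: "size (exponents m) = card (set_mset m)"
  by (simp add: exponents_def)

lemma exponents_add_replicate:
  assumes "i \<notin># m" "n > 0"
  shows "exponents (m + replicate_mset n i) = add_mset n (exponents m)"
proof -
  have "set_mset (m + replicate_mset n i) = insert i (set_mset m)"
    using assms by auto
  moreover have "image_mset (count (m + replicate_mset n i)) (mset_set (set_mset m)) = exponents m"
    unfolding exponents_def using assms by (intro image_mset_cong) auto
  ultimately show ?thesis
    using assms by (simp add: exponents_def not_in_iff)
qed

text \<open>A monomial of p_\<mu> arises by assigning a variable to each part of \<mu>. As many
  variables as parts means that no two parts share a variable.\<close>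

lemma psum_nonzeroD:
  fixes mu :: "nat list"
  assumes "\<forall>n\<in>set mu. n > 0" "(psum mu m :: 'a::comm_ring_1) \<noteq> 0"
  shows "size m = sum_list mu \<and> card (set_mset m) \<le> length mu \<and>
    (card (set_mset m) = length mu \<longrightarrow> exponents m = mset mu)"
  using assms
proof (induction mu arbitrary: m)
  case Nil
  then show ?case
    by (auto simp: psum_Nil exponents_def split: if_splits)
next
  case (Cons n mu)
  then obtain i where i: "n \<le> count m i" "(psum mu (m - replicate_mset n i) :: 'a) \<noteq> 0"
    by (force simp: psum_Cons elim: sum.not_neutral_contains_not_neutral)
  define m' where "m' = m - replicate_mset n i"
  have m: "m = m' + replicate_mset n i"
    using i(1) by (simp add: m'_def replicate_mset_subseteq_iff)
  have IH: "size m' = sum_list mu" "card (set_mset m') \<le> length mu"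
    "card (set_mset m') = length mu \<Longrightarrow> exponents m' = mset mu"
    using Cons.IH[of m'] Cons.prems(1) i(2) by (auto simp: m'_def)
  have set: "set_mset m = insert i (set_mset m')"
    using Cons.prems(1) by (auto simp: m)
  have "exponents m = mset (n # mu)" if "card (set_mset m) = length (n # mu)"
  proof -
    have "i \<notin># m'" "card (set_mset m') = length mu"
      using that IH(2) by (auto simp: set card_insert_if split: if_splits)
    then show ?thesis
      using IH(3) Cons.prems(1) by (simp add: m exponents_add_replicate)
  qed
  moreover have "card (set_mset m) \<le> length (n # mu)"
    using IH(2) by (simp add: set card_insert_if)
  moreover have "size m = sum_list (n # mu)"
    using IH(1) by (simp add: m)
  ultimately show ?case
    by blast
qed

lemma psum_exponents_pos:
  assumes "\<forall>n\<in>set mu. n > 0" "exponents m = mset mu"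
  shows "(psum mu m :: int) > 0"
  using assms
proof (induction mu arbitrary: m)
  case Nil
  then have "m = {#}"
    by (auto simp: exponents_def mset_set_empty_iff)
  then show ?case
    by (simp add: psum_Nil)
next
  case (Cons n mu)
  have n: "n > 0"
    using Cons.prems(1) by simp
  have "n \<in># exponents m"
    using Cons.prems(2) by simp
  then obtain i where i: "i \<in># m" "count m i = n"
    by (auto simp: exponents_def)
  define m' where "m' = m - replicate_mset n i"
  have m: "m = m' + replicate_mset n i"
    using i(2) by (simp add: m'_def replicate_mset_subseteq_iff)
  have "i \<notin># m'"
    using i(2) by (simp add: m'_def not_in_iff)
  then have "exponents m' = mset mu"
    using Cons.prems(2) n by (simp add: m exponents_add_replicate)
  then have "psum mu m' > (0::int)"
    using Cons by auto
  also have "psum mu m' \<le> (\<Sum>i | n \<le> count m i. psum mu (m - replicate_mset n i) :: int)"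
    unfolding m'_def using i(2) finite_count_ge[OF n] Cons.prems(1)
    by (intro member_le_sum[of i]) (auto intro: psum_int_nonneg)
  finally show ?case
    using n by (simp add: psum_Cons)
qed

lemma exponents_exist:
  assumes "\<forall>n\<in>set mu. n > 0"
  shows "\<exists>m. exponents m = mset mu"
  using assms
proof (induction mu)
  case Nil
  then show ?case
    by (intro exI[of _ "{#}"]) (simp add: exponents_def)
next
  case (Cons n mu)
  then obtain m where m: "exponents m = mset mu"
    by auto
  obtain i where "i \<notin># m"
    using ex_new_if_finite[of "set_mset m"] infinite_UNIV_nat by blast
  then show ?case
    using Cons.prems m by (intro exI[of _ "m + replicate_mset n i"]) (simp add: exponents_add_replicate)
qed

lemma partition_mset_inj:
  assumes "is_partition lam" "is_partition mu" "mset lam = mset mu"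
  shows "lam = mu"
proof -
  have "sorted (rev lam)" "sorted (rev mu)"
    using assms by (simp_all add: is_partition_def sorted_wrt_rev)
  moreover have "mset (rev lam) = mset (rev mu)"
    using assms by simp
  ultimately have "rev lam = rev mu"
    by (metis properties_for_sort sorted_sort_id)
  then show ?thesis
    by simp
qed

text \<open>Take the longest \<lambda> with nonzero coefficient and a monomial of type \<lambda>. By
  \<open>psum_nonzeroD\<close> no other p_\<mu> with l(\<mu>) <= l(\<lambda>) contains it, while its
  coefficient in p_\<lambda> is positive.\<close>

theorem psum_independent:
  fixes c :: "nat list \<Rightarrow> 'a::{idom, ring_char_0}"
  assumes "finite S" "\<And>mu. mu \<in> S \<Longrightarrow> is_partition mu" "(\<Sum>mu\<in>S. smul (c mu) (psum mu)) = 0"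
  shows "\<forall>mu\<in>S. c mu = 0"
proof (rule ccontr)
  assume "\<not> (\<forall>mu\<in>S. c mu = 0)"
  then have ne: "{mu \<in> S. c mu \<noteq> 0} \<noteq> {}" and fin: "finite {mu \<in> S. c mu \<noteq> 0}"
    using assms(1) by auto
  obtain lam where lam: "lam \<in> S" "c lam \<noteq> 0"
    "\<And>mu. mu \<in> S \<Longrightarrow> c mu \<noteq> 0 \<Longrightarrow> length mu \<le> length lam"
    using Max_in[of "length ` {mu \<in> S. c mu \<noteq> 0}"] Max_ge[of "length ` {mu \<in> S. c mu \<noteq> 0}"] ne fin
    by (smt (verit) finite_imageI image_iff image_is_empty mem_Collect_eq)
  have pos: "\<forall>n\<in>set mu. n > 0" if "mu \<in> S" for mu
    using assms(2)[OF that] by (simp add: is_partition_def)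
  obtain m where m: "exponents m = mset lam"
    using exponents_exist pos[OF lam(1)] by blast
  then have card: "card (set_mset m) = length lam"
    by (metis size_exponents size_mset)
  have zero: "c mu * psum mu m = 0" if mu: "mu \<in> S - {lam}" for mu
  proof (rule ccontr)
    assume "c mu * psum mu m \<noteq> 0"
    then have nz: "c mu \<noteq> 0" "psum mu m \<noteq> (0::'a)"
      by auto
    then have "length lam \<le> length mu" "length mu \<le> length lam"
      using psum_nonzeroD[OF pos nz(2)] lam(3) mu card by auto
    then have "mset mu = mset lam"
      using psum_nonzeroD[OF pos nz(2)] mu card m by auto
    then show False
      using partition_mset_inj assms(2) mu lam(1) by blast
  qed
  have "0 = (\<Sum>mu\<in>S. smul (c mu) (psum mu)) m"
    using assms(3) by simp
  also have "\<dots> = (\<Sum>mu\<in>S. c mu * psum mu m)"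
    by (simp add: sum_series_apply smul_def)
  also have "\<dots> = c lam * psum lam m"
  proof -
    have "(\<Sum>mu\<in>S - {lam}. c mu * psum mu m) = 0"
      using zero by (intro sum.neutral) blast
    then show ?thesis
      using lam(1) assms(1) by (simp add: sum.remove[of S lam])
  qed
  finally have "psum lam m = (0::'a)"
    using lam(2) by simp
  then have "psum lam m = (0::int)"
    using psum_of_int[OF pos[OF lam(1)], of m, where 'a = 'a] by simp
  then show False
    using psum_exponents_pos[OF pos[OF lam(1)] m] by simp
qed

section \<open>Symmetric functions of bounded degree\<close>

definition sym_upto :: "nat \<Rightarrow> 'a::comm_ring_1 series set" where
  "sym_upto d = {f. (\<forall>m. f m \<noteq> 0 \<longrightarrow> size m \<le> d) \<and>
     (\<forall>\<pi> m. bij \<pi> \<longrightarrow> f (image_mset \<pi> m) = f m)}"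

lemma symmetric_functions_eq_Union: "symmetric_functions = (\<Union>d. sym_upto d)"
  unfolding symmetric_functions_def sym_upto_def by blast

lemma count_image_mset_bij:
  assumes "bij \<pi>"
  shows "count (image_mset \<pi> m) (\<pi> i) = count m i"
  using assms by (induction m) (auto dest: bij_is_inj injD)

lemma psum_image_mset:
  assumes "bij \<pi>" "\<forall>n\<in>set mu. n > 0"
  shows "(psum mu (image_mset \<pi> m) :: 'a::comm_ring_1) = psum mu m"
  using assms(2)
proof (induction mu arbitrary: m)
  case (Cons n mu)
  have n: "n > 0"
    using Cons.prems by simp
  have "bij_betw \<pi> {i. n \<le> count m i} {i. n \<le> count (image_mset \<pi> m) i}"
  proof (rule bij_betw_byWitness[where f' = "inv \<pi>"])
    show "inv \<pi> ` {i. n \<le> count (image_mset \<pi> m) i} \<subseteq> {i. n \<le> count m i}"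
      using assms(1) count_image_mset_bij[OF assms(1)]
      by (auto simp: bij_inv_eq_iff) (metis bij_inv_eq_iff)
  qed (use assms(1) in \<open>auto simp: count_image_mset_bij bij_is_inj bij_is_surj surj_f_inv_f\<close>)
  then have "(psum (n # mu) (image_mset \<pi> m) :: 'a) =
      (\<Sum>i | n \<le> count m i. psum mu (image_mset \<pi> m - replicate_mset n (\<pi> i)))"
    unfolding psum_Cons[OF n] by (rule sum.reindex_bij_betw[symmetric])
  also have "\<dots> = (\<Sum>i | n \<le> count m i. psum mu (image_mset \<pi> (m - replicate_mset n i)))"
    by (intro sum.cong) (auto simp: image_mset_Diff replicate_mset_subseteq_iff)
  also have "\<dots> = psum (n # mu) m"
    using Cons by (simp add: psum_Cons)
  finally show ?case .
qed (simp add: psum_Nil)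

lemma psum_in_sym_upto:
  assumes "\<forall>n\<in>set mu. n > 0" "sum_list mu \<le> d"
  shows "(psum mu :: 'a::comm_ring_1 series) \<in> sym_upto d"
  using psum_image_mset[OF _ assms(1), where 'a = 'a] psum_nonzeroD[OF assms(1), where 'a = 'a] assms(2)
  by (auto simp: sym_upto_def)

text \<open>Only a bijection of all variables can be used in the symmetry condition. Both exponent
  functions are therefore compared on the finite set of variables of m and m', padded with
  zeros.\<close>

lemma same_exponents_bij:
  assumes "exponents m = exponents m'"
  obtains \<pi> where "bij \<pi>" "image_mset \<pi> m = m'"
proof -
  define A where "A = set_mset m \<union> set_mset m'"
  have finA: "finite A"
    by (simp add: A_def)
  have ext: "image_mset (count n) (mset_set A) = exponents n + replicate_mset (card A - card (set_mset n)) 0"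
    if "set_mset n \<subseteq> A" for n
  proof -
    have "A = set_mset n \<union> (A - set_mset n)" "finite A"
      using that by (auto simp: A_def)
    then have "mset_set A = mset_set (set_mset n) + mset_set (A - set_mset n)"
      by (metis Diff_disjoint finite_Diff finite_set_mset mset_set_Union)
    moreover have "image_mset (count n) (mset_set (A - set_mset n)) = image_mset (\<lambda>_. 0) (mset_set (A - set_mset n))"
      using \<open>finite A\<close> by (intro image_mset_cong) (auto simp: not_in_iff)
    ultimately show ?thesis
      using that \<open>finite A\<close> by (simp add: exponents_def image_mset_const_eq card_Diff_subset)
  qed
  have "card (set_mset m) = card (set_mset m')"
    using assms by (metis size_exponents)
  then have "image_mset (count m) (mset_set A) = image_mset (count m') (mset_set A)"
    using assms ext[of m] ext[of m'] by (simp add: A_def)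
  then obtain p where p: "p permutes A" "\<forall>x\<in>A. count m x = count m' (p x)"
    by (rule image_mset_eq_implies_permutes[OF finA])
  have bij: "bij p"
    using p(1) by (rule permutes_bij)
  have "image_mset p m = m'"
  proof (rule multiset_eqI)
    fix y
    obtain x where y: "y = p x"
      using bij by (metis bij_pointE)
    have "count m x = count m' (p x)"
    proof (cases "x \<in> A")
      case False
      then show ?thesis
        using p(1) by (metis A_def UnI1 UnI2 not_in_iff permutes_not_in)
    qed (use p(2) in auto)
    then show "count (image_mset p m) y = count m' y"
      by (simp add: y count_image_mset_bij[OF bij])
  qed
  then show ?thesis
    using bij that by blast
qed

lemma sym_upto_same_exponents:
  assumes "f \<in> sym_upto d" "exponents m = exponents m'"
  shows "f m = f m'"
proof -
  obtain \<pi> where "bij \<pi>" "image_mset \<pi> m = m'"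
    using same_exponents_bij assms(2) by blast
  then show ?thesis
    using assms(1) by (auto simp: sym_upto_def)
qed

definition partitions_upto :: "nat \<Rightarrow> nat list set" where
  "partitions_upto d = {lam. is_partition lam \<and> sum_list lam \<le> d}"

lemma finite_partitions_upto: "finite (partitions_upto d)"
proof (rule finite_subset)
  show "partitions_upto d \<subseteq> {lam. set lam \<subseteq> {..d} \<and> length lam \<le> d}"
  proof
    fix lam assume lam: "lam \<in> partitions_upto d"
    have "length lam \<le> sum_list lam"
      using lam by (induction lam) (auto simp: partitions_upto_def is_partition_def)
    then show "lam \<in> {lam. set lam \<subseteq> {..d} \<and> length lam \<le> d}"
      using lam member_le_sum_list[of _ lam] by (auto simp: partitions_upto_def dest: order_trans)
  qed
qed (rule finite_lists_length_le, simp)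

lemma sum_mset_exponents: "\<Sum>\<^sub># (exponents m) = size m"
  by (simp add: exponents_def size_multiset_overloaded_eq sum_unfold_sum_mset)

definition monomial_sym :: "nat list \<Rightarrow> 'a::comm_ring_1 series" where
  "monomial_sym lam m = (if exponents m = mset lam then 1 else 0)"

text \<open>Bounds the dimension of \<open>sym_upto d\<close> by the number of partitions of size at
  most d: f is determined by its value at one monomial of each type.\<close>

lemma sym_upto_span:
  "sym_upto d \<subseteq> module.span smul (monomial_sym ` partitions_upto d :: 'a::field series set)"
proof
  interpret vs: vector_space "smul :: 'a \<Rightarrow> 'a series \<Rightarrow> 'a series"
    by (rule vector_space_smul)
  fix f :: "'a series"
  assume f: "f \<in> sym_upto d"
  define rep where "rep lam = (SOME m. exponents m = mset lam)" for lam
  have rep: "exponents (rep lam) = mset lam" if "lam \<in> partitions_upto d" for lam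
    using exponents_exist[of lam] that unfolding rep_def
    by (auto simp: partitions_upto_def is_partition_def intro: someI_ex)
  have "f = (\<Sum>lam\<in>partitions_upto d. smul (f (rep lam)) (monomial_sym lam))"
  proof
    fix m
    define lam where "lam = rev (sorted_list_of_multiset (exponents m))"
    have ml: "mset lam = exponents m"
      by (simp add: lam_def)
    have "sorted_wrt (\<ge>) lam"
      using sorted_sorted_list_of_multiset[of "exponents m"] by (simp add: lam_def sorted_wrt_rev)
    then have part: "is_partition lam"
      by (auto simp: is_partition_def lam_def exponents_def)
    have sz: "sum_list lam = size m"
      using ml by (metis sum_mset_exponents sum_mset_sum_list)
    have "(\<Sum>mu\<in>partitions_upto d. smul (f (rep mu)) (monomial_sym mu)) m =
        (\<Sum>mu\<in>partitions_upto d. if mu = lam then f m else 0)"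
      unfolding sum_series_apply
    proof (intro sum.cong refl)
      fix mu assume mu: "mu \<in> partitions_upto d"
      have "exponents m = mset mu \<longleftrightarrow> mu = lam"
        using partition_mset_inj[of mu lam] part mu ml by (auto simp: partitions_upto_def)
      moreover have "f (rep lam) = f m" if "mu = lam"
        using sym_upto_same_exponents[OF f, of "rep lam" m] rep mu ml that by simp
      ultimately show "smul (f (rep mu)) (monomial_sym mu) m = (if mu = lam then f m else 0)"
        by (auto simp: smul_def monomial_sym_def)
    qed
    also have "\<dots> = f m"
      using f part sz finite_partitions_upto[of d]
      by (auto simp: sum.delta partitions_upto_def sym_upto_def)
    finally show "f m = (\<Sum>mu\<in>partitions_upto d. smul (f (rep mu)) (monomial_sym mu)) m" ..
  qed
  also have "\<dots> \<in> vs.span (monomial_sym ` partitions_upto d)"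
    by (intro vs.span_sum vs.span_scale vs.span_base) auto
  finally show "f \<in> vs.span (monomial_sym ` partitions_upto d)" .
qed

lemma sym_upto_subspace:
  "module.subspace smul (sym_upto d :: 'a::field series set)"
proof -
  interpret vs: vector_space "smul :: 'a \<Rightarrow> 'a series \<Rightarrow> 'a series"
    by (rule vector_space_smul)
  have "f + g \<in> sym_upto d" if "f \<in> sym_upto d" "g \<in> sym_upto d" for f g :: "'a series"
  proof -
    have "size m \<le> d" if "(f + g) m \<noteq> 0" for m
    proof -
      have "f m \<noteq> 0 \<or> g m \<noteq> 0"
        using that by auto
      then show ?thesis
        using \<open>f \<in> sym_upto d\<close> \<open>g \<in> sym_upto d\<close> by (auto simp: sym_upto_def)
    qed
    then show ?thesis
      using that by (simp add: sym_upto_def)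
  qed
  moreover have "smul c f \<in> sym_upto d" if "f \<in> sym_upto d" for c and f :: "'a series"
    using that by (simp add: sym_upto_def smul_def)
  moreover have "(0 :: 'a series) \<in> sym_upto d"
    by (simp add: sym_upto_def)
  ultimately show ?thesis
    by (simp add: vs.subspace_def)
qed

text \<open>The members with sum at most d are independent, lie in \<open>sym_upto d\<close> and are
  as many as \<open>sym_upto_span\<close> allows. An f of degree at most d outside their span would
  give an independent set that is too large.\<close>

theorem symmetric_functions_basisI:
  fixes F :: "nat list \<Rightarrow> 'a::field series"
  assumes deg: "\<And>lam. is_partition lam \<Longrightarrow> F lam \<in> sym_upto (sum_list lam)"
    and indep: "\<And>S c. finite S \<Longrightarrow> (\<And>lam. lam \<in> S \<Longrightarrow> is_partition lam) \<Longrightarrow>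
      (\<Sum>lam\<in>S. smul (c lam) (F lam)) = 0 \<Longrightarrow> \<forall>lam\<in>S. c lam = 0"
  shows "inj_on F {lam. is_partition lam}"
    and "\<not> module.dependent smul (F ` {lam. is_partition lam})"
    and "module.span smul (F ` {lam. is_partition lam}) = symmetric_functions"
proof -
  interpret vs: vector_space "smul :: 'a \<Rightarrow> 'a series \<Rightarrow> 'a series"
    by (rule vector_space_smul)
  let ?P = "{lam. is_partition lam}"
  show inj: "inj_on F ?P"
  proof (rule inj_onI, rule ccontr)
    fix lam mu assume *: "lam \<in> ?P" "mu \<in> ?P" "F lam = F mu" "lam \<noteq> mu"
    define c :: "nat list \<Rightarrow> 'a" where "c x = (if x = lam then 1 else -1)" for x
    have "(\<Sum>x\<in>{lam, mu}. smul (c x) (F x)) = 0"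
      using * by (auto simp: c_def smul_def fun_eq_iff)
    then have "c lam = 0"
      using indep[of "{lam, mu}" c] * by auto
    then show False
      by (simp add: c_def)
  qed
  show ind: "\<not> vs.dependent (F ` ?P)"
    unfolding vs.independent_explicit_finite_subsets
  proof (intro allI impI)
    fix S u
    assume S: "S \<subseteq> F ` ?P" "finite S" "(\<Sum>v\<in>S. smul (u v) v) = 0"
    define R where "R = {lam \<in> ?P. F lam \<in> S}"
    have injR: "inj_on F R"
      using inj by (rule inj_on_subset) (auto simp: R_def)
    have img: "F ` R = S"
      using S(1) by (auto simp: R_def)
    then have "finite R"
      using S(2) injR finite_imageD by blast
    moreover have "(\<Sum>lam\<in>R. smul (u (F lam)) (F lam)) = 0"
      using S(3) by (simp add: img[symmetric] sum.reindex[OF injR])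
    ultimately have "\<forall>lam\<in>R. u (F lam) = 0"
      by (intro indep[of R "\<lambda>lam. u (F lam)"]) (auto simp: R_def)
    then show "\<forall>v\<in>S. u v = 0"
      by (auto simp: img[symmetric])
  qed
  show "vs.span (F ` ?P) = symmetric_functions"
  proof
    have mono: "sym_upto d \<subseteq> sym_upto e" if "d \<le> e" for d e
      using that by (auto simp: sym_upto_def intro: order_trans)
    have "vs.subspace (symmetric_functions :: 'a series set)"
      unfolding vs.subspace_def
    proof (intro conjI ballI allI)
      show "(0 :: 'a series) \<in> symmetric_functions"
        using vs.subspace_0[OF sym_upto_subspace] by (auto simp: symmetric_functions_eq_Union)
      show "smul c f \<in> symmetric_functions" if "f \<in> symmetric_functions" for c :: 'a and f
        using that vs.subspace_scale[OF sym_upto_subspace] by (auto simp: symmetric_functions_eq_Union)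
      show "f + g \<in> symmetric_functions" if fg: "f \<in> symmetric_functions" "g \<in> symmetric_functions"
        for f g :: "'a series"
      proof -
        obtain d e where "f \<in> sym_upto d" "g \<in> sym_upto e"
          using fg by (auto simp: symmetric_functions_eq_Union)
        then have "f \<in> sym_upto (max d e)" "g \<in> sym_upto (max d e)"
          using mono[of d "max d e"] mono[of e "max d e"] by auto
        then show ?thesis
          using vs.subspace_add[OF sym_upto_subspace] by (auto simp: symmetric_functions_eq_Union)
      qed
    qed
    moreover have "F ` ?P \<subseteq> symmetric_functions"
      using deg by (auto simp: symmetric_functions_eq_Union)
    ultimately show "vs.span (F ` ?P) \<subseteq> symmetric_functions"
      by (rule vs.span_minimal[rotated])
    show "symmetric_functions \<subseteq> vs.span (F ` ?P)"
    proof
      fix f :: "'a series" assume "f \<in> symmetric_functions"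
      then obtain d where f: "f \<in> sym_upto d"
        by (auto simp: symmetric_functions_eq_Union)
      define B where "B = F ` partitions_upto d"
      let ?M = "monomial_sym ` partitions_upto d :: 'a series set"
      have sub: "partitions_upto d \<subseteq> ?P"
        by (auto simp: partitions_upto_def)
      have cardB: "card B = card (partitions_upto d)"
        unfolding B_def using inj_on_subset[OF inj sub] by (rule card_image)
      have BM: "B \<subseteq> vs.span ?M"
        using deg mono sym_upto_span[of d] by (force simp: B_def partitions_upto_def)
      have indB: "vs.independent B"
        using ind sub vs.dependent_mono[of B "F ` ?P"] by (auto simp: B_def)
      have "f \<in> vs.span B"
      proof (rule ccontr)
        assume nf: "f \<notin> vs.span B"
        then have "vs.independent (insert f B)"
          using indB vs.independent_insertI by blast
        moreover have "insert f B \<subseteq> vs.span ?M"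
          using BM f sym_upto_span[of d] by auto
        ultimately have "card (insert f B) \<le> card ?M"
          using vs.independent_span_bound[of ?M] finite_partitions_upto by blast
        also have "\<dots> \<le> card B"
          unfolding cardB by (rule card_image_le[OF finite_partitions_upto])
        finally show False
          using nf vs.span_base[of f B] finite_partitions_upto[of d] by (auto simp: B_def card_insert_if split: if_splits)
      qed
      then show "f \<in> vs.span (F ` ?P)"
        using vs.span_mono[of B "F ` ?P"] sub by (auto simp: B_def)
    qed
  qed
qed

section \<open>The expansion of the family in power sums\<close>

text \<open>Makes \<open>psum_independent\<close> applicable over \<open>ratfun\<close>.\<close>

instance fract :: ("{idom, ring_char_0}") ring_char_0
proof
  show "inj (of_nat :: nat \<Rightarrow> 'a fract)"
    by (rule injI) (simp add: of_nat_fract eq_fract)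
qed

text \<open>A row of nonzero index contributes at least one variable to each of its
  monomials.\<close>

lemma row_prod_nonzeroD:
  assumes "lookup (row_prod r \<beta>) M \<noteq> 0"
  shows "(\<forall>p<r. 0 \<le> lookup \<beta> p) \<and> (\<Sum>p<r. lookup \<beta> p) = int (weight M) \<and>
    card {p. p < r \<and> lookup \<beta> p \<noteq> 0} \<le> size M"
  using assms
proof (induction r arbitrary: M)
  case 0
  then show ?case
    by (simp add: row_prod_def lookup_one when_def split: if_splits)
next
  case (Suc r)
  have "M \<in> keys (row_prod r \<beta> * row (lookup \<beta> r))"
    using Suc.prems by (simp add: row_prod_def in_keys_iff)
  then obtain A B where M: "M = A + B" and A: "lookup (row_prod r \<beta>) A \<noteq> 0"
    and B: "lookup (row (lookup \<beta> r)) B \<noteq> 0"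
    using keys_mult by (fastforce simp: in_keys_iff)
  have wB: "int (weight B) = lookup \<beta> r"
    using B by (simp add: lookup_row split: if_splits)
  have "{p. p < Suc r \<and> lookup \<beta> p \<noteq> 0} =
      {p. p < r \<and> lookup \<beta> p \<noteq> 0} \<union> (if lookup \<beta> r \<noteq> 0 then {r} else {})"
    by (auto simp: less_Suc_eq)
  moreover have "lookup \<beta> r \<noteq> 0 \<Longrightarrow> size B \<ge> 1"
    using wB by (cases B) auto
  ultimately have "card {p. p < Suc r \<and> lookup \<beta> p \<noteq> 0} \<le>
      card {p. p < r \<and> lookup \<beta> p \<noteq> 0} + size B"
    by simp
  then show ?case
    using Suc.IH[OF A] wB by (auto simp: M less_Suc_eq)
qed

text \<open>A row of index n > 0 has the single monomial h_{-n} of size 1, and all its others are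
  larger. So exactly one monomial of a product of r such rows has size at most r.\<close>

lemma row_prod_leading:
  assumes "\<And>p. p < r \<Longrightarrow> lookup \<beta> p > 0" "size M \<le> r"
  shows "lookup (row_prod r \<beta>) M \<noteq> 0 \<longleftrightarrow> M = image_mset (\<lambda>p. nat (lookup \<beta> p) - 1) (mset_set {..<r})"
proof -
  define top where "top r = image_mset (\<lambda>p. nat (lookup \<beta> p) - 1) (mset_set {..<r})" for r
  have "\<exists>c R. c \<noteq> 0 \<and> row_prod r \<beta> = single (top r) c + R \<and> keys R \<subseteq> {N. size N > r}"
    using assms(1)
  proof (induction r)
    case 0
    have "row_prod 0 \<beta> = single (top 0) 1 + 0"
      by (simp add: row_prod_def top_def)
    then show ?case
      by (metis empty_subsetI keys_zero zero_neq_one)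
  next
    case (Suc r)
    then obtain c R where c: "c \<noteq> 0" and R: "row_prod r \<beta> = single (top r) c + R"
      "keys R \<subseteq> {N. size N > r}"
      by auto
    define n where "n = nat (lookup \<beta> r) - 1"
    have n: "lookup \<beta> r = int (Suc n)"
      using Suc.prems[of r] by (simp add: n_def)
    define Q where "Q = row (lookup \<beta> r) - single {#n#} (zinv {#n#})"
    have Q: "keys Q \<subseteq> {N. size N > 1}"
    proof
      fix N assume "N \<in> keys Q"
      then have N: "weight N = Suc n" "N \<noteq> {#n#}"
        by (auto simp: Q_def in_keys_iff lookup_minus lookup_row n lookup_single when_def split: if_splits)
      have "size N \<noteq> 0"
        using N(1) by auto
      moreover have "size N \<noteq> 1"
        using N size_1_singleton_mset[of N] by auto
      ultimately show "N \<in> {N. size N > 1}"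
        unfolding mem_Collect_eq by linarith
    qed
    have R0: "keys R \<subseteq> {N. size N \<ge> Suc r}" and Q0: "keys Q \<subseteq> {N. size N \<ge> 2}"
      using R(2) Q by auto
    have "top (Suc r) = top r + {#n#}"
      by (simp add: top_def n_def lessThan_Suc)
    moreover have "row_prod (Suc r) \<beta> = (single (top r) c + R) * (Q + single {#n#} (zinv {#n#}))"
      by (simp add: Q_def row_prod_def flip: R(1))
    ultimately have "row_prod (Suc r) \<beta> = single (top (Suc r)) (c * zinv {#n#}) +
        (single (top r) c * Q + R * (Q + single {#n#} (zinv {#n#})))"
      by (simp add: algebra_simps mult_single)
    moreover have "keys (single (top r) c * Q) \<subseteq> {N. size N > Suc r}"
      by (rule keys_mult_subset[OF _ Q0, of _ "{top r}"]) (auto simp: top_def)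
    moreover have "keys (R * (Q + single {#n#} (zinv {#n#}))) \<subseteq> {N. size N > Suc r}"
    proof (rule keys_mult_subset[OF R0])
      show "keys (Q + single {#n#} (zinv {#n#})) \<subseteq> {N. size N \<ge> 1}"
        using keys_add[of Q "single {#n#} (zinv {#n#})"] Q0 by fastforce
    qed auto
    ultimately have "\<exists>R'. row_prod (Suc r) \<beta> = single (top (Suc r)) (c * zinv {#n#}) + R' \<and>
        keys R' \<subseteq> {N. size N > Suc r}"
      using keys_add[of "single (top r) c * Q" "R * (Q + single {#n#} (zinv {#n#}))"]
      by (meson Un_least order_trans)
    then show ?case
      using c by (metis mult_eq_0_iff zinv_nonzero)
  qed
  then obtain c R where "c \<noteq> 0" "row_prod r \<beta> = single (top r) c + R" "keys R \<subseteq> {N. size N > r}"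
    by blast
  moreover have "lookup R M = 0"
    using \<open>keys R \<subseteq> _\<close> assms(2) by (auto simp: in_keys_iff)
  ultimately show ?thesis
    by (auto simp: lookup_add lookup_single when_def top_def)
qed

text \<open>\<open>lowered\<close> and \<open>raised\<close> translate between partitions and
  multisets of Fock indices, where i stands for the part i + 1; \<open>raised M\<close> is the list
  that \<open>T\<close> hands to \<open>psum\<close>.\<close>

definition lowered :: "nat list \<Rightarrow> nat multiset" where
  "lowered lam = mset (map (\<lambda>x. x - 1) lam)"

definition raised :: "nat multiset \<Rightarrow> nat list" where
  "raised M = rev (map Suc (sorted_list_of_multiset M))"

lemma is_partition_raised: "is_partition (raised M)"
  using sorted_sorted_list_of_multiset[of M]
  by (auto simp: is_partition_def raised_def sorted_wrt_rev sorted_wrt_map)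

lemma sum_list_raised: "sum_list (raised M) = weight M"
proof -
  have "sum_list (map Suc (sorted_list_of_multiset M)) = (\<Sum>i\<in>#mset (sorted_list_of_multiset M). Suc i)"
    by (metis mset_map sum_mset_sum_list)
  then show ?thesis
    by (simp add: raised_def weight_def)
qed

lemma lowered_raised: "lowered (raised M) = M"
  by (simp add: lowered_def raised_def rev_map[symmetric] o_def)

lemma inj_raised: "inj raised"
  by (metis injI lowered_raised)

lemma size_lowered [simp]: "size (lowered lam) = length lam"
  by (simp add: lowered_def)

lemma raised_lowered:
  assumes "is_partition lam"
  shows "raised (lowered lam) = lam"
proof (rule partition_mset_inj[OF is_partition_raised assms])
  have "mset (raised (lowered lam)) = image_mset Suc (lowered lam)"
    by (simp add: raised_def)
  also have "\<dots> = mset (map (Suc \<circ> (\<lambda>x. x - 1)) lam)"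
    by (simp add: lowered_def multiset.map_comp)
  also have "map (Suc \<circ> (\<lambda>x. x - 1)) lam = lam"
    using assms by (intro map_idI) (auto simp: is_partition_def)
  finally show "mset (raised (lowered lam)) = mset lam" .
qed

lemma c_const_nonzero [simp]: "c_const s n \<noteq> 0"
  by (simp add: c_const_def)

text \<open>\<open>g M\<close> is the coefficient of the monomial M after removal of
  \<open>c_const\<close> and of \<alpha>^l(\<lambda>). The equivalence at 0 is the triangularity; it
  covers only M at least as long as \<lambda>.\<close>

theorem X_minus_coefficients:
  assumes "is_partition lam"
  shows "\<exists>g. (\<forall>M. weight M \<noteq> sum_list lam \<longrightarrow> g M = 0) \<and> (\<forall>M. \<forall>x\<ge>0. regular_at (g M) x) \<and>
    (\<forall>M. size M \<ge> length lam \<longrightarrow> (rf_value (g M) 0 \<noteq> 0 \<longleftrightarrow> M = lowered lam)) \<and>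
    (\<forall>n>0. \<forall>M l. lookup (X_minus n lam (vac (- int (length lam)))) (M, l) =
      (if l = int (length lam) then c_const (length lam) n *
         of_rat (rf_value (alpha_var ^ length lam * g M) (of_nat n)) else 0))"
proof -
  define s where "s = length lam"
  define S where "S = {..<s}"
  define \<rho> :: "nat \<Rightarrow>\<^sub>0 int" where "\<rho> = (\<Sum>p<s. single p (int (rev lam ! p)))"
  \<comment> \<open>The \<beta> that contribute to M. They are finitely many, since their entries
    are nonnegative with sum \<open>weight M\<close>.\<close>
  define \<Gamma> where "\<Gamma> M = {\<beta> :: nat \<Rightarrow>\<^sub>0 int. keys \<beta> \<subseteq> S \<and> lookup (row_prod s \<beta>) M \<noteq> 0}" for M
  have finS: "finite S"
    by (simp add: S_def)
  obtain L where
    L_reg: "\<And>\<gamma> x. x \<ge> 0 \<Longrightarrow> regular_at (L \<gamma>) x" and L_1: "L 0 = 1" and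
    L_0: "\<And>\<gamma>. \<not> (keys \<gamma> \<subseteq> S \<and> (\<Sum>p\<in>S. lookup \<gamma> p) = 0) \<Longrightarrow> L \<gamma> = 0" and
    L_val: "\<And>\<gamma> n. n > 0 \<Longrightarrow> lookup (dyson S (\<lambda>_. n)) \<gamma> = lookup (dyson S (\<lambda>_. n)) 0 *
       of_rat (rf_value (alpha_var ^ neg_count S \<gamma> * L \<gamma>) (of_nat n))"
    using dyson_coeff_rational[OF finS] by metis
  define g where "g M = (\<Sum>\<beta>\<in>\<Gamma> M. alpha_var ^ (size M + neg_count S (\<beta> - \<rho>) - s) * L (\<beta> - \<rho>) *
      to_fract [:lookup (row_prod s \<beta>) M:])" for M

  have rho: "lookup \<rho> p = (if p < s then int (rev lam ! p) else 0)" for p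
    by (simp add: \<rho>_def lookup_sum lookup_single when_def)
  have rho_pos: "lookup \<rho> p > 0" if "p < s" for p
  proof -
    have "rev lam ! p \<in> set lam"
      using that nth_mem[of p "rev lam"] by (simp add: s_def)
    then show ?thesis
      using assms that by (auto simp: rho is_partition_def)
  qed
  have rho_keys: "keys \<rho> \<subseteq> S"
    by (auto simp: in_keys_iff rho S_def split: if_splits)
  have rho_sum: "(\<Sum>p\<in>S. lookup \<rho> p) = int (sum_list lam)"
  proof -
    have "(\<Sum>p<s. rev lam ! p) = sum_list (rev lam)"
      by (simp add: sum_list_sum_nth s_def atLeast0LessThan)
    then have "int (\<Sum>p<s. rev lam ! p) = int (sum_list lam)"
      by simp
    then show ?thesis
      by (simp add: S_def rho)
  qed
  have rho_lowered: "image_mset (\<lambda>p. nat (lookup \<rho> p) - 1) (mset_set {..<s}) = lowered lam"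
  proof -
    have "lowered lam = mset (map (\<lambda>x. x - 1) (rev lam))"
      by (simp add: lowered_def)
    also have "map (\<lambda>x. x - 1) (rev lam) = map (\<lambda>p. rev lam ! p - 1) [0..<s]"
      by (rule nth_equalityI) (auto simp: s_def)
    also have "mset \<dots> = image_mset (\<lambda>p. rev lam ! p - 1) (mset_set {..<s})"
      by (simp add: atLeast0LessThan)
    also have "\<dots> = image_mset (\<lambda>p. nat (lookup \<rho> p) - 1) (mset_set {..<s})"
      by (intro image_mset_cong) (auto simp: rho)
    finally show ?thesis ..
  qed

  have fin: "finite (\<Gamma> M)" for M
  proof (rule finite_imageD)
    show "inj_on lookup (\<Gamma> M)"
      by (simp add: inj_on_def poly_mapping_eqI)
    show "finite (lookup ` \<Gamma> M)"
    proof (rule finite_subset)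
      show "lookup ` \<Gamma> M \<subseteq>
          {f. \<forall>p. (p \<in> S \<longrightarrow> f p \<in> {0..int (weight M)}) \<and> (p \<notin> S \<longrightarrow> f p = 0)}"
      proof (rule image_subsetI)
        fix \<beta> assume \<beta>: "\<beta> \<in> \<Gamma> M"
        then have b: "\<And>p. p < s \<Longrightarrow> 0 \<le> lookup \<beta> p" "(\<Sum>p<s. lookup \<beta> p) = int (weight M)"
          using row_prod_nonzeroD[of s \<beta> M] by (auto simp: \<Gamma>_def)
        have "lookup \<beta> p \<le> int (weight M)" if "p < s" for p
          unfolding b(2)[symmetric] using b(1) that by (intro member_le_sum) auto
        then show "lookup \<beta> \<in> {f. \<forall>p. (p \<in> S \<longrightarrow> f p \<in> {0..int (weight M)}) \<and> (p \<notin> S \<longrightarrow> f p = 0)}"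
          using b(1) \<beta> by (auto simp: \<Gamma>_def S_def in_keys_iff)
      qed
    qed (rule finite_set_of_finite_funs, auto simp: finS)
  qed

  \<comment> \<open>For each p < s, a nonzero \<beta>_p uses up a variable of M, and a zero
    \<beta>_p becomes the negative entry - \<rho>_p of \<beta> - \<rho>. This makes the subtraction
    of s in \<open>g\<close> exact.\<close>
  have exponent: "s \<le> size M + neg_count S (\<beta> - \<rho>)" if "\<beta> \<in> \<Gamma> M" for \<beta> M
  proof -
    have "S = {p. p < s \<and> lookup \<beta> p \<noteq> 0} \<union> {p \<in> S. lookup \<beta> p = 0}"
      by (auto simp: S_def)
    then have "s \<le> card {p. p < s \<and> lookup \<beta> p \<noteq> 0} + card {p \<in> S. lookup \<beta> p = 0}"
      by (metis S_def card_Un_le card_lessThan)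
    moreover have "card {p. p < s \<and> lookup \<beta> p \<noteq> 0} \<le> size M"
      using that row_prod_nonzeroD[of s \<beta> M] by (simp add: \<Gamma>_def)
    moreover have "card {p \<in> S. lookup \<beta> p = 0} \<le> neg_count S (\<beta> - \<rho>)"
      unfolding neg_count_def using rho_pos finS
      by (intro card_mono) (auto simp: lookup_minus S_def)
    ultimately show ?thesis
      by linarith
  qed
  have reg_term: "regular_at (alpha_var ^ e * L \<gamma> * to_fract [:c:]) x" if "x \<ge> 0" for e \<gamma> c x
    using that by (intro regular_at_mult regular_at_power) (auto simp: L_reg)
  have reg: "regular_at (g M) x" if "x \<ge> 0" for M x
    unfolding g_def using that by (intro regular_at_sum reg_term)

  have "g M = 0" if "weight M \<noteq> sum_list lam" for M
    unfolding g_def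
  proof (rule sum.neutral, intro ballI)
    fix \<beta> assume "\<beta> \<in> \<Gamma> M"
    then have "(\<Sum>p\<in>S. lookup \<beta> p) = int (weight M)"
      using row_prod_nonzeroD[of s \<beta> M] by (simp add: \<Gamma>_def S_def)
    then have "(\<Sum>p\<in>S. lookup (\<beta> - \<rho>) p) \<noteq> 0"
      using that by (simp add: lookup_minus sum_subtractf rho_sum)
    then show "alpha_var ^ (size M + neg_count S (\<beta> - \<rho>) - s) * L (\<beta> - \<rho>) *
        to_fract [:lookup (row_prod s \<beta>) M:] = 0"
      by (simp add: L_0)
  qed
  moreover have "rf_value (g M) 0 \<noteq> 0 \<longleftrightarrow> M = lowered lam" if M: "size M \<ge> s" for M
  proof -
    have term0: "rf_value (alpha_var ^ (size M + neg_count S (\<beta> - \<rho>) - s) * L (\<beta> - \<rho>) *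
        to_fract [:lookup (row_prod s \<beta>) M:]) 0 =
        (if \<beta> = \<rho> \<and> size M = s then lookup (row_prod s \<rho>) M else 0)" if \<beta>: "\<beta> \<in> \<Gamma> M" for \<beta>
    proof -
      \<comment> \<open>A positive power of \<alpha> kills the term at 0. The power 0 means
        \<open>size M = s\<close> without negative entries in \<beta> - \<rho>, and as
        \<open>L\<close> vanishes unless the entries have sum 0, only \<beta> = \<rho> is
        left.\<close>
      consider "\<beta> = \<rho>" "size M = s" | "size M + neg_count S (\<beta> - \<rho>) - s > 0"
        | "size M = s" "neg_count S (\<beta> - \<rho>) = 0" "\<beta> \<noteq> \<rho>"
        using M by fastforce
      then show ?thesis
      proof cases
        case 1
        then show ?thesis
          by (simp add: L_1 neg_count_def rf_value_mult)
      next
        case 2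
        then have "\<not> (\<beta> = \<rho> \<and> size M = s)"
          by (auto simp: neg_count_def)
        moreover have "rf_value (alpha_var ^ (size M + neg_count S (\<beta> - \<rho>) - s)) 0 = 0"
          using 2 by (simp add: rf_value_power zero_power)
        ultimately show ?thesis
          by (auto simp: rf_value_mult regular_at_mult regular_at_power L_reg)
      next
        case 3
        have nonneg: "\<forall>p\<in>S. 0 \<le> lookup (\<beta> - \<rho>) p"
          using 3(2) finS by (auto simp: neg_count_def not_less)
        have "L (\<beta> - \<rho>) = 0"
        proof (rule ccontr)
          assume "L (\<beta> - \<rho>) \<noteq> 0"
          then have "keys (\<beta> - \<rho>) \<subseteq> S" "(\<Sum>p\<in>S. lookup (\<beta> - \<rho>) p) = 0"
            using L_0 by blast+
          then have "lookup (\<beta> - \<rho>) p = 0" for p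
            using nonneg finS sum_nonneg_eq_0_iff[of S "lookup (\<beta> - \<rho>)"] by (auto simp: in_keys_iff)
          then have "\<beta> - \<rho> = 0"
            by (intro poly_mapping_eqI) simp
          then show False
            using 3(3) by simp
        qed
        then show ?thesis
          using 3 by simp
      qed
    qed
    have "rf_value (g M) 0 = (\<Sum>\<beta>\<in>\<Gamma> M. if \<beta> = \<rho> \<and> size M = s then lookup (row_prod s \<rho>) M else 0)"
      unfolding g_def by (subst rf_value_sum) (auto simp: reg_term term0 intro!: sum.cong)
    also have "\<dots> = (if size M = s then lookup (row_prod s \<rho>) M else 0)"
      using fin[of M] rho_keys by (auto simp: \<Gamma>_def)
    finally show ?thesis
      using row_prod_leading[of s \<rho> M] rho_pos rho_lowered by (auto simp: s_def)
  qed
  moreover have "lookup (X_minus n lam (vac (- int s))) (M, l) =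
      (if l = int s then c_const s n * of_rat (rf_value (alpha_var ^ s * g M) (of_nat n)) else 0)"
    if n: "n > 0" for n M l
  proof (cases "l = int s")
    case True
    define D where "D = dyson S (\<lambda>_. n)"
    define \<epsilon> :: complex where "\<epsilon> = (-1) ^ (s * (s - 1) * n div 2)"
    have "zmono s (\<lambda>p. int (rev lam ! p)) = single \<rho> 1"
    proof -
      have "(\<Prod>p<m. zpow p (int (rev lam ! p))) = single (\<Sum>p<m. single p (int (rev lam ! p))) 1" for m
        by (induction m) (simp_all add: zpow_def mult_single)
      then show ?thesis
        by (simp add: zmono_def \<rho>_def)
    qed
    moreover have "(-1) ^ m = (single 0 ((-1) ^ m) :: laurent)" for m
      by (induction m) (simp_all add: mult_single flip: single_uminus)
    ultimately have X: "X_minus n lam (vac (- int s)) =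
        fock_lift n s (int s) (single 0 \<epsilon> * (single \<rho> 1 * D))"
      using X_minus_vac[OF n, of lam "- int s"] by (simp add: s_def[symmetric] S_def D_def \<epsilon>_def)
    have coeff: "lookup (single 0 \<epsilon> * (single \<rho> 1 * D)) \<beta> = \<epsilon> * lookup D (\<beta> - \<rho>)" for \<beta>
      by (simp add: lookup_single_mult)
    have outside: "lookup D (\<beta> - \<rho>) = 0" if "\<not> keys \<beta> \<subseteq> S" for \<beta>
    proof -
      have "\<not> keys (\<beta> - \<rho>) \<subseteq> S"
      proof
        assume "keys (\<beta> - \<rho>) \<subseteq> S"
        then have "keys (\<beta> - \<rho> + \<rho>) \<subseteq> S"
          using keys_add[of "\<beta> - \<rho>" \<rho>] rho_keys by blast
        then show False
          using that by simp
      qed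
      then show ?thesis
        unfolding D_def by (intro dyson_coeff_eq_0[OF finS]) blast
    qed
    let ?Z = "single 0 \<epsilon> * (single \<rho> 1 * D)"
    have "(\<Sum>\<beta>\<in>keys ?Z. lookup ?Z \<beta> * of_rat (lookup (row_prod s \<beta>) M)) =
        (\<Sum>\<beta>\<in>\<Gamma> M. \<epsilon> * lookup D (\<beta> - \<rho>) * of_rat (lookup (row_prod s \<beta>) M))"
    proof (rule sum.mono_neutral_cong)
      show "lookup ?Z \<beta> * of_rat (lookup (row_prod s \<beta>) M) = 0" if "\<beta> \<in> keys ?Z - \<Gamma> M" for \<beta>
        using that outside[of \<beta>]
        by (cases "keys \<beta> \<subseteq> S") (simp_all add: coeff \<Gamma>_def del: lookup_scale)
      show "\<epsilon> * lookup D (\<beta> - \<rho>) * of_rat (lookup (row_prod s \<beta>) M) = 0" if "\<beta> \<in> \<Gamma> M - keys ?Z" for \<beta>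
        using that coeff[of \<beta>] by (auto simp: in_keys_iff simp del: lookup_scale)
    qed (auto simp: fin coeff simp del: lookup_scale)
    then have "lookup (X_minus n lam (vac (- int s))) (M, l) = of_nat n ^ size M *
        (\<Sum>\<beta>\<in>\<Gamma> M. \<epsilon> * lookup D (\<beta> - \<rho>) * of_rat (lookup (row_prod s \<beta>) M))"
      using True by (simp add: X lookup_fock_lift)
    also have "\<dots> = \<epsilon> * lookup D 0 * of_rat (of_nat n ^ size M *
        (\<Sum>\<beta>\<in>\<Gamma> M. rf_value (alpha_var ^ neg_count S (\<beta> - \<rho>) * L (\<beta> - \<rho>)) (of_nat n) *
          lookup (row_prod s \<beta>) M))"
      unfolding D_def L_val[OF n, of "_ - \<rho>"]
      by (simp add: of_rat_mult of_rat_sum of_rat_power sum_distrib_left mult_ac)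
    also have "of_nat n ^ size M *
        (\<Sum>\<beta>\<in>\<Gamma> M. rf_value (alpha_var ^ neg_count S (\<beta> - \<rho>) * L (\<beta> - \<rho>)) (of_nat n) *
          lookup (row_prod s \<beta>) M) = rf_value (alpha_var ^ s * g M) (of_nat n)"
    proof -
      have "of_nat n ^ size M * (rf_value (alpha_var ^ neg_count S (\<beta> - \<rho>) * L (\<beta> - \<rho>)) (of_nat n) *
          lookup (row_prod s \<beta>) M) = of_nat n ^ s * rf_value
          (alpha_var ^ (size M + neg_count S (\<beta> - \<rho>) - s) * L (\<beta> - \<rho>) *
            to_fract [:lookup (row_prod s \<beta>) M:]) (of_nat n)" if "\<beta> \<in> \<Gamma> M" for \<beta>
      proof -
        have "of_nat n ^ size M * of_nat n ^ neg_count S (\<beta> - \<rho>) =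
            of_nat n ^ s * (of_nat n ^ (size M + neg_count S (\<beta> - \<rho>) - s) :: rat)"
          using exponent[OF that] by (simp flip: power_add)
        then show ?thesis
          by (simp add: rf_value_mult regular_at_mult regular_at_power rf_value_power L_reg)
      qed
      then have "of_nat n ^ size M *
          (\<Sum>\<beta>\<in>\<Gamma> M. rf_value (alpha_var ^ neg_count S (\<beta> - \<rho>) * L (\<beta> - \<rho>)) (of_nat n) *
            lookup (row_prod s \<beta>) M) = of_nat n ^ s * rf_value (g M) (of_nat n)"
        unfolding g_def sum_distrib_left by (subst rf_value_sum) (auto simp: reg_term sum_distrib_left)
      then show ?thesis
        by (simp add: rf_value_mult reg regular_at_power rf_value_power)
    qed
    \<comment> \<open>Dyson's theorem supplies the factorials of \<open>c_const\<close>, and the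
      symmetrisation its sign.\<close>
    also have "\<epsilon> * lookup D 0 = c_const s n"
      by (simp add: D_def \<epsilon>_def c_const_def dyson_constant_term finS) (simp add: S_def)
    finally show ?thesis
      using True by simp
  next
    case False
    then show ?thesis
      using X_minus_vac[OF n, of lam "- int s"] by (simp add: s_def[symmetric] lookup_fock_lift)
  qed
  ultimately show ?thesis
    using reg unfolding s_def by (intro exI[of _ g]) blast
qed

section \<open>Existence and uniqueness of the family\<close>

lemma finite_weight_eq: "finite {M. weight M = n}"
  by (rule finite_subset[OF _ finite_weight_le[of n]]) auto

lemma smul_0 [simp]: "smul 0 f = 0"
  by (simp add: smul_def fun_eq_iff)

lemma smul_smul: "smul a (smul b f) = smul (a * b) f"
  by (simp add: smul_def mult.assoc)

lemma smul_diff_left: "smul (a - b) f = smul a f - smul b f"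
  by (simp add: smul_def fun_eq_iff algebra_simps)

lemma smul_sum_right: "smul a (\<Sum>i\<in>I. f i) = (\<Sum>i\<in>I. smul a (f i))"
  by (simp add: smul_def fun_eq_iff sum_series_apply sum_distrib_left)

lemma smul_sum_left: "smul (\<Sum>i\<in>I. a i) f = (\<Sum>i\<in>I. smul (a i) f)"
  by (simp add: smul_def fun_eq_iff sum_series_apply sum_distrib_right)

text \<open>Independence of the power sums over the complex numbers forces the coefficients to agree
  at every positive integer; these are infinitely many points, so they agree as rational
  functions.\<close>

lemma is_X_prime_unique:
  assumes "is_X_prime lam F" "is_X_prime lam F'"
  shows "F = F'"
proof -
  obtain a where a: "\<forall>mu\<in>keys a. is_partition mu"
    "F = (\<Sum>mu\<in>keys a. smul (lookup a mu) (psum mu))"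
    "\<forall>mu\<in>keys a. \<forall>n::nat. 0 < n \<longrightarrow> regular_at (lookup a mu) (of_nat n)"
    "\<forall>n::nat. 0 < n \<longrightarrow>
      (\<Sum>mu\<in>keys a. smul (of_rat (rf_value (lookup a mu) (of_nat n))) (psum mu)) =
      smul (inverse (c_const (length lam) n)) (T (X_minus n lam (vac (- int (length lam)))))"
    using assms(1) unfolding is_X_prime_def by blast
  obtain b where b: "\<forall>mu\<in>keys b. is_partition mu"
    "F' = (\<Sum>mu\<in>keys b. smul (lookup b mu) (psum mu))"
    "\<forall>mu\<in>keys b. \<forall>n::nat. 0 < n \<longrightarrow> regular_at (lookup b mu) (of_nat n)"
    "\<forall>n::nat. 0 < n \<longrightarrow>
      (\<Sum>mu\<in>keys b. smul (of_rat (rf_value (lookup b mu) (of_nat n))) (psum mu)) =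
      smul (inverse (c_const (length lam) n)) (T (X_minus n lam (vac (- int (length lam)))))"
    using assms(2) unfolding is_X_prime_def by blast
  define K where "K = keys a \<union> keys b"
  have K: "finite K" "\<And>mu. mu \<in> K \<Longrightarrow> is_partition mu"
    using a(1) b(1) by (auto simp: K_def)
  have ext: "(\<Sum>mu\<in>keys c. smul (of_rat (rf_value (lookup c mu) x)) (psum mu)) =
      (\<Sum>mu\<in>K. smul (of_rat (rf_value (lookup c mu) x)) (psum mu) :: complex series)"
    if "keys c \<subseteq> K" for c x
    using that K(1) by (intro sum.mono_neutral_left) (auto simp: in_keys_iff)
  have reg: "regular_at (lookup a mu) (of_nat n)" "regular_at (lookup b mu) (of_nat n)"
    if "n > 0" for n mu
    using a(3) b(3) that by (cases "mu \<in> keys a"; cases "mu \<in> keys b"; simp add: in_keys_iff)+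
  have val: "rf_value (lookup a mu) (of_nat n) = rf_value (lookup b mu) (of_nat n)"
    if n: "n > 0" and mu: "mu \<in> K" for n mu
  proof -
    have "(\<Sum>mu\<in>K. smul (of_rat (rf_value (lookup a mu) (of_nat n)) -
        of_rat (rf_value (lookup b mu) (of_nat n))) (psum mu) :: complex series) = 0"
      using a(4) b(4) n ext[of a] ext[of b]
      by (simp add: smul_diff_left sum_subtractf K_def)
    then have "(of_rat (rf_value (lookup a mu) (of_nat n)) :: complex) =
        of_rat (rf_value (lookup b mu) (of_nat n))"
      using psum_independent[OF K] mu by force
    then show ?thesis
      by simp
  qed
  have inf: "infinite {x :: rat. \<exists>n>0. x = of_nat n}"
  proof
    assume "finite {x :: rat. \<exists>n>0. x = of_nat n}"
    then have "finite ((of_nat :: nat \<Rightarrow> rat) ` {0<..})"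
      by (rule rev_finite_subset) auto
    then have "finite {0::nat<..}"
      by (rule finite_imageD) (simp add: inj_on_def)
    then show False
      using infinite_Ioi by blast
  qed
  have "lookup a mu = lookup b mu" if "mu \<in> K" for mu
    by (rule ratfun_eqI[OF inf]) (use reg val that in auto)
  then have "lookup a mu = lookup b mu" for mu
    by (cases "mu \<in> K") (auto simp: K_def in_keys_iff)
  then have "a = b"
    by (rule poly_mapping_eqI)
  then show ?thesis
    using a(2) b(2) by simp
qed

lemma T_eq_sum:
  assumes "finite W" "\<And>M l. lookup v (M, l) \<noteq> 0 \<Longrightarrow> M \<in> W \<and> l = k"
  shows "T v = (\<Sum>M\<in>W. smul (lookup v (M, k)) (psum (raised M)))"
proof -
  have "T v = (\<Sum>(M, l)\<in>(\<lambda>M. (M, k)) ` W. smul (lookup v (M, l)) (psum (raised M)))"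
    unfolding T_def raised_def[symmetric] using assms
    by (intro sum.mono_neutral_left) (auto simp: in_keys_iff)
  also have "\<dots> = (\<Sum>M\<in>W. smul (lookup v (M, k)) (psum (raised M)))"
    by (subst sum.reindex) (auto simp: inj_on_def)
  finally show ?thesis .
qed

lemma X_prime_expansion:
  assumes "is_partition lam"
  shows "\<exists>g. (\<forall>M. weight M \<noteq> sum_list lam \<longrightarrow> g M = 0) \<and> (\<forall>M. regular_at (g M) 0) \<and>
    (\<forall>M. size M \<ge> length lam \<longrightarrow> (rf_value (g M) 0 \<noteq> 0 \<longleftrightarrow> M = lowered lam)) \<and>
    X_prime lam = (\<Sum>M | weight M = sum_list lam.
      smul (alpha_var ^ length lam * g M) (psum (raised M)))"
proof -
  define s where "s = length lam"
  define W where "W = {M. weight M = sum_list lam}"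
  have finW: "finite W"
    by (simp add: W_def finite_weight_eq)
  obtain g where "\<forall>M. weight M \<noteq> sum_list lam \<longrightarrow> g M = 0" "\<forall>M. \<forall>x\<ge>0. regular_at (g M) x"
    "\<forall>M. size M \<ge> s \<longrightarrow> (rf_value (g M) 0 \<noteq> 0 \<longleftrightarrow> M = lowered lam)"
    "\<forall>n>0. \<forall>M l. lookup (X_minus n lam (vac (- int s))) (M, l) =
      (if l = int s then c_const s n * of_rat (rf_value (alpha_var ^ s * g M) (of_nat n)) else 0)"
    using X_minus_coefficients[OF assms] unfolding s_def by (elim exE conjE)
  note g = this[rule_format]
  define h where "h M = alpha_var ^ s * g M" for M
  define a where "a = (\<Sum>M\<in>W. single (raised M) (h M))"
  have a_raised: "lookup a (raised M) = (if M \<in> W then h M else 0)" for M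
    using finW by (simp add: a_def lookup_sum lookup_single when_def inj_eq[OF inj_raised])
  have keys_a: "keys a \<subseteq> raised ` W"
    by (auto simp: a_def in_keys_iff lookup_sum lookup_single when_def split: if_splits
        elim!: sum.not_neutral_contains_not_neutral)
  \<comment> \<open>Kept general in \<open>\<phi>\<close> because it is used for the coefficients
    themselves and for their values at n.\<close>
  have expand: "(\<Sum>mu\<in>keys a. smul (\<phi> (lookup a mu)) (psum mu)) =
      (\<Sum>M\<in>W. smul (\<phi> (h M)) (psum (raised M)))" if "\<phi> 0 = 0"
    for \<phi> :: "ratfun \<Rightarrow> 'b::comm_ring_1"
  proof -
    have "(\<Sum>mu\<in>keys a. smul (\<phi> (lookup a mu)) (psum mu)) =
        (\<Sum>mu\<in>raised ` W. smul (\<phi> (lookup a mu)) (psum mu))"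
      using keys_a finW that by (intro sum.mono_neutral_left) (auto simp: in_keys_iff)
    also have "\<dots> = (\<Sum>M\<in>W. smul (\<phi> (h M)) (psum (raised M)))"
      by (subst sum.reindex) (auto simp: a_raised intro: inj_on_subset[OF inj_raised])
    finally show ?thesis .
  qed
  have reg_h: "regular_at (h M) (of_nat n)" for M n
    by (simp add: h_def regular_at_mult regular_at_power g(2))
  define F where "F = (\<Sum>M\<in>W. smul (h M) (psum (raised M)))"
  have "is_X_prime lam F"
    unfolding is_X_prime_def
  proof (intro exI[of _ a] conjI ballI allI impI)
    fix mu assume "mu \<in> keys a"
    then obtain M where M: "mu = raised M" "M \<in> W"
      using keys_a by blast
    then show "is_partition mu"
      by (simp add: is_partition_raised)
    show "regular_at (lookup a mu) (of_nat n)" for n :: nat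
      using M by (simp add: a_raised reg_h)
  next
    show "F = (\<Sum>mu\<in>keys a. smul (lookup a mu) (psum mu))"
      using expand[of "\<lambda>x. x"] by (simp add: F_def)
  next
    fix n :: nat assume n: "0 < n"
    let ?v = "X_minus n lam (vac (- int s))"
    have "M \<in> W \<and> l = int s" if "lookup ?v (M, l) \<noteq> 0" for M l
    proof -
      have "l = int s" "rf_value (alpha_var ^ s * g M) (of_nat n) \<noteq> 0"
        using that by (simp_all add: g(4)[OF n] split: if_splits)
      then show ?thesis
        using g(1)[of M] by (cases "weight M = sum_list lam") (auto simp: W_def)
    qed
    then have "T ?v = (\<Sum>M\<in>W. smul (lookup ?v (M, int s)) (psum (raised M)))"
      by (rule T_eq_sum[OF finW])
    then have "smul (inverse (c_const s n)) (T ?v) =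
        (\<Sum>M\<in>W. smul (of_rat (rf_value (h M) (of_nat n))) (psum (raised M)))"
      by (simp add: smul_sum_right smul_smul g(4)[OF n] h_def flip: mult.assoc)
    then show "(\<Sum>mu\<in>keys a. smul (of_rat (rf_value (lookup a mu) (of_nat n))) (psum mu)) =
        smul (inverse (c_const (length lam) n)) (T (X_minus n lam (vac (- int (length lam)))))"
      using expand[of "\<lambda>f. of_rat (rf_value f (of_nat n)) :: complex"] by (simp add: s_def)
  qed
  then have "X_prime lam = F"
    unfolding X_prime_def using is_X_prime_unique by (intro the_equality) blast+
  then show ?thesis
    using g(1,2,3) by (intro exI[of _ g]) (simp add: F_def W_def h_def s_def)
qed

section \<open>Independence by specialisation at zero\<close>

text \<open>Divides out the largest common power of \<alpha>. While all polynomials vanish at 0, one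
  more factor \<alpha> can be removed, and the degree of the nonzero \<open>P j\<close>
  drops.\<close>

lemma normalise_polys_at_zero:
  fixes P :: "'i \<Rightarrow> rat poly"
  assumes "j \<in> S" "P j \<noteq> 0"
  shows "\<exists>e R. (\<forall>i\<in>S. P i = [:0, 1:] ^ e * R i) \<and> (\<exists>i\<in>S. poly (R i) 0 \<noteq> 0)"
  using assms
proof (induction "degree (P j)" arbitrary: P rule: less_induct)
  case less
  show ?case
  proof (cases "\<exists>i\<in>S. poly (P i) 0 \<noteq> 0")
    case True
    then show ?thesis
      by (intro exI[of _ 0] exI[of _ P]) simp
  next
    case False
    then have "\<forall>i\<in>S. \<exists>Q. P i = [:0, 1:] * Q"
      using poly_eq_0_iff_dvd[of _ 0] by (auto simp: dvd_def)
    then obtain Q where Q: "\<And>i. i \<in> S \<Longrightarrow> P i = [:0, 1:] * Q i"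
      by metis
    then have "Q j \<noteq> 0"
      using less.prems by auto
    then have "degree (Q j) < degree (P j)"
      using Q[OF less.prems(1)] by simp
    then obtain e R where R: "\<forall>i\<in>S. Q i = [:0, 1:] ^ e * R i" "\<exists>i\<in>S. poly (R i) 0 \<noteq> 0"
      using less.hyps[of Q] less.prems(1) \<open>Q j \<noteq> 0\<close> by blast
    have "\<forall>i\<in>S. P i = [:0, 1:] ^ Suc e * R i"
      using Q R(1) by (simp add: mult.assoc)
    then show ?thesis
      using R(2) by blast
  qed
qed

text \<open>Scales a linear relation so that it can be evaluated at \<alpha> = 0 without becoming
  trivial: denominators are cleared, then the common power of \<alpha> is removed.\<close>

lemma normalise_at_zero:
  fixes h :: "'i \<Rightarrow> ratfun"
  assumes "finite S" "j \<in> S" "h j \<noteq> 0"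
  shows "\<exists>q. (\<forall>i\<in>S. regular_at (q * h i) 0) \<and> (\<exists>i\<in>S. rf_value (q * h i) 0 \<noteq> 0)"
proof -
  have "\<forall>i. \<exists>a b. h i = Fract a b \<and> b \<noteq> 0"
    by (metis Fract_cases)
  then obtain a b where h: "\<And>i. h i = Fract (a i) (b i)" "\<And>i. b i \<noteq> 0"
    by metis
  define P where "P i = a i * (\<Prod>k\<in>S - {i}. b k)" for i
  define B where "B = (\<Prod>k\<in>S. b k)"
  have P: "to_fract B * h i = to_fract (P i)" if "i \<in> S" for i
    using h(2)[of i] assms(1) that
    by (simp add: h(1) B_def P_def to_fract_def prod.remove[of S i] eq_fract mult_ac)
  have "B \<noteq> 0"
    using h(2) assms(1) by (simp add: B_def)
  then have "P j \<noteq> 0"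
    using P[OF assms(2)] assms(3) by auto
  then obtain e R where R: "\<forall>i\<in>S. P i = [:0, 1:] ^ e * R i" "\<exists>i\<in>S. poly (R i) 0 \<noteq> 0"
    using normalise_polys_at_zero[of j S P] assms(2) by blast
  have power: "to_fract (p ^ m) = to_fract p ^ m" for p :: "rat poly" and m
    by (induction m) simp_all
  have "inverse (alpha_var ^ e) * to_fract B * h i = to_fract (R i)" if "i \<in> S" for i
  proof -
    have "to_fract B * h i = alpha_var ^ e * to_fract (R i)"
      using that R(1) P by (simp add: power alpha_var_def)
    then show ?thesis
      by (simp add: mult.assoc)
  qed
  then show ?thesis
    using R(2) by (intro exI[of _ "inverse (alpha_var ^ e) * to_fract B"]) simp
qed

text \<open>In a normalised relation take the longest \<mu> whose coefficient is nonzero at 0, and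
  read off p_\<mu> at \<alpha> = 0. Another \<lambda> either has coefficient 0 there or satisfies
  l(\<lambda>) <= l(\<mu>), in which case p_\<mu> has coefficient 0 by triangularity. Only the
  nonzero diagonal term remains.\<close>

lemma X_prime_independent:
  assumes "finite S" "\<And>lam. lam \<in> S \<Longrightarrow> is_partition lam"
    and zero: "(\<Sum>lam\<in>S. smul (c lam) (X_prime lam)) = 0"
  shows "\<forall>lam\<in>S. c lam = 0"
proof (rule ccontr)
  assume "\<not> (\<forall>lam\<in>S. c lam = 0)"
  then obtain lam0 where lam0: "lam0 \<in> S" "c lam0 \<noteq> 0"
    by blast
  define expands where "expands lam g \<longleftrightarrow> (\<forall>M. weight M \<noteq> sum_list lam \<longrightarrow> g M = 0) \<and>
    (\<forall>M. regular_at (g M) 0) \<and>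
    (\<forall>M. size M \<ge> length lam \<longrightarrow> (rf_value (g M) 0 \<noteq> 0 \<longleftrightarrow> M = lowered lam)) \<and>
    X_prime lam = (\<Sum>M | weight M = sum_list lam.
      smul (alpha_var ^ length lam * g M) (psum (raised M)))" for lam g
  have "\<forall>lam\<in>S. \<exists>g. expands lam g"
    unfolding expands_def using X_prime_expansion assms(2) by simp
  then obtain g where g: "\<And>lam. lam \<in> S \<Longrightarrow> expands lam (g lam)"
    by metis
  have g_0: "g lam M = 0" if "lam \<in> S" "weight M \<noteq> sum_list lam" for lam M
    using g[OF that(1)] that(2) by (simp add: expands_def)
  have g_reg: "regular_at (g lam M) 0" if "lam \<in> S" for lam M
    using g[OF that] by (simp add: expands_def)
  have g_lead: "rf_value (g lam M) 0 \<noteq> 0 \<longleftrightarrow> M = lowered lam"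
    if "lam \<in> S" "size M \<ge> length lam" for lam M
    using g[OF that(1)] that(2) by (simp add: expands_def)
  have X: "X_prime lam = (\<Sum>M | weight M = sum_list lam.
      smul (alpha_var ^ length lam * g lam M) (psum (raised M)))" if "lam \<in> S" for lam
    using g[OF that] by (simp add: expands_def)
  \<comment> \<open>The powers \<alpha>^l(\<lambda>) are absorbed into the unknown coefficients
    before normalising, since it is \<open>g\<close> that is triangular at 0.\<close>
  define h where "h lam = c lam * alpha_var ^ length lam" for lam
  define U where "U = (\<Union>lam\<in>S. {M. weight M = sum_list lam})"
  have finU: "finite U"
    using assms(1) by (simp add: U_def finite_weight_eq)
  have "smul (c lam) (X_prime lam) = (\<Sum>M\<in>U. smul (h lam * g lam M) (psum (raised M)))"
    if lam: "lam \<in> S" for lam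
  proof -
    have "smul (c lam) (X_prime lam) =
        (\<Sum>M | weight M = sum_list lam. smul (h lam * g lam M) (psum (raised M)))"
      by (simp add: X[OF lam] smul_sum_right smul_smul h_def mult.assoc)
    also have "\<dots> = (\<Sum>M\<in>U. smul (h lam * g lam M) (psum (raised M)))"
      using finU lam g_0[OF lam] by (intro sum.mono_neutral_left) (auto simp: U_def)
    finally show ?thesis .
  qed
  then have "(\<Sum>lam\<in>S. \<Sum>M\<in>U. smul (h lam * g lam M) (psum (raised M))) = 0"
    using zero by simp
  then have "(\<Sum>M\<in>U. smul (\<Sum>lam\<in>S. h lam * g lam M) (psum (raised M))) = 0"
    by (subst (asm) sum.swap) (simp add: smul_sum_left)
  then have "(\<Sum>mu\<in>raised ` U. smul (\<Sum>lam\<in>S. h lam * g lam (lowered mu)) (psum mu)) = 0"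
    by (subst sum.reindex) (auto simp: lowered_raised intro: inj_on_subset[OF inj_raised])
  then have "\<forall>mu\<in>raised ` U. (\<Sum>lam\<in>S. h lam * g lam (lowered mu)) = 0"
    using finU by (intro psum_independent) (auto simp: is_partition_raised)
  then have eq: "(\<Sum>lam\<in>S. h lam * g lam M) = 0" if "M \<in> U" for M
    using that by (auto simp: lowered_raised)
  have "h lam0 \<noteq> 0"
    using lam0 by (simp add: h_def)
  then obtain q where q: "\<And>lam. lam \<in> S \<Longrightarrow> regular_at (q * h lam) 0"
    "\<exists>lam\<in>S. rf_value (q * h lam) 0 \<noteq> 0"
    using normalise_at_zero[OF assms(1) lam0(1)] by blast
  define N where "N = {lam \<in> S. rf_value (q * h lam) 0 \<noteq> 0}"
  have "finite N" "N \<noteq> {}"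
    using assms(1) q(2) by (auto simp: N_def)
  then have "Max (length ` N) \<in> length ` N"
    by (intro Max_in) auto
  then obtain mu where mu: "mu \<in> N" "length mu = Max (length ` N)"
    by auto
  have longest: "length lam \<le> length mu" if "lam \<in> N" for lam
    unfolding mu(2) using \<open>finite N\<close> that by (intro Max_ge) auto
  have muS: "mu \<in> S"
    using mu by (simp add: N_def)
  define M where "M = lowered mu"
  have "raised M = mu"
    using raised_lowered assms(2) muS by (simp add: M_def)
  then have "weight M = sum_list mu"
    by (metis sum_list_raised)
  then have "M \<in> U"
    using muS by (auto simp: U_def)
  have vanish: "rf_value (q * h lam * g lam M) 0 = 0" if lam: "lam \<in> S - {mu}" for lam
  proof (cases "lam \<in> N")
    case True
    have "lowered lam \<noteq> M"
      using raised_lowered[of lam] raised_lowered[of mu] assms(2) lam muS by (auto simp: M_def)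
    then have "rf_value (g lam M) 0 = 0"
      using g_lead[of lam M] longest[OF True] lam by (auto simp: M_def)
    then show ?thesis
      using q(1) g_reg lam by (simp add: rf_value_mult)
  next
    case False
    then show ?thesis
      using q(1) g_reg lam by (simp add: rf_value_mult N_def)
  qed
  have "0 = rf_value (q * (\<Sum>lam\<in>S. h lam * g lam M)) 0"
    by (simp add: eq[OF \<open>M \<in> U\<close>])
  also have "\<dots> = (\<Sum>lam\<in>S. rf_value (q * h lam * g lam M) 0)"
    unfolding sum_distrib_left mult.assoc[symmetric]
    by (rule rf_value_sum) (simp add: regular_at_mult q(1) g_reg)
  also have "\<dots> = rf_value (q * h mu * g mu M) 0"
  proof -
    have "(\<Sum>lam\<in>S - {mu}. rf_value (q * h lam * g lam M) 0) = 0"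
      using vanish by (intro sum.neutral) blast
    then show ?thesis
      using muS assms(1) by (simp add: sum.remove[of S mu])
  qed
  also have "\<dots> = rf_value (q * h mu) 0 * rf_value (g mu M) 0"
    by (rule rf_value_mult[OF q(1)[OF muS] g_reg[OF muS]])
  finally show False
    using mu(1) g_lead[OF muS, of M] by (simp add: N_def M_def)
qed

lemma X_prime_in_sym_upto:
  assumes "is_partition lam"
  shows "X_prime lam \<in> sym_upto (sum_list lam)"
proof -
  interpret vs: vector_space "smul :: ratfun \<Rightarrow> ratfun series \<Rightarrow> ratfun series"
    by (rule vector_space_smul)
  obtain g where "X_prime lam = (\<Sum>M | weight M = sum_list lam.
      smul (alpha_var ^ length lam * g M) (psum (raised M)))"
    using X_prime_expansion[OF assms] by blast
  moreover have "psum (raised M) \<in> sym_upto (sum_list lam)" if "weight M = sum_list lam" for M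
    using is_partition_raised[of M] that
    by (intro psum_in_sym_upto) (auto simp: is_partition_def sum_list_raised)
  ultimately show ?thesis
    by (auto intro!: vs.subspace_sum[OF sym_upto_subspace] vs.subspace_scale[OF sym_upto_subspace])
qed

theorem theorem3p14:
  shows "inj_on X_prime {lam. is_partition lam} \<and>
    \<not> module.dependent smul (X_prime ` {lam. is_partition lam}) \<and>
    module.span smul (X_prime ` {lam. is_partition lam}) =
      (symmetric_functions :: ratfun series set)"
  using symmetric_functions_basisI[of X_prime] X_prime_in_sym_upto X_prime_independent by blast

end
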